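(* Every ordinal space is homeomorphic to one of the following ordinal spaces: (1) $\emptyset$ or $k$; (2) $\omega^\alpha\cdot k+1$; (3) $\omega^\alpha\cdot k$; (4) $\omega^\alpha\cdot k+\omega^\beta$; where $k$ is a nonzero natural number, $\alpha$ is a nonzero ordinal and, in case (4), $\beta$ is a nonzero ordinal with $\beta<\alpha$. Moreover, this list has no redundancy: no space in one of these four families is homeomorphic to a space in another family, and within each family, distinct parameter values ($k$, $\alpha$, $\beta$) give non-homeomorphic spaces.
   Context: An ordinal space is an ordinal $\gamma=\{\delta:\delta<\gamma\}$ endowed with its order topology. Ordinal arithmetic (addition, multiplication, exponentiation) is the standard one, continuous in the right argument. *)

theory Defs
  imports "HOL-Analysis.Analysis"
begin

text \<open>Ordinals are represented by well-orders (reflexive, in the sense of Main's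
  BNF_Wellorder theories) on arbitrary types; isomorphism of ordinals is ordIso
  (written =o) and the strict order of ordinals is ordLess (written <o).\<close>

definition ord_space :: "'a rel \<Rightarrow> 'a topology" where
  "ord_space r = topology_generated_by
     (insert (Field r)
       ({{x \<in> Field r. (x, a) \<in> r \<and> x \<noteq> a} | a. a \<in> Field r} \<union>
        {{x \<in> Field r. (a, x) \<in> r \<and> x \<noteq> a} | a. a \<in> Field r}))"

definition fin_ord :: "nat \<Rightarrow> nat rel" where
  "fin_ord k = {(i, j). i \<le> j \<and> j < k}"

definition one_ord :: "unit rel" where
  "one_ord = {((), ())}"

definition osum :: "'a rel \<Rightarrow> 'b rel \<Rightarrow> ('a + 'b) rel" where
  "osum r s = {(Inl a, Inl a') | a a'. (a, a') \<in> r}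
            \<union> {(Inr b, Inr b') | b b'. (b, b') \<in> s}
            \<union> {(Inl a, Inr b) | a b. a \<in> Field r \<and> b \<in> Field s}"

definition oprod :: "'a rel \<Rightarrow> 'b rel \<Rightarrow> ('a \<times> 'b) rel" where
  "oprod r s = {((a, b), (a', b')). a \<in> Field r \<and> a' \<in> Field r \<and> b \<in> Field s \<and> b' \<in> Field s \<and>
                  ((b \<noteq> b' \<and> (b, b') \<in> s) \<or> (b = b' \<and> (a, a') \<in> r))}"

text \<open>Ordinal exponentiation \<omega>^\<alpha>, in its standard (Cantor normal form) realisation:
  finitely supported functions from the field of \<alpha> to \<omega>, compared at the
  \<alpha>-largest argument where they differ.\<close>
definition omega_exp :: "'a rel \<Rightarrow> ('a \<Rightarrow> nat) rel" where
  "omega_exp \<alpha> =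
    {(f, g). finite {x. f x \<noteq> 0} \<and> {x. f x \<noteq> 0} \<subseteq> Field \<alpha> \<and>
             finite {x. g x \<noteq> 0} \<and> {x. g x \<noteq> 0} \<subseteq> Field \<alpha> \<and>
             (f = g \<or> (\<exists>x. f x < g x \<and> (\<forall>y. f y \<noteq> g y \<longrightarrow> (y, x) \<in> \<alpha>)))}"

definition nf1 :: "nat \<Rightarrow> nat topology" where
  "nf1 k = ord_space (fin_ord k)"

definition nf2 :: "'a rel \<Rightarrow> nat \<Rightarrow> ((('a \<Rightarrow> nat) \<times> nat) + unit) topology" where
  "nf2 \<alpha> k = ord_space (osum (oprod (omega_exp \<alpha>) (fin_ord k)) one_ord)"

definition nf3 :: "'a rel \<Rightarrow> nat \<Rightarrow> (('a \<Rightarrow> nat) \<times> nat) topology" where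
  "nf3 \<alpha> k = ord_space (oprod (omega_exp \<alpha>) (fin_ord k))"

definition nf4 :: "'a rel \<Rightarrow> 'a rel \<Rightarrow> nat \<Rightarrow> ((('a \<Rightarrow> nat) \<times> nat) + ('a \<Rightarrow> nat)) topology" where
  "nf4 \<alpha> \<beta> k = ord_space (osum (oprod (omega_exp \<alpha>) (fin_ord k)) (omega_exp \<beta>))"

definition ok23 :: "'a rel \<Rightarrow> nat \<Rightarrow> bool" where
  "ok23 \<alpha> k \<longleftrightarrow> Well_order \<alpha> \<and> Field \<alpha> \<noteq> {} \<and> 0 < k"

definition ok4 :: "'a rel \<Rightarrow> 'a rel \<Rightarrow> nat \<Rightarrow> bool" where
  "ok4 \<alpha> \<beta> k \<longleftrightarrow> Well_order \<alpha> \<and> Well_order \<beta> \<and> Field \<alpha> \<noteq> {} \<and> Field \<beta> \<noteq> {} \<and> (\<beta>, \<alpha>) \<in> ordLess \<and> 0 < k"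

end

theory Submission
  imports Defs "HOL-Library.Multiset"
begin

text \<open>All spaces are studied inside \<open>\<omega>\<^sup>r\<close>, realised as finitely supported functions (Cantor normal
  forms). An ordinal \<open>\<gamma>\<close> embeds into \<open>\<omega>\<^sup>\<gamma>\<close>, so it is either \<open>\<omega>\<^sup>\<gamma>\<close> itself or the set of
  normal forms below some \<open>f\<close>. If \<open>\<omega>\<^sup>a k\<close> is the leading term of \<open>f\<close> and \<open>\<omega>\<^sup>b\<close> its last one,
  with \<open>b < a\<close>, then \<open>f = \<delta> + \<omega>\<^sup>b\<close>, and absorption \<open>h + \<omega>\<^sup>a k = \<omega>\<^sup>a k\<close> lets one rearrange clopen
  blocks to identify \<open>[0, \<delta>]\<close> with \<open>[0, \<omega>\<^sup>a k]\<close>; hence \<open>f\<close> is homeomorphic to \<open>\<omega>\<^sup>a k + \<omega>\<^sup>b\<close>,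
  which is family (4), or family (2) when \<open>b = 0\<close>.

  For non-redundancy, the Cantor-Bendixson rank of a normal form is its smallest exponent. Ranks
  are characterised by a local condition which determines them without transfinite recursion, so
  the following are homeomorphism invariants: the ranks attained infinitely often (of type
  \<open>\<alpha>\<close>), those among them for which the points of at least that rank do not form a compact set
  (of type \<open>0\<close>, \<open>\<alpha>\<close>, \<open>\<beta>\<close> in families (2), (3), (4)), and the number of remaining points
  (\<open>k\<close>, \<open>k - 1\<close>, \<open>k\<close>).\<close>

subsection \<open>Order topologies of well-orders\<close>

text \<open>Working inside one host order turns ordinal arithmetic up to isomorphism into operations
  on functions: addition is \<open>cnf_add\<close>, and homeomorphisms become statements about
  intervals of a single space. No separate existence proof of normal forms is needed, because
  comparing \<gamma> with \<open>\<omega>\<^sup>\<gamma>\<close> already produces one. Translation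
  by h is continuous but may fail to be open at 0, as the isolated point 0 goes to h, which can be a
  limit. This is why the block moves keep {0} apart. For uniqueness the exponents are taken in
  \<alpha> + 1, where \<open>\<omega>\<^sup>\<alpha> k\<close> is itself a one-term normal form
  bounding a segment. Two spaces then carry ranks in unrelated well-orders on different types. One
  of these embeds into the other, and uniqueness of rank functions identifies the values. The top
  rank \<alpha> is the only one attained finitely often, so that counting fibres recovers \<alpha>
  as an order and the number of top points as a number, without reference to the host.\<close>

lemma topspace_ord_space [simp]: "topspace (ord_space r) = Field r"
  unfolding ord_space_def topology_generated_by_topspace by auto

context
  fixes r :: "'a rel"
  assumes WO: "Well_order r"
begin

lemma wor: "wo_rel r"
  by (simp add: wo_rel_def WO)

lemma wo_trans: "(x, y) \<in> r \<Longrightarrow> (y, z) \<in> r \<Longrightarrow> (x, z) \<in> r"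
  using wo_rel.TRANS[OF wor] by (meson transD)

lemma wo_antisym: "(x, y) \<in> r \<Longrightarrow> (y, x) \<in> r \<Longrightarrow> x = y"
  using wo_rel.ANTISYM[OF wor] by (meson antisymD)

lemma wo_refl: "x \<in> Field r \<Longrightarrow> (x, x) \<in> r"
  using wo_rel.REFL[OF wor] by (meson refl_onD)

lemma wo_linear: "x \<in> Field r \<Longrightarrow> y \<in> Field r \<Longrightarrow> (x, y) \<in> r \<or> (y, x) \<in> r"
  using wo_rel.TOTALS[OF wor] by blast

lemma wo_Restr_underS: "Field (Restr r (underS r a)) = underS r a"
  using Refl_Field_Restr2[OF wo_rel.REFL[OF wor]] Order_Relation.underS_Field[of r a] by metis

text \<open>One-sided neighbourhoods \<open>(a, x]\<close> suffice because in a well-order a point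
  that is not the maximum has an immediate successor, so nothing above x needs to be
  included.\<close>

lemma openin_ord_space:
  "openin (ord_space r) U \<longleftrightarrow> U \<subseteq> Field r \<and>
    (\<forall>x\<in>U. underS r x = {} \<or> (\<exists>a\<in>underS r x. \<forall>y. (a, y) \<in> r \<and> a \<noteq> y \<and> (y, x) \<in> r \<longrightarrow> y \<in> U))"
  (is "_ \<longleftrightarrow> ?R U")
proof
  let ?B = "insert (Field r)
       ({{x \<in> Field r. (x, a) \<in> r \<and> x \<noteq> a} | a. a \<in> Field r} \<union>
        {{x \<in> Field r. (a, x) \<in> r \<and> x \<noteq> a} | a. a \<in> Field r})"
  assume "openin (ord_space r) U"
  then have "generate_topology_on ?B U"
    by (simp add: ord_space_def openin_topology_generated_by_iff)
  then show "?R U"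
  proof induction
    case Empty
    then show ?case by simp
  next
    case (Int A B)
    have "\<exists>c\<in>underS r x. \<forall>y. (c, y) \<in> r \<and> c \<noteq> y \<and> (y, x) \<in> r \<longrightarrow> y \<in> A \<inter> B"
      if x: "x \<in> A \<inter> B" and ne: "underS r x \<noteq> {}" for x
    proof -
      obtain a where a: "a \<in> underS r x" "\<forall>y. (a, y) \<in> r \<and> a \<noteq> y \<and> (y, x) \<in> r \<longrightarrow> y \<in> A"
        using Int x ne by blast
      obtain b where b: "b \<in> underS r x" "\<forall>y. (b, y) \<in> r \<and> b \<noteq> y \<and> (y, x) \<in> r \<longrightarrow> y \<in> B"
        using Int x ne by blast
      have "a \<in> Field r" "b \<in> Field r"
        using a(1) b(1) Order_Relation.underS_Field[of r x] by auto
      then consider "(a, b) \<in> r" | "(b, a) \<in> r"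
        using wo_linear by blast
      then show ?thesis
      proof cases
        case 1
        then have "(a, y) \<in> r \<and> a \<noteq> y" if "(b, y) \<in> r" "b \<noteq> y" for y
          using that wo_trans wo_antisym by metis
        then show ?thesis
          using a b by (intro bexI[of _ b]) auto
      next
        case 2
        then have "(b, y) \<in> r \<and> b \<noteq> y" if "(a, y) \<in> r" "a \<noteq> y" for y
          using that wo_trans wo_antisym by metis
        then show ?thesis
          using a b by (intro bexI[of _ a]) auto
      qed
    qed
    with Int show ?case by auto
  next
    case (UN K)
    then have sub: "\<Union> K \<subseteq> Field r" by blast
    have "\<exists>a\<in>underS r x. \<forall>y. (a, y) \<in> r \<and> a \<noteq> y \<and> (y, x) \<in> r \<longrightarrow> y \<in> \<Union> K"
      if x: "x \<in> k" "k \<in> K" and ne: "underS r x \<noteq> {}" for x k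
    proof -
      obtain a where "a \<in> underS r x" "\<forall>y. (a, y) \<in> r \<and> a \<noteq> y \<and> (y, x) \<in> r \<longrightarrow> y \<in> k"
        using UN x ne by blast
      then show ?thesis using x(2) by blast
    qed
    with sub show ?case by blast
  next
    case (Basis s)
    then consider "s = Field r" | a where "s = {x \<in> Field r. (x, a) \<in> r \<and> x \<noteq> a}" "a \<in> Field r"
      | a where "s = {x \<in> Field r. (a, x) \<in> r \<and> x \<noteq> a}" "a \<in> Field r"
      by blast
    then show ?case
    proof cases
      case 1
      have "underS r x \<noteq> {} \<Longrightarrow> \<exists>a\<in>underS r x. \<forall>y. (a, y) \<in> r \<and> a \<noteq> y \<and> (y, x) \<in> r \<longrightarrow> y \<in> s" for x
        using 1 by (auto intro: FieldI2)
      then show ?thesis using 1 by blast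
    next
      case 2
      have "y \<in> s" if "x \<in> s" "(y, x) \<in> r" for x y
        using that 2 wo_trans wo_antisym FieldI1 by (smt (verit) mem_Collect_eq)
      then show ?thesis using 2 by blast
    next
      case 3
      then show ?thesis by (auto simp: underS_def FieldI2)
    qed
  qed
next
  assume R: "?R U"
  have left: "openin (ord_space r) {x \<in> Field r. (x, a) \<in> r \<and> x \<noteq> a}" if "a \<in> Field r" for a
    unfolding ord_space_def by (rule topology_generated_by_Basis) (use that in auto)
  have right: "openin (ord_space r) {x \<in> Field r. (a, x) \<in> r \<and> x \<noteq> a}" if "a \<in> Field r" for a
    unfolding ord_space_def by (rule topology_generated_by_Basis) (use that in auto)
  have full: "openin (ord_space r) (Field r)"
    using openin_topspace[of "ord_space r"] by simp
  \<comment> \<open>The initial segment up to x is the whole field if x is the maximum, and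
    otherwise the open ray below the successor of x.\<close>
  have under: "openin (ord_space r) (under r x)" if x: "x \<in> Field r" for x
  proof (cases "AboveS r {x} = {}")
    case True
    have "(y, x) \<in> r" if "y \<in> Field r" for y
    proof (rule ccontr)
      assume "(y, x) \<notin> r"
      then have "(x, y) \<in> r" "y \<noteq> x"
        using that x wo_linear wo_refl by auto
      then show False using True that by (auto simp: AboveS_def)
    qed
    then have "under r x = Field r"
      by (auto simp: under_def intro: FieldI1)
    then show ?thesis using full by simp
  next
    case False
    let ?s = "wo_rel.suc r {x}"
    have suc: "(x, ?s) \<in> r" "x \<noteq> ?s" "?s \<in> Field r"
      using wo_rel.suc_greater[OF wor, of "{x}" x] wo_rel.suc_inField[OF wor, of "{x}"] False x by auto
    have "under r x = {y \<in> Field r. (y, ?s) \<in> r \<and> y \<noteq> ?s}"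
    proof (intro set_eqI iffI)
      fix y assume "y \<in> under r x"
      then have y: "(y, x) \<in> r" by (simp add: under_def)
      have "(y, ?s) \<in> r" using y suc(1) by (rule wo_trans)
      moreover have "y \<noteq> ?s" using y suc(1,2) wo_antisym by blast
      ultimately show "y \<in> {y \<in> Field r. (y, ?s) \<in> r \<and> y \<noteq> ?s}"
        using FieldI1[OF y] by simp
    next
      fix y assume y: "y \<in> {y \<in> Field r. (y, ?s) \<in> r \<and> y \<noteq> ?s}"
      show "y \<in> under r x"
      proof (rule ccontr)
        assume "y \<notin> under r x"
        then have "(x, y) \<in> r" "x \<noteq> y"
          using y x wo_linear wo_refl by (auto simp: under_def)
        then have "y \<in> AboveS r {x}"
          using y by (auto simp: AboveS_def)
        then have "(?s, y) \<in> r"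
          using wo_rel.suc_least_AboveS[OF wor] by blast
        then show False using y wo_antisym by blast
      qed
    qed
    then show ?thesis using left suc by simp
  qed
  show "openin (ord_space r) U"
  proof (subst openin_subopen, intro ballI)
    fix x assume x: "x \<in> U"
    then have xF: "x \<in> Field r" using R by auto
    consider "underS r x = {}" | a where "a \<in> underS r x" "\<forall>y. (a, y) \<in> r \<and> a \<noteq> y \<and> (y, x) \<in> r \<longrightarrow> y \<in> U"
      using R x by blast
    then show "\<exists>T. openin (ord_space r) T \<and> x \<in> T \<and> T \<subseteq> U"
    proof cases
      case 1
      then have "under r x = {x}"
        using Refl_under_underS[OF wo_rel.REFL[OF wor] xF] by auto
      then show ?thesis using under[OF xF] x by (intro exI[of _ "{x}"]) auto
    next
      case 2
      have aF: "a \<in> Field r" using 2 Order_Relation.underS_Field[of r x] by auto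
      have "openin (ord_space r) (under r x \<inter> {y \<in> Field r. (a, y) \<in> r \<and> y \<noteq> a})"
        using under[OF xF] right[OF aF] by blast
      moreover have "x \<in> under r x \<inter> {y \<in> Field r. (a, y) \<in> r \<and> y \<noteq> a}"
        using 2 xF wo_refl by (auto simp: under_def underS_def)
      moreover have "under r x \<inter> {y \<in> Field r. (a, y) \<in> r \<and> y \<noteq> a} \<subseteq> U"
        using 2 by (auto simp: under_def)
      ultimately show ?thesis by blast
    qed
  qed
qed

end

context
  fixes r :: "'a rel"
  assumes WO: "Well_order r"
begin

lemma openin_ord_space_downward:
  assumes "U \<subseteq> Field r" "\<And>x y. x \<in> U \<Longrightarrow> (y, x) \<in> r \<Longrightarrow> y \<in> U"
  shows "openin (ord_space r) U"
  unfolding openin_ord_space[OF WO] using assms by blast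

lemma openin_under: "openin (ord_space r) (under r x)"
proof (rule openin_ord_space_downward)
  show "z \<in> under r x" if "y \<in> under r x" "(z, y) \<in> r" for y z
    using that wo_trans[OF WO, of z y x] by (simp add: under_def)
qed (rule under_Field)

lemma openin_underS: "openin (ord_space r) (underS r x)"
proof (rule openin_ord_space_downward)
  show "z \<in> underS r x" if "y \<in> underS r x" "(z, y) \<in> r" for y z
    using that wo_trans[OF WO, of z y x] wo_antisym[OF WO, of z x] wo_antisym[OF WO, of y x]
    unfolding underS_def by blast
qed (rule Order_Relation.underS_Field)

text \<open>Intervals \<open>(b, x]\<close> with x below \<open>a\<close> are the same in both
  orders, so the criterion \<open>openin_ord_space\<close> reads identically on the segment.\<close>

lemma ord_space_Restr_underS:
  "ord_space (Restr r (underS r a)) = subtopology (ord_space r) (underS r a)"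
proof (rule topology_eq[THEN iffD2], intro allI)
  fix U
  let ?s = "Restr r (underS r a)"
  have WOs: "Well_order ?s" by (rule Well_order_Restr[OF WO])
  have F: "Field ?s = underS r a" by (rule wo_Restr_underS[OF WO])
  have *: "y \<in> underS r a" if "x \<in> underS r a" "(y, x) \<in> r" for x y
    using that wo_trans[OF WO, of y x a] wo_antisym[OF WO, of x a] unfolding underS_def by blast
  have u: "underS ?s x = underS r x" if "x \<in> underS r a" for x
    using *[OF that] that unfolding underS_def by blast
  have "openin (subtopology (ord_space r) (underS r a)) U
      \<longleftrightarrow> openin (ord_space r) U \<and> U \<subseteq> underS r a"
    using openin_underS by (simp add: openin_open_subtopology)
  also have "\<dots> \<longleftrightarrow> openin (ord_space ?s) U"
  proof (cases "U \<subseteq> underS r a")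
    case True
    have eq: "(\<forall>y. (b, y) \<in> r \<and> b \<noteq> y \<and> (y, x) \<in> r \<longrightarrow> y \<in> U) \<longleftrightarrow>
          (\<forall>y. (b, y) \<in> ?s \<and> b \<noteq> y \<and> (y, x) \<in> ?s \<longrightarrow> y \<in> U)"
      if "x \<in> U" "b \<in> underS r x" for b x
    proof -
      have "x \<in> underS r a" using that True by auto
      moreover from this have "b \<in> underS r a" using that *[of x b] by (simp add: underS_def)
      ultimately show ?thesis using * by blast
    qed
    have "(underS r x = {} \<or> (\<exists>b\<in>underS r x. \<forall>y. (b, y) \<in> r \<and> b \<noteq> y \<and> (y, x) \<in> r \<longrightarrow> y \<in> U)) \<longleftrightarrow>
      (underS ?s x = {} \<or> (\<exists>b\<in>underS ?s x. \<forall>y. (b, y) \<in> ?s \<and> b \<noteq> y \<and> (y, x) \<in> ?s \<longrightarrow> y \<in> U))"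
      if "x \<in> U" for x
    proof -
      have "underS ?s x = underS r x" using u True that by blast
      then show ?thesis using eq[OF that] by (metis (no_types, lifting))
    qed
    moreover have "U \<subseteq> Field r" using True Order_Relation.underS_Field[of r a] by blast
    ultimately show ?thesis
      unfolding openin_ord_space[OF WO] openin_ord_space[OF WOs] F using True by (simp cong: ball_cong)
  next
    case False
    then show ?thesis
      unfolding openin_ord_space[OF WOs] F by blast
  qed
  finally show "openin (ord_space ?s) U \<longleftrightarrow> openin (subtopology (ord_space r) (underS r a)) U" ..
qed

text \<open>Transfinite induction: a member of the cover that contains x contains some
  \<open>(a, x]\<close>, and the induction hypothesis covers what is left, the points up to
  a.\<close>

lemma compactin_under: "compactin (ord_space r) (under r x)"
proof (cases "x \<in> Field r")
  case False
  then have "under r x = {}" by (auto simp: under_def intro: FieldI2)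
  then show ?thesis by simp
next
  case True
  then show ?thesis
  proof (induction x rule: wo_rel.well_order_induct[OF wo_rel.intro[OF WO]])
    case (1 x)
    show ?case
    proof (cases "underS r x = {}")
      case True
      then have "under r x = {x}"
        using Refl_under_underS[OF wo_rel.REFL[OF wo_rel.intro[OF WO]] 1(2)] by simp
      then show ?thesis using 1 by simp
    next
      case ne: False
      show ?thesis
        unfolding compactin_def
      proof (intro conjI allI impI)
        show "under r x \<subseteq> topspace (ord_space r)" by (simp add: under_Field)
        fix \<U> assume U: "Ball \<U> (openin (ord_space r)) \<and> under r x \<subseteq> \<Union> \<U>"
        have "x \<in> under r x" using 1(2) wo_rel.REFL[OF wo_rel.intro[OF WO]] by (simp add: Refl_under_in)
        then obtain V where V: "V \<in> \<U>" "x \<in> V" "openin (ord_space r) V" using U by blast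
        then obtain a where a: "a \<in> underS r x" "\<forall>y. (a, y) \<in> r \<and> a \<noteq> y \<and> (y, x) \<in> r \<longrightarrow> y \<in> V"
          using ne unfolding openin_ord_space[OF WO] by blast
        have aF: "a \<in> Field r" using a Order_Relation.underS_Field[of r x] by auto
        have "compactin (ord_space r) (under r a)"
          using 1(1) a aF by (auto simp: underS_def)
        moreover have "under r a \<subseteq> under r x"
          using a wo_trans[OF WO, of _ a x] unfolding under_def underS_def by blast
        ultimately obtain \<F> where F: "finite \<F>" "\<F> \<subseteq> \<U>" "under r a \<subseteq> \<Union> \<F>"
          using U unfolding compactin_def by (meson subset_trans)
        have "under r x \<subseteq> \<Union> (insert V \<F>)"
        proof
          fix y assume y: "y \<in> under r x"
          then have "y \<in> Field r" using under_Field[of r x] by auto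
          then have "y \<in> under r a \<or> ((a, y) \<in> r \<and> a \<noteq> y)"
            using aF wo_linear[OF WO] wo_refl[OF WO] by (auto simp: under_def)
          then show "y \<in> \<Union> (insert V \<F>)"
            using F(3) a(2) y by (auto simp: under_def)
        qed
        then show "\<exists>\<F>. finite \<F> \<and> \<F> \<subseteq> \<U> \<and> under r x \<subseteq> \<Union> \<F>"
          using F V by (intro exI[of _ "insert V \<F>"]) auto
      qed
    qed
  qed
qed

end

section \<open>Constructing homeomorphisms: order isomorphisms and gluing\<close>

lemma homeomorphic_ord_space:
  assumes bij: "bij_betw \<phi> (Field r) (Field s)"
    and ord: "\<And>x y. x \<in> Field r \<Longrightarrow> y \<in> Field r \<Longrightarrow> (x, y) \<in> r \<longleftrightarrow> (\<phi> x, \<phi> y) \<in> s"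
  shows "ord_space r homeomorphic_space ord_space s"
proof -
  \<comment> \<open>Preimages of subbasic rays are rays. The claim is made for arbitrary relations
    so that it also yields continuity of the inverse map.\<close>
  have cont: "continuous_map (ord_space r) (ord_space s) \<phi>"
    if bij: "bij_betw \<phi> (Field r) (Field s)"
      and ord: "\<And>x y. x \<in> Field r \<Longrightarrow> y \<in> Field r \<Longrightarrow> (x, y) \<in> r \<longleftrightarrow> (\<phi> x, \<phi> y) \<in> s"
    for r :: "'x rel" and s :: "'y rel" and \<phi>
  proof -
    have B: "openin (ord_space r) {x \<in> Field r. (x, a) \<in> r \<and> x \<noteq> a}"
      "openin (ord_space r) {x \<in> Field r. (a, x) \<in> r \<and> x \<noteq> a}" if "a \<in> Field r" for a
      unfolding ord_space_def by (rule topology_generated_by_Basis; use that in auto)+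
    have F: "openin (ord_space r) (Field r)"
      using openin_topspace[of "ord_space r"] by simp
    have im: "\<phi> x \<in> Field s" if "x \<in> Field r" for x
      using bij that by (auto simp: bij_betw_def)
    have 1: "\<phi> -` {x \<in> Field s. (x, b) \<in> s \<and> x \<noteq> b} \<inter> Field r
             = {x \<in> Field r. (x, a) \<in> r \<and> x \<noteq> a}"
      "\<phi> -` {x \<in> Field s. (b, x) \<in> s \<and> x \<noteq> b} \<inter> Field r
             = {x \<in> Field r. (a, x) \<in> r \<and> x \<noteq> a}"
      if "a \<in> Field r" "b = \<phi> a" for a b
      using that ord im bij by (auto simp: bij_betw_def inj_on_def)
    have "openin (ord_space r) (\<phi> -` U \<inter> Field r)"
      if "U \<in> insert (Field s)
         ({{x \<in> Field s. (x, a) \<in> s \<and> x \<noteq> a} | a. a \<in> Field s} \<union>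
          {{x \<in> Field s. (a, x) \<in> s \<and> x \<noteq> a} | a. a \<in> Field s})" for U
    proof -
      consider "U = Field s" | b where "b \<in> Field s" "U = {x \<in> Field s. (x, b) \<in> s \<and> x \<noteq> b}"
        | b where "b \<in> Field s" "U = {x \<in> Field s. (b, x) \<in> s \<and> x \<noteq> b}"
        using \<open>U \<in> _\<close> by blast
      then show ?thesis
      proof cases
        case 1
        have "\<phi> -` Field s \<inter> Field r = Field r" using im by auto
        then show ?thesis using 1 F by simp
      next
        case 2
        then obtain a where "a \<in> Field r" "b = \<phi> a"
          using bij by (auto simp: bij_betw_def)
        then show ?thesis using 1(1) B(1) 2(2) by simp
      next
        case 3
        then obtain a where "a \<in> Field r" "b = \<phi> a"
          using bij by (auto simp: bij_betw_def)
        then show ?thesis using 1(2) B(2) 3(2) by simp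
      qed
    qed
    then have "continuous_map (ord_space r) (topology_generated_by (insert (Field s)
         ({{x \<in> Field s. (x, a) \<in> s \<and> x \<noteq> a} | a. a \<in> Field s} \<union>
          {{x \<in> Field s. (a, x) \<in> s \<and> x \<noteq> a} | a. a \<in> Field s}))) \<phi>"
      by (intro continuous_on_generated_topo) (auto simp: im)
    then show ?thesis by (simp only: ord_space_def[of s])
  qed
  let ?\<psi> = "inv_into (Field r) \<phi>"
  have b2: "bij_betw ?\<psi> (Field s) (Field r)" by (rule bij_betw_inv_into[OF bij])
  have p1: "?\<psi> (\<phi> x) = x" if "x \<in> Field r" for x
    using bij that by (simp add: bij_betw_def)
  have p2: "\<phi> (?\<psi> y) = y" "?\<psi> y \<in> Field r" if "y \<in> Field s" for y
    using bij that b2 by (auto simp: bij_betw_def f_inv_into_f)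
  have "continuous_map (ord_space s) (ord_space r) ?\<psi>"
    by (rule cont[OF b2]) (use ord p2 in metis)
  then show ?thesis
    unfolding homeomorphic_space_def homeomorphic_maps_def
    using cont[OF bij ord] p1 p2 by (intro exI[of _ \<phi>] exI[of _ ?\<psi>]) auto
qed

text \<open>On a total order a strictly increasing map is injective and reflects the order, so for
  the concrete maps on normal forms only monotonicity and surjectivity have to be checked.\<close>

lemma homeomorphic_ord_space_mono:
  assumes r: "Total r" "antisym r" "Refl r" and s: "antisym s"
    and surj: "\<phi> ` Field r = Field s"
    and mono: "\<And>x y. (x, y) \<in> r \<Longrightarrow> x \<noteq> y \<Longrightarrow> (\<phi> x, \<phi> y) \<in> s \<and> \<phi> x \<noteq> \<phi> y"
    and s_refl: "Refl s"
  shows "ord_space r homeomorphic_space ord_space s"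
proof (rule homeomorphic_ord_space)
  have tot: "(x, y) \<in> r \<or> (y, x) \<in> r" if "x \<in> Field r" "y \<in> Field r" "x \<noteq> y" for x y
    using r(1) that by (auto simp: total_on_def)
  show "bij_betw \<phi> (Field r) (Field s)"
    unfolding bij_betw_def inj_on_def using surj mono tot by metis
  fix x y assume xy: "x \<in> Field r" "y \<in> Field r"
  have fx: "(\<phi> x, \<phi> x) \<in> s" using s_refl surj xy by (metis imageI refl_onD)
  have rx: "(x, x) \<in> r" using r(3) xy by (metis refl_onD)
  show "(x, y) \<in> r \<longleftrightarrow> (\<phi> x, \<phi> y) \<in> s"
    using tot[OF xy] mono[of x y] mono[of y x] fx rx antisymD[OF s] by metis
qed

lemma continuous_map_openin_Un:
  assumes "openin X A" "openin X B" "topspace X \<subseteq> A \<union> B"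
    and "continuous_map (subtopology X A) Y h" "continuous_map (subtopology X B) Y h"
  shows "continuous_map X Y h"
proof -
  have 1: "openin X {x \<in> S. h x \<in> U}" if "openin X S" "continuous_map (subtopology X S) Y h" "openin Y U" for S U
  proof -
    have "openin (subtopology X S) {x \<in> topspace (subtopology X S). h x \<in> U}"
      using that by (simp add: continuous_map)
    moreover have "topspace (subtopology X S) = S"
      using openin_subset[OF that(1)] by auto
    ultimately show ?thesis using openin_open_subtopology[OF that(1)] by metis
  qed
  have AB: "A \<subseteq> topspace X" "B \<subseteq> topspace X"
    using assms openin_subset by blast+
  show ?thesis
    unfolding continuous_map
  proof (intro conjI allI impI)
    show "h ` topspace X \<subseteq> topspace Y"
    proof (intro image_subsetI)
      fix x assume "x \<in> topspace X"
      then have "x \<in> topspace (subtopology X A) \<or> x \<in> topspace (subtopology X B)"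
        using assms(3) by auto
      then show "h x \<in> topspace Y"
        using assms(4,5) unfolding continuous_map by blast
    qed
    fix U assume U: "openin Y U"
    have "{x \<in> topspace X. h x \<in> U} = {x \<in> A. h x \<in> U} \<union> {x \<in> B. h x \<in> U}"
      using assms(3) AB by auto
    then show "openin X {x \<in> topspace X. h x \<in> U}"
      using 1[OF assms(1,4) U] 1[OF assms(2,5) U] by auto
  qed
qed

text \<open>Continuity can be tested on the open pieces, and disjointness makes the case
  distinctions of the glued map and of its inverse correspond.\<close>

lemma homeomorphic_space_Un:
  assumes X: "openin X A" "openin X B" "A \<inter> B = {}" "A \<union> B = topspace X"
    and Y: "openin Y C" "openin Y D" "C \<inter> D = {}" "C \<union> D = topspace Y"
    and AC: "subtopology X A homeomorphic_space subtopology Y C"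
    and BD: "subtopology X B homeomorphic_space subtopology Y D"
  shows "X homeomorphic_space Y"
proof -
  have tops: "topspace (subtopology X A) = A" "topspace (subtopology X B) = B"
    "topspace (subtopology Y C) = C" "topspace (subtopology Y D) = D"
    using openin_subset X Y by auto
  have glue: "continuous_map X Y (\<lambda>x. if x \<in> A then f x else g x)"
    if "openin X A" "openin X B" "A \<inter> B = {}" "A \<union> B = topspace X"
      "continuous_map (subtopology X A) (subtopology Y C) f"
      "continuous_map (subtopology X B) (subtopology Y D) g"
    for X :: "'x topology" and Y :: "'y topology" and A B C D f g
  proof (rule continuous_map_openin_Un[OF that(1,2)])
    show "continuous_map (subtopology X A) Y (\<lambda>x. if x \<in> A then f x else g x)"
      by (rule continuous_map_eq[OF continuous_map_into_fulltopology[OF that(5)]]) auto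
    show "continuous_map (subtopology X B) Y (\<lambda>x. if x \<in> A then f x else g x)"
      by (rule continuous_map_eq[OF continuous_map_into_fulltopology[OF that(6)]]) (use that in auto)
  qed (use that in auto)
  obtain f f' where f: "homeomorphic_maps (subtopology X A) (subtopology Y C) f f'"
    using AC unfolding homeomorphic_space_def by blast
  obtain g g' where g: "homeomorphic_maps (subtopology X B) (subtopology Y D) g g'"
    using BD unfolding homeomorphic_space_def by blast
  let ?h = "\<lambda>x. if x \<in> A then f x else g x"
  let ?h' = "\<lambda>y. if y \<in> C then f' y else g' y"
  have 1: "f x \<in> C" "f' (f x) = x" if "x \<in> A" for x
    using f that unfolding homeomorphic_maps_def continuous_map_def tops by blast+
  have 2: "g x \<in> D" "g' (g x) = x" if "x \<in> B" for x
    using g that unfolding homeomorphic_maps_def continuous_map_def tops by blast+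
  have 3: "f' y \<in> A" "f (f' y) = y" if "y \<in> C" for y
    using f that unfolding homeomorphic_maps_def continuous_map_def tops by blast+
  have 4: "g' y \<in> B" "g (g' y) = y" if "y \<in> D" for y
    using g that unfolding homeomorphic_maps_def continuous_map_def tops by blast+
  have disj: "x \<notin> A \<longleftrightarrow> x \<in> B" if "x \<in> topspace X" for x using X that by blast
  have disj': "y \<notin> C \<longleftrightarrow> y \<in> D" if "y \<in> topspace Y" for y using Y that by blast
  have "homeomorphic_maps X Y ?h ?h'"
    unfolding homeomorphic_maps_def
  proof (intro conjI ballI)
    show "continuous_map X Y ?h"
      using glue[OF X] f g unfolding homeomorphic_maps_def by blast
    show "continuous_map Y X ?h'"
      using glue[OF Y] f g unfolding homeomorphic_maps_def by blast
    fix x assume x: "x \<in> topspace X"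
    show "?h' (?h x) = x"
    proof (cases "x \<in> A")
      case True then show ?thesis using 1 by simp
    next
      case False
      then have "g x \<in> D" "g' (g x) = x" using disj[OF x] 2 by auto
      then show ?thesis using False Y(3) by auto
    qed
  next
    fix y assume y: "y \<in> topspace Y"
    show "?h (?h' y) = y"
    proof (cases "y \<in> C")
      case True then show ?thesis using 3 by simp
    next
      case False
      then have "g' y \<in> B" "g (g' y) = y" using disj'[OF y] 4 by auto
      then show ?thesis using False X(3) by auto
    qed
  qed
  then show ?thesis unfolding homeomorphic_space_def by blast
qed

subsection \<open>Cantor normal forms\<close>

definition lt :: "'a rel \<Rightarrow> 'a \<Rightarrow> 'a \<Rightarrow> bool" where
  "lt r x y \<longleftrightarrow> (x, y) \<in> r \<and> x \<noteq> y"

definition fin_supp :: "'a rel \<Rightarrow> ('a \<Rightarrow> nat) set" where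
  "fin_supp r = {f. finite {x. f x \<noteq> 0} \<and> {x. f x \<noteq> 0} \<subseteq> Field r}"

text \<open>The comparison behind \<open>omega_exp\<close>, with p the largest exponent at which the
  coefficients differ. Agreement above p is easier to combine for two witnesses than the requirement
  that p dominates all differences; on \<open>fin_supp\<close> the two coincide.\<close>

definition below :: "'a rel \<Rightarrow> ('a \<Rightarrow> nat) \<Rightarrow> ('a \<Rightarrow> nat) \<Rightarrow> bool" where
  "below r f g \<longleftrightarrow> (\<exists>p. f p < g p \<and> (\<forall>y. lt r p y \<longrightarrow> f y = g y))"

text \<open>The one-term normal form \<open>\<omega>\<^sup>a k\<close>.\<close>

definition single :: "'a \<Rightarrow> nat \<Rightarrow> 'a \<Rightarrow> nat" where
  "single a k = (\<lambda>x. if x = a then k else 0)"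

text \<open>Ordinal addition h + x: terms of h below the leading exponent of x are absorbed, at that
  exponent the coefficients add up, and higher terms of h survive.\<close>

definition cnf_add :: "'a rel \<Rightarrow> ('a \<Rightarrow> nat) \<Rightarrow> ('a \<Rightarrow> nat) \<Rightarrow> 'a \<Rightarrow> nat" where
  "cnf_add r h x = (\<lambda>y. if \<exists>z. lt r y z \<and> x z \<noteq> 0 then x y else h y + x y)"

lemma lt_irrefl [simp]: "\<not> lt r x x"
  by (simp add: lt_def)

lemma lt_Field: "lt r x y \<Longrightarrow> x \<in> Field r" "lt r x y \<Longrightarrow> y \<in> Field r"
  by (auto simp: lt_def Field_def)

lemma underS_lt: "underS r x = {y. lt r y x}"
  by (auto simp: underS_def lt_def)

lemma fin_supp_Field: "f \<in> fin_supp r \<Longrightarrow> 0 < f x \<Longrightarrow> x \<in> Field r"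
  by (auto simp: fin_supp_def)

lemma zero_fin_supp [simp]: "(\<lambda>_. 0) \<in> fin_supp r"
  by (simp add: fin_supp_def)

lemma single_fin_supp: "a \<in> Field r \<Longrightarrow> single a k \<in> fin_supp r"
  by (auto simp: fin_supp_def single_def)

lemma fin_supp_mono:
  assumes "g \<in> fin_supp r" "\<And>x. f x \<noteq> 0 \<Longrightarrow> g x \<noteq> 0"
  shows "f \<in> fin_supp r"
proof -
  have "{x. f x \<noteq> 0} \<subseteq> {x. g x \<noteq> 0}" using assms(2) by auto
  then show ?thesis using assms(1) finite_subset unfolding fin_supp_def by blast
qed

lemma fin_supp_Un:
  assumes "g \<in> fin_supp r" "h \<in> fin_supp r" "\<And>x. f x \<noteq> 0 \<Longrightarrow> g x \<noteq> 0 \<or> h x \<noteq> 0"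
  shows "f \<in> fin_supp r"
proof -
  have "{x. f x \<noteq> 0} \<subseteq> {x. g x \<noteq> 0} \<union> {x. h x \<noteq> 0}" using assms(3) by blast
  moreover have "finite ({x. g x \<noteq> 0} \<union> {x. h x \<noteq> 0})"
    using assms(1,2) by (simp add: fin_supp_def)
  ultimately show ?thesis using assms(1,2) finite_subset unfolding fin_supp_def by blast
qed

lemma below_irrefl [simp]: "\<not> below r f f"
  by (simp add: below_def)

lemma below_neq: "below r f g \<Longrightarrow> f \<noteq> g"
  by auto

lemma not_below_zero [simp]: "\<not> below r f (\<lambda>_. 0)"
  by (simp add: below_def)

lemma cnf_add_zero [simp]: "cnf_add r h (\<lambda>_. 0) = h"
  by (simp add: cnf_add_def)

section \<open>The well-order of normal forms\<close>

context
  fixes r :: "'a rel"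
  assumes WO: "Well_order r"
begin

lemma lt_trans: "lt r x y \<Longrightarrow> lt r y z \<Longrightarrow> lt r x z"
  unfolding lt_def using wo_trans[OF WO, of x y z] wo_antisym[OF WO, of x y] by auto

lemma lt_asym: "lt r x y \<Longrightarrow> \<not> lt r y x"
  using lt_trans[of x y x] by auto

lemma lt_linear: "x \<in> Field r \<Longrightarrow> y \<in> Field r \<Longrightarrow> lt r x y \<or> x = y \<or> lt r y x"
  unfolding lt_def using wo_linear[OF WO] by blast

lemma le_iff_lt: "(x, y) \<in> r \<longleftrightarrow> lt r x y \<or> (x = y \<and> x \<in> Field r)"
  unfolding lt_def using wo_refl[OF WO] by (auto intro: FieldI1)

lemma wf_lt: "wf {(x, y). lt r x y}"
proof -
  have "{(x, y). lt r x y} = r - Id" by (auto simp: lt_def)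
  then show ?thesis using wo_rel.WF[OF wo_rel.intro[OF WO]] by simp
qed

lemma ex_least:
  assumes "A \<subseteq> Field r" "A \<noteq> {}"
  obtains m where "m \<in> A" "\<And>y. y \<in> A \<Longrightarrow> y = m \<or> lt r m y"
proof -
  obtain m where m: "m \<in> A" "\<And>y. (y, m) \<in> {(x, y). lt r x y} \<Longrightarrow> y \<notin> A"
    using wfE_min'[OF wf_lt assms(2)] by blast
  have "y = m \<or> lt r m y" if "y \<in> A" for y
    using lt_linear[of m y] assms(1) that m by auto
  with m(1) show thesis by (rule that)
qed

lemma ex_greatest:
  assumes "finite A" "A \<noteq> {}" "A \<subseteq> Field r"
  obtains m where "m \<in> A" "\<And>y. y \<in> A \<Longrightarrow> y = m \<or> lt r y m"
proof -
  have "\<exists>m\<in>A. \<forall>y\<in>A. y = m \<or> lt r y m"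
    using assms
  proof (induction A rule: finite_ne_induct)
    case (singleton x)
    then show ?case by simp
  next
    case (insert x A)
    then obtain m where m: "m \<in> A" "\<forall>y\<in>A. y = m \<or> lt r y m" by auto
    consider "lt r x m \<or> x = m" | "lt r m x"
      using lt_linear[of x m] insert m by auto
    then show ?case
    proof cases
      case 1
      then show ?thesis using m by (intro bexI[of _ m]) auto
    next
      case 2
      then have "\<forall>y\<in>A. lt r y x" using m lt_trans[of _ m x] by metis
      then show ?thesis by (intro bexI[of _ x]) auto
    qed
  qed
  then show thesis using that by blast
qed

lemma below_Field:
  assumes "g \<in> fin_supp r" "below r f g"
  obtains p where "p \<in> Field r" "f p < g p" "\<And>y. lt r p y \<Longrightarrow> f y = g y"
  using assms fin_supp_Field[of g r] unfolding below_def by (metis gr_zeroI not_less_zero)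

lemma below_trans:
  assumes "g \<in> fin_supp r" "h \<in> fin_supp r" "below r f g" "below r g h"
  shows "below r f h"
proof -
  obtain p where p: "p \<in> Field r" "f p < g p" "\<And>y. lt r p y \<Longrightarrow> f y = g y"
    using below_Field[OF assms(1,3)] by blast
  obtain q where q: "q \<in> Field r" "g q < h q" "\<And>y. lt r q y \<Longrightarrow> g y = h y"
    using below_Field[OF assms(2,4)] by blast
  show ?thesis
  proof (cases "lt r q p")
    case True
    then have "f p < h p" using p q by simp
    moreover have "f y = h y" if "lt r p y" for y
      using that True p(3) q(3) lt_trans by metis
    ultimately show ?thesis unfolding below_def by blast
  next
    case False
    then have pq: "p = q \<or> lt r p q" using lt_linear p q by blast
    then have "f q < h q" using p q by auto
    moreover have "f y = h y" if "lt r q y" for y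
      using that pq p(3) q(3) lt_trans by metis
    ultimately show ?thesis unfolding below_def by blast
  qed
qed

lemma below_asym:
  "f \<in> fin_supp r \<Longrightarrow> g \<in> fin_supp r \<Longrightarrow> below r f g \<Longrightarrow> \<not> below r g f"
  using below_trans[of g f f] below_irrefl by blast

text \<open>Two distinct finitely supported functions differ at finitely many exponents, and the
  largest of these decides.\<close>

lemma below_linear:
  assumes "f \<in> fin_supp r" "g \<in> fin_supp r" "f \<noteq> g"
  shows "below r f g \<or> below r g f"
proof -
  let ?A = "{x. f x \<noteq> g x}"
  have sub: "?A \<subseteq> {x. f x \<noteq> 0} \<union> {x. g x \<noteq> 0}" by auto
  have "finite ?A"
    using assms by (intro finite_subset[OF sub]) (simp add: fin_supp_def)
  moreover have "?A \<noteq> {}" using assms by auto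
  moreover have "?A \<subseteq> Field r" using sub assms unfolding fin_supp_def by blast
  ultimately obtain m where m: "m \<in> ?A" "\<And>y. y \<in> ?A \<Longrightarrow> y = m \<or> lt r y m"
    using ex_greatest[of ?A] by blast
  have "f y = g y" if "lt r m y" for y
    using m(2)[of y] lt_asym[OF that] that by auto
  moreover have "f m < g m \<or> g m < f m" using m by auto
  ultimately show ?thesis unfolding below_def by metis
qed

lemma omega_exp_iff:
  "(f, g) \<in> omega_exp r \<longleftrightarrow> f \<in> fin_supp r \<and> g \<in> fin_supp r \<and> (f = g \<or> below r f g)"
proof -
  have "(\<exists>x. f x < g x \<and> (\<forall>y. f y \<noteq> g y \<longrightarrow> (y, x) \<in> r)) \<longleftrightarrow> below r f g"
    if fg: "f \<in> fin_supp r" "g \<in> fin_supp r"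
  proof
    assume "\<exists>x. f x < g x \<and> (\<forall>y. f y \<noteq> g y \<longrightarrow> (y, x) \<in> r)"
    then obtain x where "f x < g x" "\<forall>y. f y \<noteq> g y \<longrightarrow> (y, x) \<in> r" by blast
    then show "below r f g"
      unfolding below_def lt_def using wo_antisym[OF WO] by metis
  next
    assume "below r f g"
    then obtain p where p: "p \<in> Field r" "f p < g p" "\<And>y. lt r p y \<Longrightarrow> f y = g y"
      using below_Field[OF fg(2)] by blast
    have "(y, p) \<in> r" if "f y \<noteq> g y" for y
    proof -
      have "0 < f y \<or> 0 < g y" using that by auto
      then have "y \<in> Field r" using fin_supp_Field fg by metis
      then show ?thesis using p that lt_linear[of y p] le_iff_lt[of y p] by blast
    qed
    then show "\<exists>x. f x < g x \<and> (\<forall>y. f y \<noteq> g y \<longrightarrow> (y, x) \<in> r)" using p by blast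
  qed
  then show ?thesis unfolding omega_exp_def fin_supp_def by auto
qed

lemma Field_omega_exp [simp]: "Field (omega_exp r) = fin_supp r"
  unfolding Field_def Domain_iff Range_iff set_eq_iff Un_iff using omega_exp_iff by blast

lemma lt_omega_exp:
  "lt (omega_exp r) f g \<longleftrightarrow> f \<in> fin_supp r \<and> g \<in> fin_supp r \<and> below r f g"
  unfolding lt_def omega_exp_iff using below_neq by blast

text \<open>Finitely supported functions into the naturals are multisets, and the order on \<open>\<omega>\<^sup>\<alpha>\<close>
  is contained in the multiset extension of the strict order of \<open>\<alpha>\<close>.\<close>
lemma wf_below: "wf {(f, g). f \<in> fin_supp r \<and> g \<in> fin_supp r \<and> below r f g}"
proof (rule wf_subset)
  show "wf (inv_image (mult {(x, y). lt r x y}) Abs_multiset)"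
    by (intro wf_inv_image wf_mult wf_lt)
  show "{(f, g). f \<in> fin_supp r \<and> g \<in> fin_supp r \<and> below r f g}
    \<subseteq> inv_image (mult {(x, y). lt r x y}) Abs_multiset"
  proof clarify
    fix f g assume fg: "f \<in> fin_supp r" "g \<in> fin_supp r" "below r f g"
    obtain p where p: "p \<in> Field r" "f p < g p" "\<And>y. lt r p y \<Longrightarrow> f y = g y"
      using below_Field[OF fg(2,3)] by blast
    define F where "F = Abs_multiset f"
    define G where "G = Abs_multiset g"
    have cF: "count F = f" using fg by (simp add: F_def fin_supp_def)
    have cG: "count G = g" using fg by (simp add: G_def fin_supp_def)
    \<comment> \<open>The common part stays and F - G is exchanged for G - F. All exponents in F - G
      lie below the leading difference p, and p itself occurs in G - F.\<close>
    have "((F \<inter># G) + (F - G), (F \<inter># G) + (G - F)) \<in> mult {(x, y). lt r x y}"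
    proof (rule one_step_implies_mult)
      have pG: "p \<in># G - F" using p cF cG by (simp add: in_diff_count)
      then show "G - F \<noteq> {#}" by auto
      show "\<forall>k\<in>#F - G. \<exists>j\<in>#G - F. (k, j) \<in> {(x, y). lt r x y}"
      proof
        fix k assume "k \<in># F - G"
        then have k: "g k < f k" using cF cG by (simp add: in_diff_count)
        then have "k \<in> Field r" using fin_supp_Field[OF fg(1), of k] by simp
        then have "lt r k p" using k p lt_linear[of k p] by (metis less_irrefl less_asym)
        then show "\<exists>j\<in>#G - F. (k, j) \<in> {(x, y). lt r x y}" using pG by blast
      qed
    qed
    moreover have "(F \<inter># G) + (F - G) = F" "(F \<inter># G) + (G - F) = G"
      by (auto simp: multiset_eq_iff)
    ultimately show "(f, g) \<in> inv_image (mult {(x, y). lt r x y}) Abs_multiset"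
      by (simp add: F_def G_def)
  qed
qed

lemma Well_order_omega_exp: "Well_order (omega_exp r)"
proof -
  have "trans (omega_exp r)"
    by (intro transI) (use below_trans in \<open>auto simp: omega_exp_iff\<close>)
  moreover have "antisym (omega_exp r)"
    by (intro antisymI) (use below_asym in \<open>auto simp: omega_exp_iff\<close>)
  moreover have "Refl (omega_exp r)"
    by (auto simp: refl_on_def omega_exp_iff)
  moreover have "Total (omega_exp r)"
    by (auto simp: total_on_def omega_exp_iff dest: below_linear)
  moreover have "wf (omega_exp r - Id)"
    by (rule wf_subset[OF wf_below]) (auto simp: omega_exp_iff)
  moreover have "omega_exp r \<subseteq> Field (omega_exp r) \<times> Field (omega_exp r)"
    by (auto simp: omega_exp_iff)
  ultimately show ?thesis
    unfolding well_order_on_def linear_order_on_def partial_order_on_def preorder_on_def by blast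
qed

lemma below_zero: "f \<in> fin_supp r \<Longrightarrow> f \<noteq> (\<lambda>_. 0) \<Longrightarrow> below r (\<lambda>_. 0) f"
  using below_linear[of "\<lambda>_. 0" f] by auto

lemma openin_omega_exp:
  "openin (ord_space (omega_exp r)) U \<longleftrightarrow> U \<subseteq> fin_supp r \<and>
    (\<forall>x\<in>U. x = (\<lambda>_. 0) \<or>
      (\<exists>a\<in>fin_supp r. below r a x \<and> (\<forall>y\<in>fin_supp r. below r a y \<longrightarrow> y = x \<or> below r y x \<longrightarrow> y \<in> U)))"
proof (cases "U \<subseteq> fin_supp r")
  case True
  have "(underS (omega_exp r) x = {} \<or> (\<exists>a\<in>underS (omega_exp r) x. \<forall>y. (a, y) \<in> omega_exp r \<and> a \<noteq> y \<and> (y, x) \<in> omega_exp r \<longrightarrow> y \<in> U))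
    \<longleftrightarrow> (x = (\<lambda>_. 0) \<or>
      (\<exists>a\<in>fin_supp r. below r a x \<and> (\<forall>y\<in>fin_supp r. below r a y \<longrightarrow> y = x \<or> below r y x \<longrightarrow> y \<in> U)))"
    if "x \<in> U" for x
  proof -
    have x: "x \<in> fin_supp r" using that True by blast
    have "underS (omega_exp r) x = {a \<in> fin_supp r. below r a x}"
      using x by (auto simp: underS_lt lt_omega_exp)
    moreover have "{a \<in> fin_supp r. below r a x} = {} \<longleftrightarrow> x = (\<lambda>_. 0)"
      using below_zero[OF x] zero_fin_supp[of r] not_below_zero by blast
    moreover have "(a, y) \<in> omega_exp r \<and> a \<noteq> y \<and> (y, x) \<in> omega_exp r \<longleftrightarrow>
      y \<in> fin_supp r \<and> below r a y \<and> (y = x \<or> below r y x)" if "a \<in> fin_supp r" for a y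
      using that x below_neq unfolding omega_exp_iff by blast
    ultimately show ?thesis by (simp add: Bex_def Ball_def) blast
  qed
  then show ?thesis
    unfolding openin_ord_space[OF Well_order_omega_exp] Field_omega_exp by (simp cong: ball_cong)
next
  case False
  then show ?thesis
    unfolding openin_ord_space[OF Well_order_omega_exp] Field_omega_exp by blast
qed

section \<open>Ordinal addition on normal forms\<close>

lemma cnf_add_fin_supp: "h \<in> fin_supp r \<Longrightarrow> x \<in> fin_supp r \<Longrightarrow> cnf_add r h x \<in> fin_supp r"
  by (rule fin_supp_Un[of h r x]) (auto simp: cnf_add_def split: if_splits)

text \<open>From the leading difference p upwards the two right summands have the same exponents
  above any given one, hence absorb the same terms of h. So p is also the leading difference of the
  sums.\<close>

lemma cnf_add_mono:
  assumes "below r x x'"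
  shows "below r (cnf_add r h x) (cnf_add r h x')"
proof -
  obtain p where p: "x p < x' p" "\<And>y. lt r p y \<Longrightarrow> x y = x' y"
    using assms unfolding below_def by blast
  have 1: "(\<exists>z. lt r y z \<and> x z \<noteq> 0) \<longleftrightarrow> (\<exists>z. lt r y z \<and> x' z \<noteq> 0)" if "y = p \<or> lt r p y" for y
    using that p(2) lt_trans by metis
  have "cnf_add r h x p < cnf_add r h x' p" using 1[of p] p(1) by (simp add: cnf_add_def)
  moreover have "cnf_add r h x y = cnf_add r h x' y" if "lt r p y" for y
    using 1[of y] p(2)[OF that] that unfolding cnf_add_def by presburger
  ultimately show ?thesis unfolding below_def by blast
qed

lemma cnf_add_below_iff:
  assumes "x \<in> fin_supp r" "x' \<in> fin_supp r" "h \<in> fin_supp r"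
  shows "below r (cnf_add r h x) (cnf_add r h x') \<longleftrightarrow> below r x x'"
  using cnf_add_mono[of x x' h] cnf_add_mono[of x' x h] below_linear[OF assms(1,2)]
    below_asym[OF cnf_add_fin_supp[OF assms(3,1)] cnf_add_fin_supp[OF assms(3,2)]] below_irrefl by metis

lemma cnf_add_eq_iff:
  assumes "x \<in> fin_supp r" "x' \<in> fin_supp r"
  shows "cnf_add r h x = cnf_add r h x' \<longleftrightarrow> x = x'"
  using cnf_add_mono[of x x' h] cnf_add_mono[of x' x h] below_linear[OF assms] below_irrefl by metis

text \<open>Left subtraction of ordinals.\<close>

lemma cnf_add_surj:
  assumes "h \<in> fin_supp r" "z \<in> fin_supp r" "below r h z"
  obtains x where "x \<in> fin_supp r" "x \<noteq> (\<lambda>_. 0)" "z = cnf_add r h x"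
proof -
  obtain p where p: "p \<in> Field r" "h p < z p" "\<And>y. lt r p y \<Longrightarrow> h y = z y"
    using below_Field[OF assms(2,3)] by blast
  \<comment> \<open>The difference z - h: at the leading difference p the surplus of z, below p
    everything z has, and above p nothing because there z agrees with h.\<close>
  define x where "x = (\<lambda>y. if lt r y p then z y else if y = p then z p - h p else 0)"
  have x: "x \<in> fin_supp r"
    by (rule fin_supp_mono[OF assms(2)]) (auto simp: x_def split: if_splits)
  have xp: "x p \<noteq> 0" using p by (simp add: x_def)
  have above: "\<not> (\<exists>v. lt r y v \<and> x v \<noteq> 0)" if "y = p \<or> lt r p y" for y
  proof
    assume "\<exists>v. lt r y v \<and> x v \<noteq> 0"
    then obtain v where v: "lt r y v" "x v \<noteq> 0" by blast
    have "lt r p v" using that v lt_trans by blast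
    then show False using v(2) lt_asym by (auto simp: x_def split: if_splits)
  qed
  have "cnf_add r h x y = z y" for y
  proof (cases "y \<in> Field r")
    case False
    then have "z y = 0" "h y = 0" "x y = 0" using assms x unfolding fin_supp_def by blast+
    then show ?thesis by (simp add: cnf_add_def)
  next
    case True
    then consider "lt r y p" | "y = p" | "lt r p y" using lt_linear p by blast
    then show ?thesis
    proof cases
      case 1
      then have "\<exists>v. lt r y v \<and> x v \<noteq> 0" using xp by blast
      then have "cnf_add r h x y = x y" by (simp add: cnf_add_def)
      then show ?thesis using 1 by (simp add: x_def)
    next
      case 2
      then have "cnf_add r h x y = h y + x y" using above[of y] 2 unfolding cnf_add_def by (metis (no_types, lifting))
      then show ?thesis using 2 p by (simp add: x_def)
    next
      case 3
      then have "x y = 0" using lt_asym by (auto simp: x_def)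
      moreover have "cnf_add r h x y = h y + x y" using above[of y] 3 unfolding cnf_add_def by (metis (no_types, lifting))
      ultimately show ?thesis using 3 p by simp
    qed
  qed
  then have "z = cnf_add r h x" by auto
  moreover have "x \<noteq> (\<lambda>_. 0)" using xp by auto
  ultimately show thesis using x that by blast
qed

end

subsection \<open>Rearranging clopen blocks\<close>

definition exp_space :: "'a rel \<Rightarrow> ('a \<Rightarrow> nat) topology" where
  "exp_space r = ord_space (omega_exp r)"

definition seg_eq :: "'a rel \<Rightarrow> ('a \<Rightarrow> nat) set \<Rightarrow> ('a \<Rightarrow> nat) set \<Rightarrow> bool" where
  "seg_eq r S T \<longleftrightarrow> subtopology (exp_space r) S homeomorphic_space subtopology (exp_space r) T"

definition iic :: "'a rel \<Rightarrow> ('a \<Rightarrow> nat) \<Rightarrow> ('a \<Rightarrow> nat) set" where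
  "iic r g = {x \<in> fin_supp r. x = g \<or> below r x g}"

definition iio :: "'a rel \<Rightarrow> ('a \<Rightarrow> nat) \<Rightarrow> ('a \<Rightarrow> nat) set" where
  "iio r g = {x \<in> fin_supp r. below r x g}"

definition ioi :: "'a rel \<Rightarrow> ('a \<Rightarrow> nat) \<Rightarrow> ('a \<Rightarrow> nat) set" where
  "ioi r g = {x \<in> fin_supp r. below r g x}"

lemma seg_eq_refl: "seg_eq r S S"
  by (simp add: seg_eq_def homeomorphic_space_refl)

lemma seg_eq_sym: "seg_eq r S T \<Longrightarrow> seg_eq r T S"
  unfolding seg_eq_def using homeomorphic_space_sym by blast

lemma seg_eq_trans: "seg_eq r S T \<Longrightarrow> seg_eq r T U \<Longrightarrow> seg_eq r S U"
  unfolding seg_eq_def using homeomorphic_space_trans by blast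

text \<open>Disjoint open blocks may be moved independently, regardless of their order. This is what
  makes rearrangement more flexible than order isomorphism.\<close>

lemma seg_eq_Un:
  assumes op: "openin (exp_space r) A" "openin (exp_space r) B"
    "openin (exp_space r) C" "openin (exp_space r) D"
    and disj: "A \<inter> B = {}" "C \<inter> D = {}" and eq: "seg_eq r A C" "seg_eq r B D"
  shows "seg_eq r (A \<union> B) (C \<union> D)"
  unfolding seg_eq_def
proof (rule homeomorphic_space_Un[of _ A B _ C D])
  have *: "openin (subtopology (exp_space r) (S \<union> T)) S \<and> openin (subtopology (exp_space r) (S \<union> T)) T
      \<and> S \<union> T = topspace (subtopology (exp_space r) (S \<union> T))"
    if "openin (exp_space r) S" "openin (exp_space r) T" for S T
  proof -
    have "openin (exp_space r) (S \<union> T)" using that by (rule openin_Un)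
    then show ?thesis
      using that openin_subset[of "exp_space r" "S \<union> T"] by (auto simp: openin_open_subtopology)
  qed
  show "openin (subtopology (exp_space r) (A \<union> B)) A" "openin (subtopology (exp_space r) (A \<union> B)) B"
    "A \<union> B = topspace (subtopology (exp_space r) (A \<union> B))"
    using *[OF op(1,2)] by blast+
  show "openin (subtopology (exp_space r) (C \<union> D)) C" "openin (subtopology (exp_space r) (C \<union> D)) D"
    "C \<union> D = topspace (subtopology (exp_space r) (C \<union> D))"
    using *[OF op(3,4)] by blast+
  have i: "(A \<union> B) \<inter> A = A" "(A \<union> B) \<inter> B = B" "(C \<union> D) \<inter> C = C" "(C \<union> D) \<inter> D = D" by auto
  show "subtopology (subtopology (exp_space r) (A \<union> B)) A homeomorphic_space
        subtopology (subtopology (exp_space r) (C \<union> D)) C"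
    "subtopology (subtopology (exp_space r) (A \<union> B)) B homeomorphic_space
        subtopology (subtopology (exp_space r) (C \<union> D)) D"
    using eq unfolding seg_eq_def subtopology_subtopology i by blast+
qed (use disj in auto)

section \<open>Intervals and their translates\<close>

context
  fixes r :: "'a rel"
  assumes WO: "Well_order r"
begin

lemma topspace_exp_space [simp]: "topspace (exp_space r) = fin_supp r"
  by (simp add: exp_space_def Field_omega_exp[OF WO])

lemma openin_exp_space:
  "openin (exp_space r) U \<longleftrightarrow> U \<subseteq> fin_supp r \<and>
    (\<forall>x\<in>U. x = (\<lambda>_. 0) \<or>
      (\<exists>a\<in>fin_supp r. below r a x \<and> (\<forall>y\<in>fin_supp r. below r a y \<longrightarrow> y = x \<or> below r y x \<longrightarrow> y \<in> U)))"
  unfolding exp_space_def by (rule openin_omega_exp[OF WO])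

lemma iic_under: "g \<in> fin_supp r \<Longrightarrow> iic r g = under (omega_exp r) g"
  by (auto simp: iic_def under_def omega_exp_iff[OF WO])

lemma iio_underS: "g \<in> fin_supp r \<Longrightarrow> iio r g = underS (omega_exp r) g"
  by (auto simp: iio_def underS_lt lt_omega_exp[OF WO])

lemma openin_iic: "g \<in> fin_supp r \<Longrightarrow> openin (exp_space r) (iic r g)"
  unfolding exp_space_def using iic_under openin_under[OF Well_order_omega_exp[OF WO]] by metis

lemma openin_iio: "g \<in> fin_supp r \<Longrightarrow> openin (exp_space r) (iio r g)"
  unfolding exp_space_def using iio_underS openin_underS[OF Well_order_omega_exp[OF WO]] by metis

lemma openin_ioi: "g \<in> fin_supp r \<Longrightarrow> openin (exp_space r) (ioi r g)"
  unfolding openin_exp_space by (auto simp: ioi_def)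

text \<open>The map sending x to h + x is continuous, and by left subtraction it carries
  \<open>(a, x]\<close> onto \<open>(h + a, h + x]\<close>. It is therefore an open embedding on
  nonzero points. At 0 openness would fail for a limit h.\<close>

lemma cnf_add_translation:
  assumes h: "h \<in> fin_supp r" and S: "S \<subseteq> fin_supp r - {\<lambda>_. 0}"
  shows "seg_eq r S (cnf_add r h ` S)"
proof -
  let ?E = "exp_space r" and ?N = "fin_supp r - {\<lambda>_. 0}" and ?T = "cnf_add r h"
  note T_fin = cnf_add_fin_supp[OF WO h]
  note T_below = cnf_add_below_iff[OF WO _ _ h]
  have T0: "h = ?T (\<lambda>_. 0)" by simp
  have N: "openin ?E ?N"
    unfolding openin_exp_space
  proof (intro conjI ballI disjI2)
    fix x assume "x \<in> ?N"
    then show "\<exists>a\<in>fin_supp r. below r a x \<and> (\<forall>y\<in>fin_supp r. below r a y \<longrightarrow> y = x \<or> below r y x \<longrightarrow> y \<in> ?N)"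
      using below_zero[OF WO, of x] below_neq by (intro bexI[of _ "\<lambda>_. 0"]) auto
  qed auto
  have cont: "continuous_map ?E ?E ?T"
    unfolding continuous_map
  proof (intro conjI allI impI)
    show "?T ` topspace ?E \<subseteq> topspace ?E" using T_fin by auto
    fix U assume U: "openin ?E U"
    show "openin ?E {x \<in> topspace ?E. ?T x \<in> U}"
      unfolding openin_exp_space
    proof (intro conjI ballI)
      show "{x \<in> topspace ?E. ?T x \<in> U} \<subseteq> fin_supp r" by auto
      fix x assume x: "x \<in> {x \<in> topspace ?E. ?T x \<in> U}"
      then have xF: "x \<in> fin_supp r" by simp
      show "x = (\<lambda>_. 0) \<or> (\<exists>a\<in>fin_supp r. below r a x \<and>
           (\<forall>y\<in>fin_supp r. below r a y \<longrightarrow> y = x \<or> below r y x \<longrightarrow> y \<in> {x \<in> topspace ?E. ?T x \<in> U}))"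
      proof (cases "x = (\<lambda>_. 0)")
        case False
        then have hx: "below r h (?T x)"
          using below_zero[OF WO xF] cnf_add_mono[OF WO, of "\<lambda>_. 0" x h] by simp
        then obtain a where a: "a \<in> fin_supp r" "below r a (?T x)"
          "\<And>y. y \<in> fin_supp r \<Longrightarrow> below r a y \<Longrightarrow> y = ?T x \<or> below r y (?T x) \<Longrightarrow> y \<in> U"
        proof -
          have "?T x \<in> U" "?T x \<noteq> (\<lambda>_. 0)" using x hx not_below_zero[of r h] by auto
          then have "\<exists>a\<in>fin_supp r. below r a (?T x) \<and>
              (\<forall>y\<in>fin_supp r. below r a y \<longrightarrow> y = ?T x \<or> below r y (?T x) \<longrightarrow> y \<in> U)"
            using U unfolding openin_exp_space by blast
          then show thesis using that by blast
        qed
        \<comment> \<open>Pulls the left end of a neighbourhood of h + x back to the domain: if a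
          exceeds h, subtract h; otherwise a' = 0 works, since h + 0 already reaches a.\<close>
        obtain a' where a': "a' \<in> fin_supp r" "below r a' x" "a = ?T a' \<or> below r a (?T a')"
        proof (cases "below r h a")
          case True
          then obtain a' where "a' \<in> fin_supp r" "a = ?T a'"
            using cnf_add_surj[OF WO h a(1)] by blast
          then show thesis using that a(2) T_below xF by blast
        next
          case nb: False
          then have "a = h \<or> below r a h" using below_linear[OF WO h a(1)] by blast
          then have "a = ?T (\<lambda>_. 0) \<or> below r a (?T (\<lambda>_. 0))" by simp
          then show thesis by (rule that[OF zero_fin_supp below_zero[OF WO xF False]])
        qed
        have "?T y \<in> U" if "y \<in> fin_supp r" "below r a' y" "y = x \<or> below r y x" for y
        proof (rule a(3))
          show "?T y \<in> fin_supp r" using T_fin that by blast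
          have "below r (?T a') (?T y)" using cnf_add_mono[OF WO] that by blast
          then show "below r a (?T y)"
            using a'(3) below_trans[OF WO T_fin[OF a'(1)] T_fin[OF that(1)]] by blast
          show "?T y = ?T x \<or> below r (?T y) (?T x)" using that cnf_add_mono[OF WO] by blast
        qed
        then show ?thesis using a'(1,2) by auto
      qed simp
    qed
  qed
  have op: "openin ?E (?T ` V)" if V: "openin ?E V" "V \<subseteq> ?N" for V
    unfolding openin_exp_space
  proof (intro conjI ballI disjI2)
    show "?T ` V \<subseteq> fin_supp r" using V(2) T_fin by auto
    fix z assume "z \<in> ?T ` V"
    then obtain x where x: "x \<in> V" "z = ?T x" by blast
    have xF: "x \<in> fin_supp r" "x \<noteq> (\<lambda>_. 0)" using x V by auto
    then obtain a where a: "a \<in> fin_supp r" "below r a x"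
      "\<And>y. y \<in> fin_supp r \<Longrightarrow> below r a y \<Longrightarrow> y = x \<or> below r y x \<Longrightarrow> y \<in> V"
      using V(1) x(1) unfolding openin_exp_space by blast
    have ha: "h = ?T a \<or> below r h (?T a)"
      using below_zero[OF WO a(1)] cnf_add_mono[OF WO, of "\<lambda>_. 0" a h] by (cases "a = (\<lambda>_. 0)") auto
    \<comment> \<open>Such a y exceeds h, so it is h + y' for some y', and cancelling h places y' in
      \<open>(a, x]\<close>.\<close>
    have "y \<in> ?T ` V" if y: "y \<in> fin_supp r" "below r (?T a) y" "y = z \<or> below r y z" for y
    proof -
      have "below r h y" using ha y(2) below_trans[OF WO T_fin[OF a(1)] y(1)] by metis
      then obtain y' where y': "y' \<in> fin_supp r" "y = ?T y'"
        using cnf_add_surj[OF WO h y(1)] by blast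
      have "below r a y'" using T_below[OF a(1) y'(1)] y(2) unfolding y'(2) by blast
      moreover have "y' = x \<or> below r y' x"
        using y(3) unfolding y'(2) x(2) using T_below[OF y'(1) xF(1)] cnf_add_eq_iff[OF WO y'(1) xF(1)] by blast
      ultimately show ?thesis using a(3) y' by blast
    qed
    then show "\<exists>a\<in>fin_supp r. below r a z \<and> (\<forall>y\<in>fin_supp r. below r a y \<longrightarrow> y = z \<or> below r y z \<longrightarrow> y \<in> ?T ` V)"
      using T_fin[OF a(1)] cnf_add_mono[OF WO a(2), of h] x(2) by (intro bexI[of _ "?T a"]) auto
  qed
  have "embedding_map (subtopology ?E ?N) ?E ?T"
  proof (rule injective_open_imp_embedding_map)
    show "continuous_map (subtopology ?E ?N) ?E ?T"
      by (rule continuous_map_from_subtopology[OF cont])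
    show "open_map (subtopology ?E ?N) ?E ?T"
      unfolding open_map_def using op N by (simp add: openin_open_subtopology)
    show "inj_on ?T (topspace (subtopology ?E ?N))"
      by (auto simp: inj_on_def cnf_add_eq_iff[OF WO])
  qed
  then have "homeomorphic_map (subtopology ?E ?N) (subtopology ?E (?T ` topspace (subtopology ?E ?N))) ?T"
    by (simp add: embedding_map_def)
  then have "homeomorphic_map (subtopology (subtopology ?E ?N) S)
      (subtopology (subtopology ?E (?T ` topspace (subtopology ?E ?N))) (?T ` S)) ?T"
    by (rule homeomorphic_map_subtopologies) (use S T_fin in auto)
  moreover have "?N \<inter> S = S" "?T ` topspace (subtopology ?E ?N) \<inter> ?T ` S = ?T ` S"
    using S by auto
  ultimately show ?thesis
    unfolding seg_eq_def subtopology_subtopology by (metis homeomorphic_map_imp_homeomorphic_space)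
qed

lemma cnf_add_image_iic:
  assumes h: "h \<in> fin_supp r" and x: "x \<in> fin_supp r"
  shows "cnf_add r h ` (iic r x - {\<lambda>_. 0}) = iic r (cnf_add r h x) \<inter> ioi r h"
proof (intro set_eqI iffI)
  fix z assume "z \<in> cnf_add r h ` (iic r x - {\<lambda>_. 0})"
  then obtain y where y: "y \<in> fin_supp r" "y \<noteq> (\<lambda>_. 0)" "y = x \<or> below r y x" "z = cnf_add r h y"
    by (auto simp: iic_def)
  have "below r (cnf_add r h (\<lambda>_. 0)) (cnf_add r h y)"
    using below_zero[OF WO y(1,2)] by (rule cnf_add_mono[OF WO])
  then show "z \<in> iic r (cnf_add r h x) \<inter> ioi r h"
    using y cnf_add_fin_supp[OF WO h y(1)] cnf_add_mono[OF WO, of y x h]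
    by (auto simp: iic_def ioi_def)
next
  fix z assume z: "z \<in> iic r (cnf_add r h x) \<inter> ioi r h"
  then have "z \<in> fin_supp r" "below r h z" by (auto simp: ioi_def)
  then obtain y where y: "y \<in> fin_supp r" "y \<noteq> (\<lambda>_. 0)" "z = cnf_add r h y"
    using cnf_add_surj[OF WO h] by blast
  have "y = x \<or> below r y x"
    using z y cnf_add_below_iff[OF WO y(1) x h] cnf_add_eq_iff[OF WO y(1) x] by (auto simp: iic_def)
  then show "z \<in> cnf_add r h ` (iic r x - {\<lambda>_. 0})" using y by (auto simp: iic_def)
qed

text \<open>Follows from the closed case by removing the end point, which injectivity of the
  translation permits.\<close>

lemma cnf_add_image_iio:
  assumes h: "h \<in> fin_supp r" and x: "x \<in> fin_supp r"
  shows "cnf_add r h ` (iio r x - {\<lambda>_. 0}) = iio r (cnf_add r h x) \<inter> ioi r h"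
proof -
  have "iio r g = iic r g - {g}" if "g \<in> fin_supp r" for g
    using that below_neq by (auto simp: iio_def iic_def)
  then have "cnf_add r h ` (iio r x - {\<lambda>_. 0}) = cnf_add r h ` ((iic r x - {\<lambda>_. 0}) - {x})"
    using x by (simp add: Diff_insert2[symmetric] insert_commute)
  also have "\<dots> = cnf_add r h ` (iic r x - {\<lambda>_. 0}) - {cnf_add r h x}"
  proof -
    have "inj_on (cnf_add r h) (fin_supp r)"
      by (auto simp: inj_on_def cnf_add_eq_iff[OF WO])
    then show ?thesis
      using x by (subst inj_on_image_set_diff[of _ "fin_supp r"]) (auto simp: iic_def)
  qed
  also have "\<dots> = iio r (cnf_add r h x) \<inter> ioi r h"
    unfolding cnf_add_image_iic[OF h x]
    using below_neq by (auto simp: iio_def iic_def)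
  finally show ?thesis .
qed

lemma seg_eq_iic_translate:
  assumes "h \<in> fin_supp r" "x \<in> fin_supp r"
  shows "seg_eq r (iic r x - {\<lambda>_. 0}) (iic r (cnf_add r h x) \<inter> ioi r h)"
  using cnf_add_translation[OF assms(1), of "iic r x - {\<lambda>_. 0}"] cnf_add_image_iic[OF assms]
  by (auto simp: iic_def)

lemma seg_eq_iio_translate:
  assumes "h \<in> fin_supp r" "x \<in> fin_supp r"
  shows "seg_eq r (iio r x - {\<lambda>_. 0}) (iio r (cnf_add r h x) \<inter> ioi r h)"
  using cnf_add_translation[OF assms(1), of "iio r x - {\<lambda>_. 0}"] cnf_add_image_iio[OF assms]
  by (auto simp: iio_def)

lemma iic_split:
  assumes g: "g \<in> fin_supp r" and h: "h \<in> fin_supp r" and hg: "h = g \<or> below r h g"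
  shows "iic r g = iic r h \<union> (iic r g \<inter> ioi r h)" "iic r h \<inter> (iic r g \<inter> ioi r h) = {}"
proof -
  have "x \<in> iic r g" if "x \<in> iic r h" for x
    using that hg below_trans[OF WO h g, of x] unfolding iic_def by blast
  moreover have "x \<in> iic r h \<or> x \<in> ioi r h" if "x \<in> iic r g" for x
    using that below_linear[OF WO _ h, of x] unfolding iic_def ioi_def by blast
  ultimately show "iic r g = iic r h \<union> (iic r g \<inter> ioi r h)" by blast
  show "iic r h \<inter> (iic r g \<inter> ioi r h) = {}"
    using below_asym[OF WO _ h] below_irrefl[of r h] unfolding iic_def ioi_def by blast
qed

lemma iio_split:
  assumes g: "g \<in> fin_supp r" and h: "h \<in> fin_supp r" and hg: "below r h g"
  shows "iio r g = iic r h \<union> (iio r g \<inter> ioi r h)" "iic r h \<inter> (iio r g \<inter> ioi r h) = {}"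
proof -
  have "x \<in> iio r g" if "x \<in> iic r h" for x
    using that hg below_trans[OF WO h g, of x] unfolding iic_def iio_def by blast
  moreover have "x \<in> iic r h \<or> x \<in> ioi r h" if "x \<in> iio r g" for x
    using that below_linear[OF WO _ h, of x] unfolding iic_def iio_def ioi_def by blast
  ultimately show "iio r g = iic r h \<union> (iio r g \<inter> ioi r h)" by blast
  show "iic r h \<inter> (iio r g \<inter> ioi r h) = {}"
    using below_asym[OF WO _ h] below_irrefl[of r h] unfolding iic_def ioi_def by blast
qed

lemma iic_zero: "iic r (\<lambda>_. 0) = {\<lambda>_. 0}"
  by (auto simp: iic_def)

lemma zero_in_iic: "g \<in> fin_supp r \<Longrightarrow> (\<lambda>_. 0) \<in> iic r g"
  using below_zero[OF WO, of g] by (auto simp: iic_def)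

lemma iic_minus_zero: "g \<in> fin_supp r \<Longrightarrow> iic r g - {\<lambda>_. 0} = iic r g \<inter> ioi r (\<lambda>_. 0)"
  using below_zero[OF WO] by (auto simp: iic_def ioi_def)

section \<open>Absorption and reduction to two terms\<close>

lemma cnf_add_absorb:
  assumes "k \<noteq> 0" "\<And>y. h y \<noteq> 0 \<Longrightarrow> lt r y a"
  shows "cnf_add r h (single a k) = single a k"
proof
  fix y
  show "cnf_add r h (single a k) y = single a k y"
    using assms(1) assms(2)[of y] lt_irrefl[of r a] by (auto simp: cnf_add_def single_def)
qed

text \<open>With \<open>P = \<omega>\<^sup>a k\<close>: the blocks \<open>{0}\<close>, \<open>(0, P]\<close>, \<open>(P, P + h]\<close> of \<open>[0, P + h]\<close> are moved to
  \<open>{0}\<close>, \<open>(h, h + P]\<close>, \<open>(0, h]\<close>, which make up \<open>[0, P]\<close> because \<open>h + P = P\<close>.\<close>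
lemma seg_eq_iic_absorb:
  assumes h: "h \<in> fin_supp r" and a: "a \<in> Field r" and k: "k \<noteq> 0"
    and less: "\<And>y. h y \<noteq> 0 \<Longrightarrow> lt r y a"
  shows "seg_eq r (iic r (cnf_add r (single a k) h)) (iic r (single a k))"
proof -
  let ?P = "single a k" and ?z = "\<lambda>_. 0 :: nat"
  have P: "?P \<in> fin_supp r" using a by (rule single_fin_supp)
  define g where "g = cnf_add r ?P h"
  have g: "g \<in> fin_supp r" unfolding g_def by (rule cnf_add_fin_supp[OF WO P h])
  have hP: "cnf_add r h ?P = ?P" by (rule cnf_add_absorb[OF k less])
  have Pg: "?P = g \<or> below r ?P g"
    using below_zero[OF WO h] cnf_add_mono[OF WO, of ?z h ?P] by (cases "h = ?z") (auto simp: g_def)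
  have "?P \<noteq> ?z" using k by (auto simp: single_def fun_eq_iff)
  then have "below r ?z ?P" by (rule below_zero[OF WO P])
  then have "below r h ?P" using cnf_add_mono[OF WO, of ?z ?P h] hP by simp
  then have hP': "h = ?P \<or> below r h ?P" by simp
  have op: "openin (exp_space r) (iic r x)" "openin (exp_space r) (iic r x \<inter> ioi r y)"
    if "x \<in> fin_supp r" "y \<in> fin_supp r" for x y
    using openin_iic openin_ioi that by auto
  have z: "?z \<in> fin_supp r" by simp
  \<comment> \<open>Translating \<open>(0, P]\<close> by h leaves the top in place, as h + P = P,
    and frees \<open>(0, h]\<close> for the block above P. The point 0 stays where it is because the
    translation is an embedding only on nonzero points.\<close>
  have "seg_eq r (iic r ?P) (iic r ?z \<union> (iic r ?P \<inter> ioi r h))"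
  proof -
    have "seg_eq r (iic r ?z \<union> (iic r ?P \<inter> ioi r ?z)) (iic r ?z \<union> (iic r ?P \<inter> ioi r h))"
    proof (rule seg_eq_Un)
      show "seg_eq r (iic r ?P \<inter> ioi r ?z) (iic r ?P \<inter> ioi r h)"
        using seg_eq_iic_translate[OF h P] unfolding hP iic_minus_zero[OF P] .
      show "iic r ?z \<inter> (iic r ?P \<inter> ioi r h) = {}"
        by (auto simp: iic_zero ioi_def)
      show "iic r ?z \<inter> (iic r ?P \<inter> ioi r ?z) = {}"
        by (auto simp: iic_zero ioi_def)
    qed (rule op(1)[OF z z] op(2)[OF P z] op(2)[OF P h] seg_eq_refl)+
    moreover have "iic r ?P = iic r ?z \<union> (iic r ?P \<inter> ioi r ?z)"
      by (rule iic_split) (use P \<open>below r ?z ?P\<close> in auto)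
    ultimately show ?thesis by simp
  qed
  then have "seg_eq r (iic r ?P \<union> (iic r g \<inter> ioi r ?P))
     ((iic r ?z \<union> (iic r ?P \<inter> ioi r h)) \<union> (iic r h \<inter> ioi r ?z))"
  proof (rule seg_eq_Un[rotated -2])
    show "seg_eq r (iic r g \<inter> ioi r ?P) (iic r h \<inter> ioi r ?z)"
      using seg_eq_iic_translate[OF P h] unfolding g_def[symmetric] iic_minus_zero[OF h]
      by (rule seg_eq_sym)
    show "iic r ?P \<inter> (iic r g \<inter> ioi r ?P) = {}" by (rule iic_split(2)[OF g P Pg])
    show "(iic r ?z \<union> (iic r ?P \<inter> ioi r h)) \<inter> (iic r h \<inter> ioi r ?z) = {}"
      using below_asym[OF WO h] by (auto simp: iic_zero ioi_def iic_def)
    show "openin (exp_space r) (iic r ?z \<union> (iic r ?P \<inter> ioi r h))"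
      by (rule openin_Un[OF op(1)[OF z z] op(2)[OF P h]])
  qed (rule op(1)[OF P z] op(2)[OF g P] op(2)[OF h z])+
  moreover have "iic r ?P \<union> (iic r g \<inter> ioi r ?P) = iic r g"
    using iic_split(1)[OF g P Pg] by simp
  moreover have "(iic r ?z \<union> (iic r ?P \<inter> ioi r h)) \<union> (iic r h \<inter> ioi r ?z) = iic r ?P"
  proof -
    have "iic r ?z \<union> (iic r h \<inter> ioi r ?z) = iic r h"
      using iic_minus_zero[OF h] zero_in_iic[OF h] by (auto simp: iic_zero)
    then show ?thesis using iic_split(1)[OF P h hP'] by blast
  qed
  ultimately show ?thesis by (simp add: g_def)
qed

text \<open>Removing the leading term of g leaves a tail with exponents below a, so g is
  \<open>\<omega>\<^sup>a k\<close> plus this tail and absorption applies.\<close>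

lemma seg_eq_iic_leading:
  assumes g: "g \<in> fin_supp r" and a: "g a \<noteq> 0" "\<And>y. lt r a y \<Longrightarrow> g y = 0"
  shows "seg_eq r (iic r g) (iic r (single a (g a)))"
proof -
  define h where "h = g(a := 0)"
  have aF: "a \<in> Field r" using fin_supp_Field[OF g, of a] a by simp
  have h: "h \<in> fin_supp r" by (rule fin_supp_mono[OF g]) (auto simp: h_def split: if_splits)
  have less: "lt r y a" if "h y \<noteq> 0" for y
  proof -
    have "y \<noteq> a" "g y \<noteq> 0" using that by (auto simp: h_def split: if_splits)
    then show ?thesis using lt_linear[OF WO aF fin_supp_Field[OF g, of y]] a(2) by auto
  qed
  have "cnf_add r (single a (g a)) h = g"
  proof
    fix y
    consider "y = a" | "lt r a y" | "y \<noteq> a" "\<not> lt r a y" by blast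
    then show "cnf_add r (single a (g a)) h y = g y"
    proof cases
      case 1
      have "\<not> (\<exists>z. lt r a z \<and> h z \<noteq> 0)" using less lt_asym[OF WO] by blast
      then show ?thesis using 1 by (auto simp: cnf_add_def single_def h_def)
    next
      case 2
      then have "g y = 0" "h y = 0" using a(2) less lt_asym[OF WO] by blast+
      then show ?thesis using 2 by (auto simp: cnf_add_def single_def)
    next
      case 3
      then show ?thesis by (auto simp: cnf_add_def single_def h_def)
    qed
  qed
  then show ?thesis using seg_eq_iic_absorb[OF h aF a(1) less] by simp
qed

text \<open>Cutting \<open>[0, f)\<close> at \<delta> leaves a translate of
  \<open>(0, \<omega>\<^sup>b)\<close> behind the cut. All translates of this block are
  homeomorphic, so only the closed part up to \<delta> has to be simplified.\<close>

lemma seg_eq_iio_leading_trailing: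
  assumes f: "f \<in> fin_supp r" and a: "f a \<noteq> 0" "\<And>y. lt r a y \<Longrightarrow> f y = 0"
    and b: "f b \<noteq> 0" "\<And>y. lt r y b \<Longrightarrow> f y = 0" and ba: "lt r b a"
  shows "seg_eq r (iio r f) (iio r (cnf_add r (single a (f a)) (single b 1)))"
proof -
  \<comment> \<open>This is \<delta>: one copy of the last term is taken off. Since b differs from
    a, the leading term keeps its coefficient even if the coefficient at b becomes 0.\<close>
  define d where "d = f(b := f b - 1)"
  let ?P = "single a (f a)" and ?w = "single b 1"
  have d: "d \<in> fin_supp r" by (rule fin_supp_mono[OF f]) (auto simp: d_def split: if_splits)
  have w: "?w \<in> fin_supp r" using lt_Field(1)[OF ba] by (rule single_fin_supp)
  have P: "?P \<in> fin_supp r" using lt_Field(2)[OF ba] by (rule single_fin_supp)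
  have ab: "a \<noteq> b" using ba by auto
  have fd: "f = cnf_add r d ?w"
  proof
    fix y
    show "f y = cnf_add r d ?w y"
      using b(2)[of y] b(1) lt_irrefl[of r b] by (auto simp: cnf_add_def d_def single_def)
  qed
  have w0: "below r (\<lambda>_. 0) ?w" by (rule below_zero[OF WO w]) (auto simp: single_def fun_eq_iff)
  have s: "iio r (cnf_add r x ?w) = iic r x \<union> (iio r (cnf_add r x ?w) \<inter> ioi r x)"
    "iic r x \<inter> (iio r (cnf_add r x ?w) \<inter> ioi r x) = {}" if x: "x \<in> fin_supp r" for x
    using iio_split[OF cnf_add_fin_supp[OF WO x w] x] cnf_add_mono[OF WO w0, of x] by auto
  have op: "openin (exp_space r) (iic r x)" "openin (exp_space r) (iio r (cnf_add r x ?w) \<inter> ioi r x)"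
    if "x \<in> fin_supp r" for x
    using openin_iic openin_iio openin_ioi that cnf_add_fin_supp[OF WO that w] by auto
  have "seg_eq r (iic r d \<union> (iio r (cnf_add r d ?w) \<inter> ioi r d))
          (iic r ?P \<union> (iio r (cnf_add r ?P ?w) \<inter> ioi r ?P))"
  proof (rule seg_eq_Un)
    have "d a = f a" using ab by (simp add: d_def)
    moreover have "d y = 0" if "lt r a y" for y using that a(2) by (auto simp: d_def)
    ultimately show "seg_eq r (iic r d) (iic r ?P)"
      using seg_eq_iic_leading[OF d, of a] a by simp
    show "seg_eq r (iio r (cnf_add r d ?w) \<inter> ioi r d) (iio r (cnf_add r ?P ?w) \<inter> ioi r ?P)"
      by (rule seg_eq_trans[OF seg_eq_sym[OF seg_eq_iio_translate[OF d w]] seg_eq_iio_translate[OF P w]])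
  qed (rule op(1)[OF d] op(2)[OF d] op(1)[OF P] op(2)[OF P] s(2)[OF d] s(2)[OF P])+
  then have "seg_eq r (iio r (cnf_add r d ?w)) (iio r (cnf_add r ?P ?w))"
    unfolding s(1)[OF d, symmetric] s(1)[OF P, symmetric] .
  then show ?thesis unfolding fd[symmetric] .
qed

end

subsection \<open>Existence of normal forms\<close>

text \<open>Lets an ordinal \<alpha> on another type serve as the exponents below t, so that
  \<open>\<omega>\<^sup>\<alpha>\<close> shows up as a segment of the host.\<close>

definition seg_iso :: "'b rel \<Rightarrow> 'a rel \<Rightarrow> 'a \<Rightarrow> ('b \<Rightarrow> 'a) \<Rightarrow> bool" where
  "seg_iso \<alpha> r t e \<longleftrightarrow> bij_betw e (Field \<alpha>) (underS r t) \<and>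
    (\<forall>x\<in>Field \<alpha>. \<forall>y\<in>Field \<alpha>. (x, y) \<in> \<alpha> \<longleftrightarrow> (e x, e y) \<in> r)"

definition pull :: "'b rel \<Rightarrow> ('b \<Rightarrow> 'a) \<Rightarrow> ('a \<Rightarrow> nat) \<Rightarrow> 'b \<Rightarrow> nat" where
  "pull \<alpha> e g = (\<lambda>x. if x \<in> Field \<alpha> then g (e x) else 0)"

text \<open>A right inverse of \<open>pull\<close> that also sets the coefficient at t. The segment
  carrying f may end strictly below t; this happens for the summand
  \<open>\<omega>\<^sup>\<beta>\<close> that follows
  \<open>\<omega>\<^sup>\<alpha> k\<close>.\<close>

definition push :: "'b rel \<Rightarrow> ('b \<Rightarrow> 'a) \<Rightarrow> 'a \<Rightarrow> nat \<Rightarrow> ('b \<Rightarrow> nat) \<Rightarrow> 'a \<Rightarrow> nat" where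
  "push \<alpha> e t i f = (\<lambda>y. if y = t then i else if y \<in> e ` Field \<alpha> then f (inv_into (Field \<alpha>) e y) else 0)"

lemma pull_fin_supp:
  assumes e: "seg_iso \<alpha> r t e" and g: "g \<in> fin_supp r"
  shows "pull \<alpha> e g \<in> fin_supp \<alpha>"
proof -
  have "inj_on e (Field \<alpha>)" using e by (simp add: seg_iso_def bij_betw_def)
  then have "finite (e -` {y. g y \<noteq> 0} \<inter> Field \<alpha>)"
    using g by (intro finite_vimage_IntI) (auto simp: fin_supp_def)
  moreover have "{x. pull \<alpha> e g x \<noteq> 0} \<subseteq> e -` {y. g y \<noteq> 0} \<inter> Field \<alpha>"
    by (auto simp: pull_def)
  ultimately show ?thesis unfolding fin_supp_def using finite_subset by blast
qed

lemma push_fin_supp: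
  assumes e: "seg_iso \<alpha> r t' e" and f: "f \<in> fin_supp \<alpha>" and t: "t \<in> Field r"
  shows "push \<alpha> e t i f \<in> fin_supp r"
proof -
  have sub: "{y. push \<alpha> e t i f y \<noteq> 0} \<subseteq> insert t (e ` {x. f x \<noteq> 0})"
  proof
    fix y assume "y \<in> {y. push \<alpha> e t i f y \<noteq> 0}"
    then have y: "y = t \<or> y \<in> e ` Field \<alpha> \<and> f (inv_into (Field \<alpha>) e y) \<noteq> 0"
      by (auto simp: push_def split: if_splits)
    then show "y \<in> insert t (e ` {x. f x \<noteq> 0})"
      using f_inv_into_f[of y e "Field \<alpha>"] by (metis (mono_tags) imageI insert_iff mem_Collect_eq)
  qed
  moreover have "finite (insert t (e ` {x. f x \<noteq> 0}))" using f by (simp add: fin_supp_def)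
  moreover have "insert t (e ` {x. f x \<noteq> 0}) \<subseteq> Field r"
  proof -
    have "e ` {x. f x \<noteq> 0} \<subseteq> e ` Field \<alpha>" using f by (auto simp: fin_supp_def)
    moreover have "e ` Field \<alpha> = underS r t'" using e by (simp add: seg_iso_def bij_betw_def)
    moreover have "underS r t' \<subseteq> Field r" by (rule Order_Relation.underS_Field)
    ultimately show ?thesis using t by blast
  qed
  ultimately show ?thesis unfolding fin_supp_def using finite_subset by blast
qed

lemma push_simps:
  assumes e: "seg_iso \<alpha> r t' e" and t: "t' = t \<or> lt r t' t" and WO: "Well_order r"
  shows "push \<alpha> e t i f t = i" "lt r t y \<Longrightarrow> push \<alpha> e t i f y = 0"
    "y \<noteq> t \<Longrightarrow> \<not> lt r y t' \<Longrightarrow> push \<alpha> e t i f y = 0"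
    "f \<in> fin_supp \<alpha> \<Longrightarrow> pull \<alpha> e (push \<alpha> e t i f) = f"
proof -
  have im: "e ` Field \<alpha> = underS r t'" and inj: "inj_on e (Field \<alpha>)"
    using e by (auto simp: seg_iso_def bij_betw_def)
  have im': "lt r (e x) t" if "x \<in> Field \<alpha>" for x
  proof -
    have "lt r (e x) t'" using im that by (auto simp: underS_lt)
    then show ?thesis using t lt_trans[OF WO] by blast
  qed
  show "push \<alpha> e t i f t = i" by (simp add: push_def)
  show "push \<alpha> e t i f y = 0" if "lt r t y"
    using that im' lt_asym[OF WO, of t y] lt_irrefl[of r t] by (auto simp: push_def)
  show "push \<alpha> e t i f y = 0" if "y \<noteq> t" "\<not> lt r y t'"
    using that im by (auto simp: push_def underS_lt)
  show "pull \<alpha> e (push \<alpha> e t i f) = f" if f: "f \<in> fin_supp \<alpha>"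
  proof
    fix x
    show "pull \<alpha> e (push \<alpha> e t i f) x = f x"
    proof (cases "x \<in> Field \<alpha>")
      case True
      then have "e x \<noteq> t" using im'[OF True] lt_irrefl[of r t] by metis
      then show ?thesis using True inj by (simp add: pull_def push_def)
    next
      case False
      then show ?thesis using f by (auto simp: pull_def fin_supp_def)
    qed
  qed
qed

text \<open>The leading difference lies below t, hence comes from an exponent of \<alpha>, and e
  keeps track of which exponents lie above it.\<close>

lemma pull_below:
  assumes e: "seg_iso \<alpha> r t e" and p: "lt r p t" "f p < g p" "\<And>y. lt r p y \<Longrightarrow> f y = g y"
  shows "below \<alpha> (pull \<alpha> e f) (pull \<alpha> e g)"
proof -
  have "p \<in> e ` Field \<alpha>" using e p(1) by (auto simp: seg_iso_def bij_betw_def underS_lt)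
  then obtain q where q: "q \<in> Field \<alpha>" "p = e q" by blast
  have inj: "inj_on e (Field \<alpha>)" using e by (auto simp: seg_iso_def bij_betw_def)
  have "pull \<alpha> e f q < pull \<alpha> e g q" using p q by (simp add: pull_def)
  moreover have "pull \<alpha> e f y = pull \<alpha> e g y" if y: "lt \<alpha> q y" for y
  proof -
    have yF: "y \<in> Field \<alpha>" using y by (rule lt_Field)
    have "lt r p (e y)"
      using y e q yF inj unfolding lt_def seg_iso_def by (auto dest: inj_onD)
    then show ?thesis using p(3) yF by (simp add: pull_def)
  qed
  ultimately show ?thesis unfolding below_def by blast
qed

section \<open>Sums and products of orders\<close>

lemma fin_ord_iff: "(i, j) \<in> fin_ord k \<longleftrightarrow> i \<le> j \<and> j < k"
  by (simp add: fin_ord_def)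

lemma osum_iff:
  "(Inl a, Inl a') \<in> osum r s \<longleftrightarrow> (a, a') \<in> r" "(Inr b, Inr b') \<in> osum r s \<longleftrightarrow> (b, b') \<in> s"
  "(Inl a, Inr b) \<in> osum r s \<longleftrightarrow> a \<in> Field r \<and> b \<in> Field s" "(Inr b, Inl a) \<notin> osum r s"
  by (auto simp: osum_def)

lemma Field_fin_ord: "Field (fin_ord k) = {..<k}"
  by (auto simp: fin_ord_def Field_def)

lemma fin_ord_order: "Refl (fin_ord k)" "antisym (fin_ord k)"
  unfolding Field_fin_ord refl_on_def antisym_def by (auto simp: fin_ord_def)

lemma Field_oprod:
  assumes "Refl r" "Refl s"
  shows "Field (oprod r s) = Field r \<times> Field s"
proof
  show "Field (oprod r s) \<subseteq> Field r \<times> Field s" by (auto simp: Field_def oprod_def)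
  show "Field r \<times> Field s \<subseteq> Field (oprod r s)"
  proof
    fix x assume "x \<in> Field r \<times> Field s"
    then have "(x, x) \<in> oprod r s"
      using assms by (auto simp: oprod_def refl_on_def)
    then show "x \<in> Field (oprod r s)" by (rule FieldI1)
  qed
qed

lemma oprod_order:
  assumes "Refl r" "Refl s" "antisym r" "antisym s"
  shows "Refl (oprod r s)" "antisym (oprod r s)"
proof -
  show "Refl (oprod r s)"
    unfolding Field_oprod[OF assms(1,2)] using assms by (auto simp: refl_on_def oprod_def)
  show "antisym (oprod r s)"
    by (intro antisymI) (auto simp: oprod_def dest: antisymD[OF assms(3)] antisymD[OF assms(4)])
qed

lemma Field_osum:
  assumes "Refl r" "Refl s"
  shows "Field (osum r s) = Inl ` Field r \<union> Inr ` Field s"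
proof
  show "Field (osum r s) \<subseteq> Inl ` Field r \<union> Inr ` Field s"
    unfolding osum_def by (auto simp: Field_def)
  show "Inl ` Field r \<union> Inr ` Field s \<subseteq> Field (osum r s)"
  proof
    fix x assume "x \<in> Inl ` Field r \<union> Inr ` Field s"
    then have "(x, x) \<in> osum r s"
      using assms by (auto simp: osum_def refl_on_def)
    then show "x \<in> Field (osum r s)" by (rule FieldI1)
  qed
qed

lemma osum_order:
  assumes "Refl r" "Refl s" "antisym r" "antisym s"
  shows "Refl (osum r s)" "antisym (osum r s)"
proof -
  show "Refl (osum r s)"
    unfolding Field_osum[OF assms(1,2)] using assms by (auto simp: refl_on_def osum_def)
  show "antisym (osum r s)"
    by (intro antisymI) (auto simp: osum_def dest: antisymD[OF assms(3)] antisymD[OF assms(4)])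
qed

lemma wo_Refl_antisym: "Well_order r \<Longrightarrow> Refl r" "Well_order r \<Longrightarrow> antisym r" "Well_order r \<Longrightarrow> Total r"
  by (auto simp: well_order_on_def linear_order_on_def partial_order_on_def preorder_on_def)

lemma ordIso_homeomorphic: "(r, s) \<in> ordIso \<Longrightarrow> ord_space r homeomorphic_space ord_space s"
proof -
  assume "(r, s) \<in> ordIso"
  then obtain f where "iso r s f" by (auto simp: ordIso_def)
  then show ?thesis unfolding iso_iff2 by (intro homeomorphic_ord_space[of f]) auto
qed

lemma exp_segment_homeomorphic:
  assumes WO: "Well_order r" and g: "g \<in> fin_supp r" and s: "Refl s" "antisym s"
    and surj: "\<phi> ` iio r g = Field s"
    and mono: "\<And>x y. x \<in> iio r g \<Longrightarrow> y \<in> iio r g \<Longrightarrow> below r x y \<Longrightarrow> (\<phi> x, \<phi> y) \<in> s \<and> \<phi> x \<noteq> \<phi> y"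
  shows "subtopology (exp_space r) (iio r g) homeomorphic_space ord_space s"
proof -
  let ?R = "omega_exp r"
  let ?S = "Restr ?R (underS ?R g)"
  note WOE = Well_order_omega_exp[OF WO]
  have F: "Field ?S = iio r g" using wo_Restr_underS[OF WOE] iio_underS[OF WO g] by simp
  have WOS: "Well_order ?S" by (rule Well_order_Restr[OF WOE])
  have "ord_space ?S homeomorphic_space ord_space s"
  proof (rule homeomorphic_ord_space_mono)
    show "\<phi> ` Field ?S = Field s" using surj F by simp
    fix x y assume xy: "(x, y) \<in> ?S" "x \<noteq> y"
    then have "x \<in> iio r g" "y \<in> iio r g" using F by (auto intro: FieldI1 FieldI2 simp del: IntI)
    moreover have "below r x y" using xy by (auto simp: omega_exp_iff[OF WO])
    ultimately show "(\<phi> x, \<phi> y) \<in> s \<and> \<phi> x \<noteq> \<phi> y" by (rule mono)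
  qed (use wo_Refl_antisym[OF WOS] s in auto)
  then show ?thesis
    unfolding ord_space_Restr_underS[OF WOE] exp_space_def iio_underS[OF WO g] .
qed

lemma fin_supp_empty: "fin_supp {} = {\<lambda>_. 0}"
  by (auto simp: fin_supp_def)

text \<open>This is \<open>\<omega>\<^sup>0 = 1\<close>: without exponents only the zero function
  remains, and the two-term form with b least becomes family (2).\<close>

lemma nf2_osum:
  assumes \<alpha>: "Well_order \<alpha>" and \<beta>: "Well_order \<beta>" "Field \<beta> = {}"
  shows "ord_space (osum (oprod (omega_exp \<alpha>) (fin_ord k)) (omega_exp \<beta>)) homeomorphic_space nf2 \<alpha> k"
  unfolding nf2_def
proof (rule homeomorphic_ord_space[where \<phi> = "map_sum id (\<lambda>_. ())"])
  let ?A = "oprod (omega_exp \<alpha>) (fin_ord k)"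
  note E = wo_Refl_antisym[OF Well_order_omega_exp[OF \<alpha>]]
  note E' = wo_Refl_antisym[OF Well_order_omega_exp[OF \<beta>(1)]]
  have A: "Refl ?A" using oprod_order E fin_ord_order by blast
  have one: "Refl one_ord" "Field one_ord = {()}" by (auto simp: one_ord_def Field_def refl_on_def)
  have "Field (omega_exp \<beta>) = fin_supp {}" using \<beta> by (auto simp: Field_omega_exp fin_supp_def)
  then have B: "Field (omega_exp \<beta>) = {\<lambda>_. 0}" by (simp add: fin_supp_empty)
  have B': "(\<lambda>_. 0, \<lambda>_. 0) \<in> omega_exp \<beta>"
    using B E'(1) by (auto simp: refl_on_def)
  have F: "Field (osum ?A (omega_exp \<beta>)) = Inl ` Field ?A \<union> {Inr (\<lambda>_. 0)}"
    unfolding Field_osum[OF A E'(1)] B by simp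
  show "bij_betw (map_sum id (\<lambda>_. ())) (Field (osum ?A (omega_exp \<beta>))) (Field (osum ?A one_ord))"
    unfolding F Field_osum[OF A one(1)] one(2) by (auto simp: bij_betw_def inj_on_def image_iff)
  fix x y assume "x \<in> Field (osum ?A (omega_exp \<beta>))" "y \<in> Field (osum ?A (omega_exp \<beta>))"
  then show "(x, y) \<in> osum ?A (omega_exp \<beta>) \<longleftrightarrow> (map_sum id (\<lambda>_. ()) x, map_sum id (\<lambda>_. ()) y) \<in> osum ?A one_ord"
    unfolding F using B' one by (auto simp: osum_iff B one_ord_def)
qed

text \<open>This is \<open>\<omega>\<^sup>0 k = k\<close>, the way finite spaces arise from one-term
  normal forms.\<close>

lemma nf3_empty:
  assumes \<alpha>: "Well_order \<alpha>" "Field \<alpha> = {}"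
  shows "nf3 \<alpha> k homeomorphic_space nf1 k"
  unfolding nf3_def nf1_def
proof (rule homeomorphic_ord_space[where \<phi> = snd])
  have "Field (omega_exp \<alpha>) = fin_supp {}" using \<alpha> by (auto simp: Field_omega_exp fin_supp_def)
  then have B: "Field (omega_exp \<alpha>) = {\<lambda>_. 0}" by (simp add: fin_supp_empty)
  note E = wo_Refl_antisym[OF Well_order_omega_exp[OF \<alpha>(1)]]
  have B'': "(\<lambda>_. 0, \<lambda>_. 0) \<in> omega_exp \<alpha>"
    using B E(1) by (auto simp: refl_on_def)
  have F: "Field (oprod (omega_exp \<alpha>) (fin_ord k)) = {\<lambda>_. 0} \<times> {..<k}"
    unfolding Field_oprod[OF E(1) fin_ord_order(1)] B Field_fin_ord ..
  show "bij_betw snd (Field (oprod (omega_exp \<alpha>) (fin_ord k))) (Field (fin_ord k))"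
    unfolding F Field_fin_ord by (auto simp: bij_betw_def inj_on_def image_iff)
  fix x y assume "x \<in> Field (oprod (omega_exp \<alpha>) (fin_ord k))" "y \<in> Field (oprod (omega_exp \<alpha>) (fin_ord k))"
  then show "(x, y) \<in> oprod (omega_exp \<alpha>) (fin_ord k) \<longleftrightarrow> (snd x, snd y) \<in> fin_ord k"
    unfolding F by (auto simp: oprod_def B B'' Field_fin_ord fin_ord_iff)
qed

section \<open>Segments of the host as concrete ordinals\<close>

context
  fixes r :: "'a rel"
  assumes WO: "Well_order r"
begin

text \<open>Off t the function \<open>single t k\<close> vanishes, so a leading difference in its
  favour can only sit at t.\<close>

lemma iio_single:
  assumes t: "t \<in> Field r"
  shows "iio r (single t k) = {g \<in> fin_supp r. g t < k \<and> (\<forall>y. lt r t y \<longrightarrow> g y = 0)}"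
proof -
  have "below r g (single t k) \<longleftrightarrow> g t < k \<and> (\<forall>y. lt r t y \<longrightarrow> g y = 0)" for g
  proof
    assume "below r g (single t k)"
    then obtain p where p: "g p < single t k p" "\<And>y. lt r p y \<Longrightarrow> g y = single t k y"
      unfolding below_def by blast
    then have "p = t" by (auto simp: single_def split: if_splits)
    then show "g t < k \<and> (\<forall>y. lt r t y \<longrightarrow> g y = 0)"
      using p by (auto simp: single_def)
  next
    assume "g t < k \<and> (\<forall>y. lt r t y \<longrightarrow> g y = 0)"
    then show "below r g (single t k)"
      unfolding below_def by (intro exI[of _ t]) (auto simp: single_def)
  qed
  then show ?thesis by (auto simp: iio_def)
qed

lemma cnf_add_single_single:
  assumes "lt r b t"
  shows "cnf_add r (single t k) (single b 1) = (\<lambda>y. if y = t then k else if y = b then 1 else 0)"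
proof
  fix y
  show "cnf_add r (single t k) (single b 1) y = (if y = t then k else if y = b then 1 else 0)"
    using assms lt_irrefl[of r b] lt_asym[OF WO assms] by (auto simp: cnf_add_def single_def)
qed

text \<open>The leading difference sits at t or at b. In the second case the coefficient at t is
  already k and the rest lies below \<open>\<omega>\<^sup>b\<close>, hence has no exponent from b
  upwards.\<close>

lemma iio_two_terms:
  assumes bt: "lt r b t"
  shows "iio r (cnf_add r (single t k) (single b 1)) =
    {g \<in> fin_supp r. (\<forall>y. lt r t y \<longrightarrow> g y = 0) \<and>
       (g t < k \<or> g t = k \<and> (\<forall>y. lt r y t \<longrightarrow> \<not> lt r y b \<longrightarrow> g y = 0))}"
proof -
  let ?f = "\<lambda>y. if y = t then k else if y = b then 1 else 0 :: nat"
  have F: "b \<in> Field r" "t \<in> Field r" using lt_Field[OF bt] by auto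
  have btn: "b \<noteq> t" using bt by auto
  have "below r g ?f \<longleftrightarrow> (\<forall>y. lt r t y \<longrightarrow> g y = 0) \<and>
       (g t < k \<or> g t = k \<and> (\<forall>y. lt r y t \<longrightarrow> \<not> lt r y b \<longrightarrow> g y = 0))" (is "_ \<longleftrightarrow> ?Q g") for g
  proof
    assume "below r g ?f"
    then obtain p where p: "g p < ?f p" "\<And>y. lt r p y \<Longrightarrow> g y = ?f y"
      unfolding below_def by blast
    then consider "p = t" | "p = b" by (auto split: if_splits)
    then show "?Q g"
    proof cases
      case 1
      have "g y = 0" if "lt r t y" for y
        using p(2)[of y] that 1 lt_asym[OF WO bt] lt_irrefl[of r t] by (auto split: if_splits)
      then show ?thesis using p 1 by auto
    next
      case 2
      have "g y = 0" if "lt r t y" for y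
        using p(2)[of y] that 2 lt_trans[OF WO bt that] lt_irrefl[of r t] lt_irrefl[of r b] by (auto split: if_splits)
      moreover have "g t = k" using p(2)[of t] 2 bt by simp
      moreover have "g y = 0" if "lt r y t" "\<not> lt r y b" for y
      proof (cases "y = b")
        case True
        then show ?thesis using p(1) 2 btn by simp
      next
        case False
        then have "lt r b y" using lt_linear[OF WO F(1) lt_Field(1)[OF that(1)]] that by blast
        then show ?thesis using p(2)[of y] 2 False that(1) by (auto split: if_splits)
      qed
      ultimately show ?thesis by blast
    qed
  next
    assume Q: "?Q g"
    show "below r g ?f"
    proof (cases "g t < k")
      case True
      have "g y = ?f y" if "lt r t y" for y
        using that Q lt_asym[OF WO bt] lt_irrefl[of r t] by auto
      then show ?thesis unfolding below_def using True by (intro exI[of _ t]) auto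
    next
      case False
      then have Q': "g t = k" "\<And>y. lt r y t \<Longrightarrow> \<not> lt r y b \<Longrightarrow> g y = 0" using Q by auto
      have "g y = ?f y" if "lt r b y" for y
      proof -
        have "y \<noteq> b" "\<not> lt r y b" using that lt_asym[OF WO that] by auto
        then show ?thesis
          using Q Q' lt_linear[OF WO lt_Field(2)[OF that] F(2)] by auto
      qed
      moreover have "g b < ?f b" using Q'(2)[OF bt] btn by simp
      ultimately show ?thesis unfolding below_def by blast
    qed
  qed
  then show ?thesis unfolding cnf_add_single_single[OF bt] iio_def by auto
qed

text \<open>The coefficient at t decides first and the exponents below t decide ties. This is the
  order of \<open>oprod\<close>, in which the second factor dominates.\<close>

lemma pull_mono:
  assumes e: "seg_iso \<alpha> r t e" and t: "t \<in> Field r" and below: "below r x y"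
    and y: "y \<in> fin_supp r" "\<And>z. lt r t z \<Longrightarrow> y z = 0"
  shows "x t < y t \<or> x t = y t \<and> below \<alpha> (pull \<alpha> e x) (pull \<alpha> e y)"
proof -
  obtain p where p: "p \<in> Field r" "x p < y p" "\<And>z. lt r p z \<Longrightarrow> x z = y z"
    using below_Field[OF WO y(1) below] by blast
  have "\<not> lt r t p" using y(2)[of p] p(2) by auto
  then consider "p = t" | "lt r p t" using lt_linear[OF WO p(1) t] by blast
  then show ?thesis
  proof cases
    case 1 then show ?thesis using p by simp
  next
    case 2
    then show ?thesis using pull_below[where f = x and g = y, OF e 2 p(2)] p(3) 2 by blast
  qed
qed

lemma iio_single_nf3:
  assumes \<alpha>: "Well_order \<alpha>" and t: "t \<in> Field r" and e: "seg_iso \<alpha> r t e"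
  shows "subtopology (exp_space r) (iio r (single t k)) homeomorphic_space nf3 \<alpha> k"
  unfolding nf3_def
proof (rule exp_segment_homeomorphic[OF WO single_fin_supp[OF t], where \<phi> = "\<lambda>g. (pull \<alpha> e g, g t)"])
  let ?s = "oprod (omega_exp \<alpha>) (fin_ord k)"
  note E = wo_Refl_antisym[OF Well_order_omega_exp[OF \<alpha>]]
  show "Refl ?s" "antisym ?s" using oprod_order E fin_ord_order by blast+
  have F: "Field ?s = fin_supp \<alpha> \<times> {..<k}"
    unfolding Field_oprod[OF E(1) fin_ord_order(1)] Field_omega_exp[OF \<alpha>] Field_fin_ord ..
  have im: "(pull \<alpha> e g, g t) \<in> fin_supp \<alpha> \<times> {..<k}" if "g \<in> iio r (single t k)" for g
    using that pull_fin_supp[OF e] by (auto simp: iio_single[OF t])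
  show "(\<lambda>g. (pull \<alpha> e g, g t)) ` iio r (single t k) = Field ?s"
    unfolding F
  proof (intro subset_antisym subsetI)
    fix z assume "z \<in> fin_supp \<alpha> \<times> {..<k}"
    then obtain f i where z: "z = (f, i)" "f \<in> fin_supp \<alpha>" "i < k" by blast
    let ?g = "push \<alpha> e t i f"
    have "?g \<in> iio r (single t k)" "z = (pull \<alpha> e ?g, ?g t)"
      using push_simps[OF e _ WO] push_fin_supp[OF e z(2) t] z by (auto simp: iio_single[OF t])
    then show "z \<in> (\<lambda>g. (pull \<alpha> e g, g t)) ` iio r (single t k)" by blast
  qed (use im in blast)
  fix x y assume xy: "x \<in> iio r (single t k)" "y \<in> iio r (single t k)" "below r x y"
  have "x t < y t \<or> x t = y t \<and> below \<alpha> (pull \<alpha> e x) (pull \<alpha> e y)"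
    using pull_mono[OF e t xy(3)] xy(2) by (auto simp: iio_single[OF t])
  then show "((pull \<alpha> e x, x t), (pull \<alpha> e y, y t)) \<in> ?s \<and> (pull \<alpha> e x, x t) \<noteq> (pull \<alpha> e y, y t)"
    using im[OF xy(1)] im[OF xy(2)] below_neq
    by (auto simp: oprod_def omega_exp_iff[OF \<alpha>] Field_omega_exp[OF \<alpha>] Field_fin_ord fin_ord_iff)
qed

text \<open>The coefficient at t tells the summands apart: as long as it is less than k it is the
  second coordinate in the product, and once it equals k the rest runs through
  \<open>\<omega>\<^sup>\<beta>\<close>. An empty \<beta> is included and later gives family
  (2).\<close>

lemma iio_two_terms_nf4:
  assumes \<alpha>: "Well_order \<alpha>" and \<beta>: "Well_order \<beta>" and bt: "lt r b t"
    and e: "seg_iso \<alpha> r t e" and e': "seg_iso \<beta> r b e'"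
  shows "subtopology (exp_space r) (iio r (cnf_add r (single t k) (single b 1)))
    homeomorphic_space ord_space (osum (oprod (omega_exp \<alpha>) (fin_ord k)) (omega_exp \<beta>))"
proof (rule exp_segment_homeomorphic[OF WO,
      where \<phi> = "\<lambda>g. if g t < k then Inl (pull \<alpha> e g, g t) else Inr (pull \<beta> e' g)"])
  let ?f = "cnf_add r (single t k) (single b 1)"
  let ?A = "oprod (omega_exp \<alpha>) (fin_ord k)"
  let ?s = "osum ?A (omega_exp \<beta>)"
  let ?\<phi> = "\<lambda>g. if g t < k then Inl (pull \<alpha> e g, g t) else Inr (pull \<beta> e' g)"
  have b: "b \<in> Field r" and t: "t \<in> Field r" using lt_Field[OF bt] by auto
  show "?f \<in> fin_supp r" by (intro cnf_add_fin_supp[OF WO] single_fin_supp b t)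
  note E = wo_Refl_antisym[OF Well_order_omega_exp[OF \<alpha>]]
  note E' = wo_Refl_antisym[OF Well_order_omega_exp[OF \<beta>]]
  have A: "Refl ?A" "antisym ?A" using oprod_order E fin_ord_order by blast+
  show "Refl ?s" "antisym ?s" using osum_order A E' by blast+
  have FA: "Field ?A = fin_supp \<alpha> \<times> {..<k}"
    unfolding Field_oprod[OF E(1) fin_ord_order(1)] Field_omega_exp[OF \<alpha>] Field_fin_ord ..
  have F: "Field ?s = Inl ` (fin_supp \<alpha> \<times> {..<k}) \<union> Inr ` fin_supp \<beta>"
    unfolding Field_osum[OF A(1) E'(1)] FA Field_omega_exp[OF \<beta>] ..
  have D: "g \<in> iio r ?f \<longleftrightarrow> g \<in> fin_supp r \<and> (\<forall>y. lt r t y \<longrightarrow> g y = 0) \<and>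
       (g t < k \<or> g t = k \<and> (\<forall>y. lt r y t \<longrightarrow> \<not> lt r y b \<longrightarrow> g y = 0))" for g
    unfolding iio_two_terms[OF bt] by blast
  have im: "?\<phi> g \<in> Field ?s" if "g \<in> iio r ?f" for g
    using that pull_fin_supp[OF e, of g] pull_fin_supp[OF e', of g] unfolding D F by auto
  show "?\<phi> ` iio r ?f = Field ?s"
  proof (intro subset_antisym subsetI)
    fix z assume "z \<in> Field ?s"
    then consider f i where "z = Inl (f, i)" "f \<in> fin_supp \<alpha>" "i < k"
      | f where "z = Inr f" "f \<in> fin_supp \<beta>"
      unfolding F by blast
    then show "z \<in> ?\<phi> ` iio r ?f"
    proof cases
      case 1
      let ?g = "push \<alpha> e t i f"
      have "?g \<in> iio r ?f" "z = ?\<phi> ?g"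
        using push_simps[OF e _ WO] push_fin_supp[OF e 1(2) t] 1 unfolding D by auto
      then show ?thesis by blast
    next
      case 2
      let ?g = "push \<beta> e' t k f"
      have s: "b = t \<or> lt r b t" using bt by blast
      have "?g y = 0" if "lt r y t" "\<not> lt r y b" for y
        using push_simps(3)[OF e' s WO] that lt_irrefl by metis
      then have "?g \<in> iio r ?f"
        using push_simps(1,2)[OF e' s WO] push_fin_supp[OF e' 2(2) t] unfolding D by auto
      moreover have "z = ?\<phi> ?g"
        using push_simps(1,4)[OF e' s WO] 2 by auto
      ultimately show ?thesis by blast
    qed
  qed (use im in blast)
  fix x y assume xy: "x \<in> iio r ?f" "y \<in> iio r ?f" "below r x y"
  have m: "x t < y t \<or> x t = y t \<and> below \<alpha> (pull \<alpha> e x) (pull \<alpha> e y)"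
    using pull_mono[OF e t xy(3)] xy(2) unfolding D by blast
  have px: "pull \<alpha> e x \<in> fin_supp \<alpha>" "pull \<alpha> e y \<in> fin_supp \<alpha>"
    "pull \<beta> e' x \<in> fin_supp \<beta>" "pull \<beta> e' y \<in> fin_supp \<beta>"
    using pull_fin_supp[OF e] pull_fin_supp[OF e'] xy unfolding D by blast+
  consider "y t < k" "x t < k" | "x t < k" "\<not> y t < k" | "x t = k" "y t = k"
    using m xy unfolding D by force
  then show "(?\<phi> x, ?\<phi> y) \<in> ?s \<and> ?\<phi> x \<noteq> ?\<phi> y"
  proof cases
    case 1
    then show ?thesis
      using m px below_neq
      by (auto simp: osum_def oprod_def omega_exp_iff[OF \<alpha>] Field_omega_exp[OF \<alpha>] Field_fin_ord fin_ord_iff)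
  next
    case 2
    then show ?thesis using px FA by (auto simp: osum_def Field_omega_exp[OF \<beta>])
  next
    case 3
    obtain p where p: "p \<in> Field r" "x p < y p" "\<And>z. lt r p z \<Longrightarrow> x z = y z"
      using below_Field[OF WO _ xy(3)] xy(2) unfolding D by blast
    have "\<not> lt r t p" "p \<noteq> t" using xy(2) p(2) 3 unfolding D by auto
    then have "lt r p t" using lt_linear[OF WO p(1) t] by blast
    \<comment> \<open>At an exponent from b up to t the function y vanishes, which would contradict
      x p < y p.\<close>
    then have "lt r p b" using xy(2) 3 p(2) unfolding D by (metis less_irrefl not_less0)
    then have "below \<beta> (pull \<beta> e' x) (pull \<beta> e' y)" using pull_below[where f = x and g = y, OF e' _ p(2)] p(3) by blast
    then show ?thesis using 3 px below_neq by (auto simp: osum_def omega_exp_iff[OF \<beta>])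
  qed
qed

lemma nf3_one:
  shows "ord_space (omega_exp r) homeomorphic_space nf3 r 1"
  unfolding nf3_def
proof (rule homeomorphic_ord_space[where \<phi> = "\<lambda>f. (f, 0)"])
  note E = wo_Refl_antisym[OF Well_order_omega_exp[OF WO]]
  have F: "Field (oprod (omega_exp r) (fin_ord 1)) = Field (omega_exp r) \<times> {0}"
    unfolding Field_oprod[OF E(1) fin_ord_order(1)] Field_fin_ord by auto
  show "bij_betw (\<lambda>f. (f, 0)) (Field (omega_exp r)) (Field (oprod (omega_exp r) (fin_ord 1)))"
    unfolding F by (auto simp: bij_betw_def inj_on_def image_iff)
  fix x y assume "x \<in> Field (omega_exp r)" "y \<in> Field (omega_exp r)"
  then show "(x, y) \<in> omega_exp r \<longleftrightarrow> ((x, 0), (y, 0)) \<in> oprod (omega_exp r) (fin_ord 1)"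
    by (auto simp: oprod_def Field_fin_ord fin_ord_iff)
qed

text \<open>Otherwise \<open>\<omega>\<^sup>r\<close> would embed below some \<open>a\<close> in \<open>r\<close>, and \<open>x \<mapsto> \<omega>\<^sup>x\<close> would become a strictly
  increasing map of \<open>r\<close> into itself with \<open>u a < a\<close>.\<close>
lemma ordLeq_omega_exp: "(r, omega_exp r) \<in> ordLeq"
proof (rule ccontr)
  note WOE = Well_order_omega_exp[OF WO]
  assume "\<not> (r, omega_exp r) \<in> ordLeq"
  then have "(omega_exp r, r) \<in> ordLess" using ordLess_or_ordLeq[OF WOE WO] by blast
  then obtain a F where a: "a \<in> Field r" and F: "iso (omega_exp r) (Restr r (underS r a)) F"
    using ordLess_iff_ordIso_Restr[OF WO WOE] by (auto simp: ordIso_def)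
  define u where "u x = F (single x 1)" for x
  have fld: "Field (Restr r (underS r a)) = underS r a" by (rule wo_Restr_underS[OF WO])
  have bij: "bij_betw F (fin_supp r) (underS r a)"
    and ord: "\<And>f g. f \<in> fin_supp r \<Longrightarrow> g \<in> fin_supp r \<Longrightarrow>
        (f, g) \<in> omega_exp r \<longleftrightarrow> (F f, F g) \<in> Restr r (underS r a)"
    using F unfolding iso_iff2 fld Field_omega_exp[OF WO] by blast+
  have ua: "lt r (u x) a" if "x \<in> Field r" for x
    using bij single_fin_supp[OF that, of 1] by (auto simp: bij_betw_def u_def underS_lt)
  have umono: "lt r (u x) (u y)" if "lt r x y" for x y
  proof -
    have s: "single x 1 \<in> fin_supp r" "single y 1 \<in> fin_supp r"
      using lt_Field[OF that] single_fin_supp by metis+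
    have "single x 1 y < single y 1 y" using that by (auto simp: single_def)
    moreover have "single x 1 z = single y 1 z" if "lt r y z" for z
      using that \<open>lt r x y\<close> lt_asym[OF WO] lt_irrefl by (auto simp: single_def)
    ultimately have "below r (single x 1) (single y 1)" unfolding below_def by blast
    then have "(single x 1, single y 1) \<in> omega_exp r" "single x 1 \<noteq> single y 1"
      using s below_neq by (auto simp: omega_exp_iff[OF WO])
    moreover from this have "u x \<noteq> u y"
      using bij s by (auto simp: u_def bij_betw_def inj_on_def)
    ultimately show ?thesis using ord[OF s] by (auto simp: u_def lt_def)
  qed
  \<comment> \<open>A least x with u x < x is undercut by u x itself, because u is strictly
    increasing.\<close>
  let ?A = "{x. lt r (u x) x}"
  have "?A \<noteq> {}" using ua[OF a] by blast
  then obtain m where m: "lt r (u m) m" "\<And>y. (y, m) \<in> {(x, y). lt r x y} \<Longrightarrow> y \<notin> ?A"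
    using wfE_min'[OF wf_lt[OF WO], of ?A] by blast
  then show False using umono[OF m(1)] by blast
qed

end

lemma seg_iso_Restr: "Well_order r \<Longrightarrow> seg_iso (Restr r (underS r t)) r t id"
  unfolding seg_iso_def wo_Restr_underS by auto

lemma ordLess_Restr_underS:
  assumes WO: "Well_order r" and bt: "lt r b t"
  shows "(Restr r (underS r b), Restr r (underS r t)) \<in> ordLess"
proof -
  let ?s = "Restr r (underS r t)"
  have "b \<in> Field ?s" unfolding wo_Restr_underS[OF WO] using bt by (simp add: underS_lt)
  then have "(Restr ?s (underS ?s b), ?s) \<in> ordLess"
    by (intro underS_Restr_ordLess Well_order_Restr[OF WO]) auto
  moreover have "underS ?s b = underS r b"
    using bt lt_trans[OF WO _ bt] unfolding underS_lt by (auto simp: lt_def underS_def)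
  moreover have "Restr ?s (underS r b) = Restr r (underS r b)"
    using lt_trans[OF WO _ bt] unfolding underS_lt by auto
  ultimately show ?thesis by simp
qed

text \<open>Except when \<gamma> equals \<open>\<omega>\<^sup>\<gamma>\<close>, the exponents
  \<alpha> and \<beta> are the initial segments of \<gamma> cut off at the leading and the last
  exponent of f. Hence they can live on the type of \<gamma>.\<close>

theorem ord_space_classification:
  fixes \<gamma> :: "'a rel"
  assumes WO: "Well_order \<gamma>"
  shows "(\<exists>k. ord_space \<gamma> homeomorphic_space nf1 k) \<or>
      (\<exists>(\<alpha> :: 'a rel) k. ok23 \<alpha> k \<and> ord_space \<gamma> homeomorphic_space nf2 \<alpha> k) \<or>
      (\<exists>(\<alpha> :: 'a rel) k. ok23 \<alpha> k \<and> ord_space \<gamma> homeomorphic_space nf3 \<alpha> k) \<or>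
      (\<exists>(\<alpha> :: 'a rel) \<beta> k. ok4 \<alpha> \<beta> k \<and> ord_space \<gamma> homeomorphic_space nf4 \<alpha> \<beta> k)"
proof (cases "Field \<gamma> = {}")
  case True
  then have "\<gamma> = {}" by (auto simp: Field_def)
  moreover have "fin_ord 0 = {}" by (auto simp: fin_ord_iff)
  ultimately have "ord_space \<gamma> homeomorphic_space nf1 0"
    unfolding nf1_def by (intro homeomorphic_ord_space) (auto simp: bij_betw_def)
  then show ?thesis by blast
next
  case ne: False
  note WOE = Well_order_omega_exp[OF WO]
  \<comment> \<open>Equality does occur, at the epsilon numbers. These are in family (3) with
    \<alpha> = \<gamma> and k = 1.\<close>
  consider "(\<gamma>, omega_exp \<gamma>) \<in> ordIso" | "(\<gamma>, omega_exp \<gamma>) \<in> ordLess"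
    using ordLeq_omega_exp[OF WO] ordLeq_iff_ordLess_or_ordIso by blast
  then show ?thesis
  proof cases
    case 1
    then have "ord_space \<gamma> homeomorphic_space nf3 \<gamma> 1"
      using ordIso_homeomorphic nf3_one[OF WO] homeomorphic_space_trans by blast
    moreover have "ok23 \<gamma> 1" using WO ne by (simp add: ok23_def)
    ultimately show ?thesis by blast
  next
    case 2
    then obtain f where f: "f \<in> fin_supp \<gamma>" and iso: "(\<gamma>, Restr (omega_exp \<gamma>) (underS (omega_exp \<gamma>) f)) \<in> ordIso"
      using ordLess_iff_ordIso_Restr[OF WOE WO] by (auto simp: Field_omega_exp[OF WO])
    have hom: "ord_space \<gamma> homeomorphic_space subtopology (exp_space \<gamma>) (iio \<gamma> f)"
      using ordIso_homeomorphic[OF iso]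
      unfolding ord_space_Restr_underS[OF WOE] exp_space_def iio_underS[OF WO f] .
    have "f \<noteq> (\<lambda>_. 0)"
    proof
      assume "f = (\<lambda>_. 0)"
      then have "iio \<gamma> f = {}" by (simp add: iio_def)
      then have "ord_space \<gamma> = trivial_topology" using homeomorphic_empty_space[OF hom] by simp
      then have "topspace (ord_space \<gamma>) = {}" by (rule ssubst) simp
      then show False using ne unfolding topspace_ord_space by contradiction
    qed
    then have S: "{x. f x \<noteq> 0} \<noteq> {}" "finite {x. f x \<noteq> 0}" "{x. f x \<noteq> 0} \<subseteq> Field \<gamma>"
      using f by (auto simp: fin_supp_def)
    obtain a where "a \<in> {x. f x \<noteq> 0}" "\<And>y. y \<in> {x. f x \<noteq> 0} \<Longrightarrow> y = a \<or> lt \<gamma> y a"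
      by (rule ex_greatest[OF WO S(2,1,3)], rule that)
    then have a: "f a \<noteq> 0" "\<And>y. f y \<noteq> 0 \<Longrightarrow> y = a \<or> lt \<gamma> y a" by auto
    obtain b where "b \<in> {x. f x \<noteq> 0}" "\<And>y. y \<in> {x. f x \<noteq> 0} \<Longrightarrow> y = b \<or> lt \<gamma> b y"
      by (rule ex_least[OF WO S(3,1)], rule that)
    then have b: "f b \<noteq> 0" "\<And>y. f y \<noteq> 0 \<Longrightarrow> y = b \<or> lt \<gamma> b y" by auto
    have aF: "a \<in> Field \<gamma>" using a S by blast
    have top: "f y = 0" if "lt \<gamma> a y" for y using a(2)[of y] that lt_asym[OF WO that] by auto
    have bot: "f y = 0" if "lt \<gamma> y b" for y using b(2)[of y] that lt_asym[OF WO that] by auto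
    let ?\<alpha> = "Restr \<gamma> (underS \<gamma> a)" and ?\<beta> = "Restr \<gamma> (underS \<gamma> b)" and ?k = "f a"
    have WOa: "Well_order ?\<alpha>" and WOb: "Well_order ?\<beta>" using Well_order_Restr[OF WO] by blast+
    note Fa = wo_Restr_underS[OF WO, of a] and Fb = wo_Restr_underS[OF WO, of b]
    show ?thesis
    proof (cases "b = a")
      \<comment> \<open>Only one term: the space is \<open>\<omega>\<^sup>a k\<close> without any
        rearrangement, and it is finite exactly when a is the least exponent.\<close>
      case True
      have "f = single a ?k"
      proof
        fix y show "f y = single a ?k y"
          using top bot True a(2)[of y] by (cases "y = a") (auto simp: single_def)
      qed
      then have h: "ord_space \<gamma> homeomorphic_space nf3 ?\<alpha> ?k"
        using hom iio_single_nf3[OF WO WOa aF seg_iso_Restr[OF WO], of ?k] homeomorphic_space_trans by metis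
      show ?thesis
      proof (cases "Field ?\<alpha> = {}")
        case True
        then show ?thesis
          using homeomorphic_space_trans[OF h nf3_empty[OF WOa True]] by blast
      next
        case False
        then have "ok23 ?\<alpha> ?k" using WOa a by (simp add: ok23_def)
        then show ?thesis using h by blast
      qed
    next
      case False
      then have ba: "lt \<gamma> b a" using a(2)[OF b(1)] by blast
      have s: "subtopology (exp_space \<gamma>) (iio \<gamma> f) homeomorphic_space
        subtopology (exp_space \<gamma>) (iio \<gamma> (cnf_add \<gamma> (single a ?k) (single b 1)))"
        using seg_eq_iio_leading_trailing[OF WO f a(1) top b(1) bot ba] by (simp add: seg_eq_def)
      have h: "ord_space \<gamma> homeomorphic_space ord_space (osum (oprod (omega_exp ?\<alpha>) (fin_ord ?k)) (omega_exp ?\<beta>))"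
        by (rule homeomorphic_space_trans[OF homeomorphic_space_trans[OF hom s]
            iio_two_terms_nf4[OF WO WOa WOb ba seg_iso_Restr[OF WO] seg_iso_Restr[OF WO]]])
      have ne_a: "Field ?\<alpha> \<noteq> {}" unfolding Fa using ba by (auto simp: underS_lt)
      show ?thesis
      proof (cases "Field ?\<beta> = {}")
        \<comment> \<open>Here b is least, so the last term is a natural number and \<gamma> is a
          successor.\<close>
        case True
        have "ord_space \<gamma> homeomorphic_space nf2 ?\<alpha> ?k"
          by (rule homeomorphic_space_trans[OF h nf2_osum[OF WOa WOb True]])
        moreover have "ok23 ?\<alpha> ?k" using WOa a ne_a by (simp add: ok23_def)
        ultimately show ?thesis by blast
      next
        case False
        have "ord_space \<gamma> homeomorphic_space nf4 ?\<alpha> ?\<beta> ?k" using h by (simp add: nf4_def)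
        moreover have "ok4 ?\<alpha> ?\<beta> ?k"
          using WOa WOb ne_a False ordLess_Restr_underS[OF WO ba] a by (simp add: ok4_def)
        ultimately show ?thesis by blast
      qed
    qed
  qed
qed

subsection \<open>Cantor-Bendixson ranks\<close>

text \<open>These conditions say that \<open>\<rho> x\<close> is the Cantor-Bendixson rank of \<open>x\<close>.\<close>
definition rank_fun :: "'x topology \<Rightarrow> 'a rel \<Rightarrow> ('x \<Rightarrow> 'a) \<Rightarrow> bool" where
  "rank_fun X r \<rho> \<longleftrightarrow> \<rho> ` topspace X \<subseteq> Field r \<and>
    (\<forall>x\<in>topspace X. \<exists>U. openin X U \<and> x \<in> U \<and> (\<forall>y\<in>U. y \<noteq> x \<longrightarrow> lt r (\<rho> y) (\<rho> x))) \<and>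
    (\<forall>x\<in>topspace X. \<forall>U d. openin X U \<longrightarrow> x \<in> U \<longrightarrow> lt r d (\<rho> x) \<longrightarrow>
       (\<exists>y\<in>U. y \<noteq> x \<and> (d, \<rho> y) \<in> r))"

text \<open>In the infinite normal forms this drops just the top rank \<alpha>, attained only at
  finitely many points \<open>\<omega>\<^sup>\<alpha> i\<close>. Values of r that are never attained
  drop out as well.\<close>

definition big_ranks :: "'x topology \<Rightarrow> 'a rel \<Rightarrow> ('x \<Rightarrow> 'a) \<Rightarrow> 'a set" where
  "big_ranks X r \<rho> = {d \<in> Field r. infinite {x \<in> topspace X. \<rho> x = d}}"

text \<open>Detects how the space ends: for the segment below f these turn out to be the ranks below
  the last exponent of f, since points of such ranks accumulate at the missing end point.\<close>

definition noncompact_ranks :: "'x topology \<Rightarrow> 'a rel \<Rightarrow> ('x \<Rightarrow> 'a) \<Rightarrow> 'a set" where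
  "noncompact_ranks X r \<rho> = {d \<in> big_ranks X r \<rho>. \<not> compactin X {x \<in> topspace X. (d, \<rho> x) \<in> r}}"

text \<open>The invariants are \<alpha>, \<beta> and n. The first two enter up to isomorphism
  because r is merely a host for ranks and differs in type from space to space.\<close>

definition rank_type :: "'x topology \<Rightarrow> 'a rel \<Rightarrow> ('x \<Rightarrow> 'a) \<Rightarrow> 'b rel \<Rightarrow> 'c rel \<Rightarrow> nat \<Rightarrow> bool" where
  "rank_type X r \<rho> \<alpha> \<beta> n \<longleftrightarrow> Well_order r \<and> rank_fun X r \<rho> \<and>
    (Restr r (big_ranks X r \<rho>), \<alpha>) \<in> ordIso \<and>
    (Restr r (noncompact_ranks X r \<rho>), \<beta>) \<in> ordIso \<and>
    card {x \<in> topspace X. \<rho> x \<notin> big_ranks X r \<rho>} = n"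

lemma rank_fun_Field: "rank_fun X r \<rho> \<Longrightarrow> x \<in> topspace X \<Longrightarrow> \<rho> x \<in> Field r"
  by (auto simp: rank_fun_def)

lemma rank_fun_nhd:
  assumes "rank_fun X r \<rho>" "x \<in> topspace X"
  obtains U where "openin X U" "x \<in> U" "\<And>y. y \<in> U \<Longrightarrow> y \<noteq> x \<Longrightarrow> lt r (\<rho> y) (\<rho> x)"
proof -
  have "\<exists>U. openin X U \<and> x \<in> U \<and> (\<forall>y\<in>U. y \<noteq> x \<longrightarrow> lt r (\<rho> y) (\<rho> x))"
    using assms unfolding rank_fun_def by blast
  then show thesis using that by blast
qed

lemma rank_fun_approx:
  assumes "rank_fun X r \<rho>" "x \<in> U" "openin X U" "lt r d (\<rho> x)"
  obtains y where "y \<in> U" "y \<noteq> x" "(d, \<rho> y) \<in> r"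
proof -
  have "x \<in> topspace X" using assms(2,3) openin_subset by blast
  then show thesis using assms that unfolding rank_fun_def by blast
qed

text \<open>Let \<rho> x = v be less than \<sigma> x, with agreement wherever a value below v is
  taken. Near x all other values of \<rho> are below v, yet some \<sigma> y is at least v; at this y
  the functions agree, which is absurd.\<close>

lemma rank_fun_unique:
  assumes WO: "Well_order r" and \<rho>: "rank_fun X r \<rho>" and \<sigma>: "rank_fun X r \<sigma>"
    and x: "x \<in> topspace X"
  shows "\<rho> x = \<sigma> x"
proof -
  \<comment> \<open>The induction runs over values instead of points, and it covers points where
    either function takes the value v, so that the two functions can be exchanged.\<close>
  have "\<forall>x\<in>topspace X. \<rho> x = v \<or> \<sigma> x = v \<longrightarrow> \<rho> x = \<sigma> x" for v
    using wf_lt[OF WO]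
  proof (induction v rule: wf_induct_rule)
    case (less v)
    have step: False if \<rho>: "rank_fun X r \<rho>" and \<sigma>: "rank_fun X r \<sigma>" and x: "x \<in> topspace X"
      and v: "\<rho> x = v" "\<sigma> x \<noteq> v"
      and IH: "\<And>w y. lt r w v \<Longrightarrow> y \<in> topspace X \<Longrightarrow> \<rho> y = w \<or> \<sigma> y = w \<Longrightarrow> \<rho> y = \<sigma> y" for \<rho> \<sigma> x
    proof -
      have "\<not> lt r (\<sigma> x) v" using IH[of "\<sigma> x" x] x v by auto
      then have "lt r v (\<sigma> x)"
        using lt_linear[OF WO rank_fun_Field[OF \<sigma> x] rank_fun_Field[OF \<rho> x]] v by blast
      obtain U where U: "openin X U" "x \<in> U" "\<And>y. y \<in> U \<Longrightarrow> y \<noteq> x \<Longrightarrow> lt r (\<rho> y) (\<rho> x)"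
        using rank_fun_nhd[OF \<rho> x] by blast
      obtain y where y: "y \<in> U" "y \<noteq> x" "(v, \<sigma> y) \<in> r"
        using rank_fun_approx[OF \<sigma> U(2,1) \<open>lt r v (\<sigma> x)\<close>] by blast
      have "lt r (\<rho> y) v" using U(3)[OF y(1,2)] v by simp
      moreover have "y \<in> topspace X" using y(1) U(1) openin_subset by blast
      ultimately have "\<rho> y = \<sigma> y" using IH by blast
      then show False
        using \<open>lt r (\<rho> y) v\<close> y(3) wo_antisym[OF WO, of v "\<rho> y"] by (auto simp: lt_def)
    qed
    show ?case
    proof (intro ballI impI)
      fix x assume x: "x \<in> topspace X" and v: "\<rho> x = v \<or> \<sigma> x = v"
      have IH: "\<rho> y = \<sigma> y" if "lt r w v" "y \<in> topspace X" "\<rho> y = w \<or> \<sigma> y = w" for w y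
        using less[of w] that by blast
      show "\<rho> x = \<sigma> x"
      proof (rule ccontr)
        assume ne: "\<rho> x \<noteq> \<sigma> x"
        from v show False
        proof
          assume "\<rho> x = v"
          then show False using step[OF \<rho> \<sigma> x _ _ IH] ne by auto
        next
          assume "\<sigma> x = v"
          moreover have "\<sigma> y = \<rho> y" if "lt r w v" "y \<in> topspace X" "\<sigma> y = w \<or> \<rho> y = w" for w y
            using IH[of w y] that by auto
          ultimately show False using step[OF \<sigma> \<rho> x] ne by auto
        qed
      qed
    qed
  qed
  then show ?thesis using x by blast
qed

section \<open>Changing the well-order of ranks\<close>

lemma embed_iff:
  assumes r: "Well_order r" and s: "Well_order s" and e: "embed r s e" and xy: "x \<in> Field r" "y \<in> Field r"
  shows "(e x, e y) \<in> s \<longleftrightarrow> (x, y) \<in> r" "lt s (e x) (e y) \<longleftrightarrow> lt r x y" "e x = e y \<longleftrightarrow> x = y"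
proof -
  have inj: "inj_on e (Field r)" by (rule embed_inj_on[OF r e])
  then show i: "e x = e y \<longleftrightarrow> x = y" using xy by (auto simp: inj_on_def)
  have c: "(x, y) \<in> r \<Longrightarrow> (e x, e y) \<in> s" for x y
    using embed_compat[OF e] by (auto simp: compat_def)
  show ii: "(e x, e y) \<in> s \<longleftrightarrow> (x, y) \<in> r"
    using c[of x y] c[of y x] wo_linear[OF r xy] wo_antisym[OF s, of "e x" "e y"] i wo_refl[OF r xy(1)] by metis
  show "lt s (e x) (e y) \<longleftrightarrow> lt r x y" using i ii by (simp add: lt_def)
qed

text \<open>The image of an embedding is an initial segment, so each d below
  \<open>e (\<rho> x)\<close> is itself a value of e and the approximation condition carries
  over.\<close>

lemma rank_fun_embed:
  assumes r: "Well_order r" and s: "Well_order s" and e: "embed r s e" and \<rho>: "rank_fun X r \<rho>"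
  shows "rank_fun X s (\<lambda>x. e (\<rho> x))"
  unfolding rank_fun_def
proof (intro conjI ballI allI impI)
  show "(\<lambda>x. e (\<rho> x)) ` topspace X \<subseteq> Field s"
    using embed_Field[OF e] rank_fun_Field[OF \<rho>] by blast
  fix x assume x: "x \<in> topspace X"
  obtain U where U: "openin X U" "x \<in> U" "\<And>y. y \<in> U \<Longrightarrow> y \<noteq> x \<Longrightarrow> lt r (\<rho> y) (\<rho> x)"
    using rank_fun_nhd[OF \<rho> x] by blast
  have "lt s (e (\<rho> y)) (e (\<rho> x))" if "y \<in> U" "y \<noteq> x" for y
    using U(3)[OF that] embed_iff(2)[OF r s e] lt_Field by metis
  then show "\<exists>U. openin X U \<and> x \<in> U \<and> (\<forall>y\<in>U. y \<noteq> x \<longrightarrow> lt s (e (\<rho> y)) (e (\<rho> x)))"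
    using U by blast
next
  fix x U d assume x: "x \<in> topspace X" and U: "openin X U" "x \<in> U" and d: "lt s d (e (\<rho> x))"
  have "bij_betw e (underS r (\<rho> x)) (underS s (e (\<rho> x)))"
    using embed_underS[OF r e rank_fun_Field[OF \<rho> x]] .
  moreover have "d \<in> underS s (e (\<rho> x))" using d by (simp add: underS_lt)
  ultimately obtain c where c: "lt r c (\<rho> x)" "d = e c"
    by (auto simp: bij_betw_def underS_lt)
  obtain y where y: "y \<in> U" "y \<noteq> x" "(c, \<rho> y) \<in> r"
    using rank_fun_approx[OF \<rho> U(2,1) c(1)] by blast
  have "(d, e (\<rho> y)) \<in> s"
    using y(3) embed_iff(1)[OF r s e, of c "\<rho> y"] c(2) by (auto intro: FieldI1 FieldI2)
  then show "\<exists>y\<in>U. y \<noteq> x \<and> (d, e (\<rho> y)) \<in> s" using y by blast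
qed

lemma ordIso_Restr_image:
  assumes r: "Well_order r" and s: "Well_order s" and e: "embed r s e" and A: "A \<subseteq> Field r"
  shows "(Restr r A, Restr s (e ` A)) \<in> ordIso"
proof -
  have eA: "e ` A \<subseteq> Field s" using embed_Field[OF e] A by blast
  have F: "Field (Restr r A) = A" "Field (Restr s (e ` A)) = e ` A"
    using Refl_Field_Restr2[OF wo_Refl_antisym(1)[OF r] A] Refl_Field_Restr2[OF wo_Refl_antisym(1)[OF s] eA]
    by auto
  have inj: "inj_on e A" using embed_inj_on[OF r e] A inj_on_subset by blast
  have "iso (Restr r A) (Restr s (e ` A)) e"
    unfolding iso_iff2 F
  proof (intro conjI ballI)
    show "bij_betw e A (e ` A)" using inj by (simp add: bij_betw_def)
    fix x y assume "x \<in> A" "y \<in> A"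
    then show "(x, y) \<in> Restr r A \<longleftrightarrow> (e x, e y) \<in> Restr s (e ` A)"
      using embed_iff(1)[OF r s e, of x y] A by blast
  qed
  then show ?thesis
    unfolding ordIso_def using Well_order_Restr[OF r] Well_order_Restr[OF s] by blast
qed

text \<open>Composing \<rho> with e gives another rank function into s. By uniqueness it agrees with
  \<sigma> on the space, and so the rank sets are images under e.\<close>

lemma rank_type_embed:
  assumes r: "Well_order r" and s: "Well_order s" and e: "embed r s e"
    and \<rho>: "rank_fun X r \<rho>" and \<sigma>: "rank_fun X s \<sigma>"
  shows "big_ranks X s \<sigma> = e ` big_ranks X r \<rho>"
    "noncompact_ranks X s \<sigma> = e ` noncompact_ranks X r \<rho>"
    "{x \<in> topspace X. \<sigma> x \<notin> big_ranks X s \<sigma>} = {x \<in> topspace X. \<rho> x \<notin> big_ranks X r \<rho>}"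
proof -
  have \<sigma>e: "\<sigma> x = e (\<rho> x)" if "x \<in> topspace X" for x
    using rank_fun_unique[OF s \<sigma> rank_fun_embed[OF r s e \<rho>] that] .
  have fib: "{x \<in> topspace X. \<sigma> x = e d} = {x \<in> topspace X. \<rho> x = d}" if "d \<in> Field r" for d
    using \<sigma>e embed_iff(3)[OF r s e _ that] rank_fun_Field[OF \<rho>] by auto
  show big: "big_ranks X s \<sigma> = e ` big_ranks X r \<rho>"
  proof (intro subset_antisym subsetI)
    fix d assume d: "d \<in> big_ranks X s \<sigma>"
    then have "infinite {x \<in> topspace X. \<sigma> x = d}" by (simp add: big_ranks_def)
    then have "{x \<in> topspace X. \<sigma> x = d} \<noteq> {}" by (rule infinite_imp_nonempty)
    then obtain x where x: "x \<in> topspace X" "d = e (\<rho> x)" using \<sigma>e by blast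
    have "\<rho> x \<in> Field r" by (rule rank_fun_Field[OF \<rho> x(1)])
    then show "d \<in> e ` big_ranks X r \<rho>"
      using d fib x(2) by (auto simp: big_ranks_def)
  next
    fix d assume "d \<in> e ` big_ranks X r \<rho>"
    then show "d \<in> big_ranks X s \<sigma>"
      using fib embed_Field[OF e] by (auto simp: big_ranks_def)
  qed
  have up: "{x \<in> topspace X. (e d, \<sigma> x) \<in> s} = {x \<in> topspace X. (d, \<rho> x) \<in> r}" if "d \<in> Field r" for d
    using \<sigma>e embed_iff(1)[OF r s e that] rank_fun_Field[OF \<rho>] by auto
  have sub: "big_ranks X r \<rho> \<subseteq> Field r" by (auto simp: big_ranks_def)
  have "compactin X {x \<in> topspace X. (e d, \<sigma> x) \<in> s} \<longleftrightarrow> compactin X {x \<in> topspace X. (d, \<rho> x) \<in> r}"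
    if "d \<in> big_ranks X r \<rho>" for d
    using up[of d] that sub by auto
  then show "noncompact_ranks X s \<sigma> = e ` noncompact_ranks X r \<rho>"
    unfolding noncompact_ranks_def big by blast
  have "\<sigma> x \<notin> big_ranks X s \<sigma> \<longleftrightarrow> \<rho> x \<notin> big_ranks X r \<rho>" if "x \<in> topspace X" for x
  proof -
    have "e (\<rho> x) = e d \<longleftrightarrow> \<rho> x = d" if "d \<in> big_ranks X r \<rho>" for d
      using embed_iff(3)[OF r s e rank_fun_Field[OF \<rho> \<open>x \<in> topspace X\<close>]] that sub by blast
    then show ?thesis unfolding big \<sigma>e[OF that] image_iff by blast
  qed
  then show "{x \<in> topspace X. \<sigma> x \<notin> big_ranks X s \<sigma>} = {x \<in> topspace X. \<rho> x \<notin> big_ranks X r \<rho>}" by blast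
qed

lemma rank_type_unique:
  assumes T: "rank_type X r \<rho> \<alpha> \<beta> n" and T': "rank_type X s \<sigma> \<alpha>' \<beta>' n'"
  shows "(\<alpha>, \<alpha>') \<in> ordIso \<and> (\<beta>, \<beta>') \<in> ordIso \<and> n = n'"
proof -
  \<comment> \<open>Kept polymorphic because either host may be the one that embeds, so the claim is
    also used with the roles exchanged.\<close>
  have *: "(\<alpha>, \<alpha>') \<in> ordIso \<and> (\<beta>, \<beta>') \<in> ordIso \<and> n = n'"
    if T: "rank_type X r \<rho> \<alpha> \<beta> n" and T': "rank_type X s \<sigma> \<alpha>' \<beta>' n'" and e: "embed r s e"
    for r :: "'p rel" and s :: "'q rel" and \<alpha> :: "'u rel" and \<beta> :: "'v rel" and \<alpha>' :: "'w rel"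
      and \<beta>' :: "'z rel" and n n' e \<rho> \<sigma>
  proof -
    have r: "Well_order r" and s: "Well_order s" and \<rho>: "rank_fun X r \<rho>" and \<sigma>: "rank_fun X s \<sigma>"
      using T T' by (auto simp: rank_type_def)
    note E = rank_type_embed[OF r s e \<rho> \<sigma>]
    have sub: "big_ranks X r \<rho> \<subseteq> Field r" "noncompact_ranks X r \<rho> \<subseteq> Field r"
      by (auto simp: big_ranks_def noncompact_ranks_def)
    have big: "(Restr r (big_ranks X r \<rho>), Restr s (big_ranks X s \<sigma>)) \<in> ordIso"
      and ncp: "(Restr r (noncompact_ranks X r \<rho>), Restr s (noncompact_ranks X s \<sigma>)) \<in> ordIso"
      unfolding E(1,2) by (intro ordIso_Restr_image[OF r s e] sub)+
    show ?thesis
    proof (intro conjI)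
      have A: "(Restr r (big_ranks X r \<rho>), \<alpha>) \<in> ordIso" "(Restr s (big_ranks X s \<sigma>), \<alpha>') \<in> ordIso"
        "(Restr r (noncompact_ranks X r \<rho>), \<beta>) \<in> ordIso" "(Restr s (noncompact_ranks X s \<sigma>), \<beta>') \<in> ordIso"
        using T T' unfolding rank_type_def by blast+
      show "(\<alpha>, \<alpha>') \<in> ordIso"
        by (rule ordIso_transitive[OF ordIso_symmetric[OF A(1)] ordIso_transitive[OF big A(2)]])
      show "(\<beta>, \<beta>') \<in> ordIso"
        by (rule ordIso_transitive[OF ordIso_symmetric[OF A(3)] ordIso_transitive[OF ncp A(4)]])
      show "n = n'" using T T' E(3) unfolding rank_type_def by simp
    qed
  qed
  have r: "Well_order r" and s: "Well_order s" using T T' by (auto simp: rank_type_def)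
  then consider e where "embed r s e" | e where "embed s r e"
    using wellorders_totally_ordered by blast
  then show ?thesis
  proof cases
    case 1 then show ?thesis by (rule *[OF T T'])
  next
    case 2 from *[OF T' T this] show ?thesis by (simp add: ordIso_symmetric)
  qed
qed

section \<open>Topological invariance of the rank data\<close>

lemma rank_type_homeomorphic:
  assumes T: "rank_type Y r \<rho> \<alpha> \<beta> n" and hom: "X homeomorphic_space Y"
  shows "\<exists>\<sigma>. rank_type X r \<sigma> \<alpha> \<beta> n"
proof -
  obtain h where h: "homeomorphic_map X Y h" using hom homeomorphic_space by blast
  have inj: "inj_on h (topspace X)" and im: "h ` topspace X = topspace Y"
    using homeomorphic_imp_injective_map[OF h] homeomorphic_imp_surjective_map[OF h] by auto
  have op: "openin X U \<longleftrightarrow> openin Y (h ` U)" if "U \<subseteq> topspace X" for U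
    using homeomorphic_map_openness_eq[OF h] homeomorphic_map_openness[OF h that] by blast
  have cp: "compactin X U \<longleftrightarrow> compactin Y (h ` U)" if "U \<subseteq> topspace X" for U
    using homeomorphic_map_compactness[OF h that] by blast
  let ?\<sigma> = "\<lambda>x. \<rho> (h x)"
  have rk: "rank_fun Y r \<rho>" using T by (simp add: rank_type_def)
  have pull: "h ` {x \<in> topspace X. P (h x)} = {y \<in> topspace Y. P y}" for P
    using im by auto
  have card: "card {x \<in> topspace X. P (h x)} = card {y \<in> topspace Y. P y}"
    "finite {x \<in> topspace X. P (h x)} \<longleftrightarrow> finite {y \<in> topspace Y. P y}" for P
  proof -
    have i: "inj_on h {x \<in> topspace X. P (h x)}" using inj by (rule inj_on_subset) auto
    show "card {x \<in> topspace X. P (h x)} = card {y \<in> topspace Y. P y}"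
      "finite {x \<in> topspace X. P (h x)} \<longleftrightarrow> finite {y \<in> topspace Y. P y}"
      using card_image[OF i] finite_image_iff[OF i] unfolding pull by auto
  qed
  have big: "big_ranks X r ?\<sigma> = big_ranks Y r \<rho>"
    unfolding big_ranks_def using card(2)[of "\<lambda>y. \<rho> y = d" for d] by auto
  have "compactin X {x \<in> topspace X. (d, ?\<sigma> x) \<in> r} \<longleftrightarrow> compactin Y {y \<in> topspace Y. (d, \<rho> y) \<in> r}" for d
    using cp[of "{x \<in> topspace X. (d, ?\<sigma> x) \<in> r}"] pull[of "\<lambda>y. (d, \<rho> y) \<in> r"] by auto
  then have ncp: "noncompact_ranks X r ?\<sigma> = noncompact_ranks Y r \<rho>"
    unfolding noncompact_ranks_def big by blast
  have "rank_fun X r ?\<sigma>"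
    unfolding rank_fun_def
  proof (intro conjI ballI allI impI)
    show "?\<sigma> ` topspace X \<subseteq> Field r" using im rank_fun_Field[OF rk] by auto
    fix x assume x: "x \<in> topspace X"
    then have hx: "h x \<in> topspace Y" using im by auto
    obtain U where U: "openin Y U" "h x \<in> U" "\<And>y. y \<in> U \<Longrightarrow> y \<noteq> h x \<Longrightarrow> lt r (\<rho> y) (\<rho> (h x))"
      using rank_fun_nhd[OF rk hx] by blast
    let ?V = "{z \<in> topspace X. h z \<in> U}"
    have "openin X ?V"
      using U(1) openin_subset[OF U(1)] op[of ?V] pull[of "\<lambda>y. y \<in> U"] by (simp add: Int_absorb1 Collect_conj_eq)
    moreover have "lt r (?\<sigma> y) (?\<sigma> x)" if "y \<in> ?V" "y \<noteq> x" for y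
      using that x inj U(3)[of "h y"] by (auto simp: inj_on_def)
    ultimately show "\<exists>U. openin X U \<and> x \<in> U \<and> (\<forall>y\<in>U. y \<noteq> x \<longrightarrow> lt r (?\<sigma> y) (?\<sigma> x))"
      using x U(2) by (intro exI[of _ ?V]) auto
  next
    fix x U d assume x: "x \<in> topspace X" and U: "openin X U" "x \<in> U" and d: "lt r d (?\<sigma> x)"
    have UX: "U \<subseteq> topspace X" by (rule openin_subset[OF U(1)])
    obtain y where y: "y \<in> h ` U" "y \<noteq> h x" "(d, \<rho> y) \<in> r"
      using rank_fun_approx[OF rk _ _ d, of "h ` U"] U op[OF UX] by blast
    then obtain z where "z \<in> U" "y = h z" by blast
    then show "\<exists>y\<in>U. y \<noteq> x \<and> (d, ?\<sigma> y) \<in> r" using y(2,3) by (intro bexI[of _ z]) auto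
  qed
  then have "rank_type X r ?\<sigma> \<alpha> \<beta> n"
    using T card(1)[of "\<lambda>y. \<rho> y \<notin> big_ranks Y r \<rho>"] unfolding rank_type_def big ncp by simp
  then show ?thesis by blast
qed

lemma rank_type_homeomorphic_unique:
  assumes "rank_type X r \<rho> \<alpha> \<beta> n" "rank_type Y s \<sigma> \<alpha>' \<beta>' n'" "X homeomorphic_space Y"
  shows "(\<alpha>, \<alpha>') \<in> ordIso \<and> (\<beta>, \<beta>') \<in> ordIso \<and> n = n'"
proof -
  obtain \<tau> where "rank_type X s \<tau> \<alpha>' \<beta>' n'"
    using rank_type_homeomorphic[OF assms(2,3)] ..
  then show ?thesis by (rule rank_type_unique[OF assms(1)])
qed

lemma rank_type_infinite:
  assumes T: "rank_type X r \<rho> \<alpha> \<beta> n" and "Field \<alpha> \<noteq> {}"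
  shows "infinite (topspace X)"
proof
  assume "finite (topspace X)"
  then have "big_ranks X r \<rho> = {}" by (simp add: big_ranks_def)
  then have "(Restr r {}, \<alpha>) \<in> ordIso" using T by (simp add: rank_type_def)
  then obtain f where "iso (Restr r {}) \<alpha> f" by (auto simp: ordIso_def)
  from iso_Field[OF this] show False using assms(2) by simp
qed

subsection \<open>Ranks of Cantor normal forms\<close>

text \<open>The exponent of the last term of the Cantor normal form; \<open>0\<close> is assigned the least element.\<close>
definition low :: "'a rel \<Rightarrow> ('a \<Rightarrow> nat) \<Rightarrow> 'a" where
  "low r f = (SOME m. m \<in> Field r \<and> (f m \<noteq> 0 \<or> f = (\<lambda>_. 0)) \<and> (\<forall>y. lt r y m \<longrightarrow> f y = 0) \<and>
     (f = (\<lambda>_. 0) \<longrightarrow> (\<forall>y. \<not> lt r y m)))"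

lemma single_eq_iff: "single a i = single a j \<longleftrightarrow> i = j"
  by (auto simp: single_def fun_eq_iff)

context
  fixes r :: "'a rel"
  assumes WO: "Well_order r" and ne: "Field r \<noteq> {}"
begin

lemma low_exists:
  assumes f: "f \<in> fin_supp r"
  shows "\<exists>m. m \<in> Field r \<and> (f m \<noteq> 0 \<or> f = (\<lambda>_. 0)) \<and> (\<forall>y. lt r y m \<longrightarrow> f y = 0) \<and>
     (f = (\<lambda>_. 0) \<longrightarrow> (\<forall>y. \<not> lt r y m))"
proof (cases "f = (\<lambda>_. 0)")
  case True
  obtain m where "m \<in> Field r" "\<And>y. y \<in> Field r \<Longrightarrow> y = m \<or> lt r m y"
    by (rule ex_least[OF WO subset_refl ne], rule that)
  moreover from this have "\<not> lt r y m" for y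
    using lt_asym[OF WO, of y m] lt_Field(1)[of r y m] by auto
  ultimately show ?thesis using True by auto
next
  case False
  have s: "{x. f x \<noteq> 0} \<subseteq> Field r" "{x. f x \<noteq> 0} \<noteq> {}" using f False by (auto simp: fin_supp_def)
  obtain m where "m \<in> {x. f x \<noteq> 0}" "\<And>y. y \<in> {x. f x \<noteq> 0} \<Longrightarrow> y = m \<or> lt r m y"
    by (rule ex_least[OF WO s], rule that)
  then have m: "f m \<noteq> 0" "\<And>y. f y \<noteq> 0 \<Longrightarrow> y = m \<or> lt r m y" by auto
  then have "f y = 0" if "lt r y m" for y
    using m(2)[of y] lt_asym[OF WO that] that by auto
  moreover have "m \<in> Field r" using m f by (auto simp: fin_supp_def)
  ultimately show ?thesis using m False by blast
qed

lemma low_props: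
  assumes f: "f \<in> fin_supp r"
  shows "low r f \<in> Field r" "f \<noteq> (\<lambda>_. 0) \<Longrightarrow> f (low r f) \<noteq> 0" "lt r y (low r f) \<Longrightarrow> f y = 0"
    "f = (\<lambda>_. 0) \<Longrightarrow> \<not> lt r y (low r f)"
  using someI_ex[OF low_exists[OF f]] unfolding low_def[symmetric] by blast+

lemma low_eqI:
  assumes f: "f \<in> fin_supp r" and b: "f b \<noteq> 0" "\<And>y. lt r y b \<Longrightarrow> f y = 0"
  shows "low r f = b"
proof -
  have "b \<in> Field r" using fin_supp_Field[OF f, of b] b by simp
  moreover have "f (low r f) \<noteq> 0" using low_props(2)[OF f] b(1) by auto
  ultimately show ?thesis
    using lt_linear[OF WO low_props(1)[OF f], of b] low_props(3)[OF f, of b] b(1) b(2)[of "low r f"] by auto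
qed

text \<open>The lower bound is the \<delta> with f = \<delta> + \<open>\<omega>\<^sup>b\<close>.
  Points strictly between are \<delta> + \<eta> with \<eta> nonzero and below
  \<open>\<omega>\<^sup>b\<close>, so their last exponent is below b.\<close>

lemma low_between:
  assumes f: "f \<in> fin_supp r" and b: "f b \<noteq> 0" "\<And>y. lt r y b \<Longrightarrow> f y = 0"
    and y: "y \<in> fin_supp r" "below r (f(b := f b - 1)) y" "below r y f"
  shows "lt r (low r y) b"
proof -
  let ?d = "f(b := f b - 1)"
  have d: "?d \<in> fin_supp r" by (rule fin_supp_mono[OF f]) (auto split: if_splits)
  have bF: "b \<in> Field r" using fin_supp_Field[OF f, of b] b by simp
  obtain p where p: "p \<in> Field r" "y p < f p" "\<And>z. lt r p z \<Longrightarrow> y z = f z"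
    using below_Field[OF WO f y(3)] by blast
  obtain q where q: "q \<in> Field r" "?d q < y q" "\<And>z. lt r q z \<Longrightarrow> ?d z = y z"
    using below_Field[OF WO y(1,2)] by blast
  have "\<not> lt r p b" using p(2) b(2) by force
  moreover have "\<not> lt r b p"
  proof
    assume bp: "lt r b p"
    have "y z = ?d z" if "lt r p z" for z
      using p(3)[OF that] lt_trans[OF WO bp that] by auto
    moreover have "y p < ?d p" using p(2) bp by auto
    ultimately have "below r y ?d" unfolding below_def by blast
    then show False using below_asym[OF WO d y(1,2)] by blast
  qed
  ultimately have pb: "p = b" using lt_linear[OF WO p(1) bF] by blast
  have "\<not> lt r b q" using q(2) p(3)[of q] pb by (auto split: if_splits)
  moreover have "q \<noteq> b" using q(2) p(2) pb by auto
  ultimately have qb: "lt r q b" using lt_linear[OF WO q(1) bF] by blast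
  have "\<not> lt r q (low r y)" using q(2) low_props(3)[OF y(1), of q] by auto
  then have "low r y = q \<or> lt r (low r y) q" using lt_linear[OF WO q(1) low_props(1)[OF y(1)]] by blast
  then show ?thesis using qb lt_trans[OF WO] by blast
qed

text \<open>The leading difference p between a and f is at least the last exponent of f, hence above
  d. A term \<open>\<omega>\<^sup>d\<close> added to a does not reach p, so the sum stays below
  f.\<close>

lemma low_approx:
  assumes f: "f \<in> fin_supp r" and d: "lt r d (low r f)" and a: "a \<in> fin_supp r" "below r a f"
  defines "y \<equiv> cnf_add r a (single d 1)"
  shows "y \<in> fin_supp r" "below r a y" "below r y f" "low r y = d"
proof -
  have dF: "d \<in> Field r" using d by (simp add: lt_Field)
  have s: "single d 1 \<in> fin_supp r" using dF by (rule single_fin_supp)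
  show yF: "y \<in> fin_supp r" unfolding y_def by (rule cnf_add_fin_supp[OF WO a(1) s])
  have "below r (\<lambda>_. 0) (single d 1)"
    by (rule below_zero[OF WO s]) (auto simp: single_def fun_eq_iff)
  from cnf_add_mono[OF WO this, of a] show "below r a y" by (simp add: y_def)
  have yd: "y d \<noteq> 0" using lt_irrefl[of r d] by (auto simp: y_def cnf_add_def single_def)
  have ylt: "y z = 0" if "lt r z d" for z
    using that by (auto simp: y_def cnf_add_def single_def)
  have ygt: "y z = a z" if "lt r d z" for z
    using that lt_asym[OF WO that] by (auto simp: y_def cnf_add_def single_def)
  show "low r y = d" by (rule low_eqI[OF yF yd ylt])
  obtain p where p: "p \<in> Field r" "a p < f p" "\<And>z. lt r p z \<Longrightarrow> a z = f z"
    using below_Field[OF WO f a(2)] by blast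
  have "\<not> lt r p (low r f)" using p(2) low_props(3)[OF f, of p] by auto
  then have "lt r d p" using lt_linear[OF WO p(1) low_props(1)[OF f]] d lt_trans[OF WO] by blast
  then have "y p < f p" using ygt p(2) by simp
  moreover have "y z = f z" if "lt r p z" for z
    using ygt[OF lt_trans[OF WO \<open>lt r d p\<close> that]] p(3)[OF that] by simp
  ultimately show "below r y f" unfolding below_def by blast
qed

text \<open>Near x only smaller ranks occur by \<open>low_between\<close>, and
  \<open>low_approx\<close> supplies points of any prescribed smaller rank arbitrarily close to x.
  Both facts are local, so they pass to an open S.\<close>

lemma rank_fun_low:
  assumes S: "openin (exp_space r) S"
  shows "rank_fun (subtopology (exp_space r) S) r (low r)"
proof -
  have SF: "S \<subseteq> fin_supp r" using S openin_subset topspace_exp_space[OF WO] by metis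
  have T: "topspace (subtopology (exp_space r) S) = S" using SF topspace_exp_space[OF WO] by auto
  have op: "openin (subtopology (exp_space r) S) U \<longleftrightarrow> openin (exp_space r) U \<and> U \<subseteq> S" for U
    by (rule openin_open_subtopology[OF S])
  show ?thesis
    unfolding rank_fun_def T op
  proof (intro conjI ballI allI impI)
    show "low r ` S \<subseteq> Field r" using low_props(1) SF by auto
    fix x assume x: "x \<in> S"
    then have xF: "x \<in> fin_supp r" using SF by blast
    show "\<exists>U. (openin (exp_space r) U \<and> U \<subseteq> S) \<and> x \<in> U \<and> (\<forall>y\<in>U. y \<noteq> x \<longrightarrow> lt r (low r y) (low r x))"
    proof (cases "x = (\<lambda>_. 0)")
      \<comment> \<open>There is no last term to lower, but 0 is isolated.\<close>
      case True
      have "openin (exp_space r) {\<lambda>_. 0}" using openin_iic[OF WO xF] True by (simp add: iic_zero[OF WO])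
      then show ?thesis using True x by (intro exI[of _ "{\<lambda>_. 0}"]) auto
    next
      case False
      let ?b = "low r x"
      let ?d = "x(?b := x ?b - 1)"
      have d: "?d \<in> fin_supp r" by (rule fin_supp_mono[OF xF]) (auto split: if_splits)
      have "below r ?d x"
        unfolding below_def using low_props(2)[OF xF False] by (intro exI[of _ ?b]) auto
      let ?U = "S \<inter> (ioi r ?d \<inter> iic r x)"
      have "openin (exp_space r) ?U"
        by (intro openin_Int S openin_ioi[OF WO d] openin_iic[OF WO xF])
      moreover have "x \<in> ?U" using x xF \<open>below r ?d x\<close> by (auto simp: ioi_def iic_def)
      moreover have "lt r (low r y) ?b" if "y \<in> ?U" "y \<noteq> x" for y
        using that low_between[OF xF low_props(2)[OF xF False] low_props(3)[OF xF], of y]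
        by (auto simp: ioi_def iic_def)
      ultimately show ?thesis by (intro exI[of _ ?U]) blast
    qed
  next
    fix x U d assume x: "x \<in> S" and U: "openin (exp_space r) U \<and> U \<subseteq> S" "x \<in> U" and d: "lt r d (low r x)"
    have xF: "x \<in> fin_supp r" using SF x by blast
    have "x \<noteq> (\<lambda>_. 0)" using d low_props(4)[OF xF] by blast
    then obtain a where a: "a \<in> fin_supp r" "below r a x"
      "\<forall>y\<in>fin_supp r. below r a y \<longrightarrow> y = x \<or> below r y x \<longrightarrow> y \<in> U"
      using U unfolding openin_exp_space[OF WO] by blast
    note y = low_approx[OF xF d a(1,2)]
    have "cnf_add r a (single d 1) \<in> U" using a(3) y by blast
    moreover have "cnf_add r a (single d 1) \<noteq> x" using y(3) below_neq by blast
    moreover have "(d, low r (cnf_add r a (single d 1))) \<in> r"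
      unfolding y(4) using d lt_Field wo_refl[OF WO] by metis
    ultimately show "\<exists>y\<in>U. y \<noteq> x \<and> (d, low r y) \<in> r" by blast
  qed
qed

lemma topspace_segment:
  "f \<in> fin_supp r \<Longrightarrow> topspace (subtopology (exp_space r) (iio r f)) = iio r f"
  using topspace_exp_space[OF WO] by (auto simp: iio_def)

text \<open>The initial segments below \<open>f\<close> cover, and a finite subfamily misses \<open>z + \<omega>\<^sup>d < f\<close>,
  where \<open>z\<close> is the largest bound.\<close>
lemma not_compactin_low:
  assumes f: "f \<in> fin_supp r" and d: "lt r d (low r f)"
  shows "\<not> compactin (subtopology (exp_space r) (iio r f)) {x \<in> iio r f. (d, low r x) \<in> r}"
proof
  let ?K = "{x \<in> iio r f. (d, low r x) \<in> r}"
  assume "compactin (subtopology (exp_space r) (iio r f)) ?K"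
  then have c: "compactin (exp_space r) ?K" by (simp add: compactin_subtopology)
  have f0: "f \<noteq> (\<lambda>_. 0)" using d low_props(4)[OF f] by blast
  have dr: "(d, d) \<in> r" using d lt_Field wo_refl[OF WO] by metis
  let ?y = "\<lambda>z. cnf_add r z (single d 1)"
  have y: "?y z \<in> ?K" "below r z (?y z)" if "z \<in> iio r f" for z
  proof -
    have z: "z \<in> fin_supp r" "below r z f" using that by (auto simp: iio_def)
    note a = low_approx[OF f d z]
    show "?y z \<in> ?K" "below r z (?y z)" using a dr by (auto simp: iio_def)
  qed
  have op: "Ball (iio r ` iio r f) (openin (exp_space r))"
    using openin_iio[OF WO] by (auto simp: iio_def)
  have cov: "?K \<subseteq> \<Union> (iio r ` iio r f)"
  proof
    fix x assume x: "x \<in> ?K"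
    then have "x \<in> iio r (?y x)" using y(2)[of x] by (auto simp: iio_def)
    moreover have "?y x \<in> iio r f" using y(1)[of x] x by blast
    ultimately show "x \<in> \<Union> (iio r ` iio r f)" by blast
  qed
  obtain \<F> where "finite \<F>" "\<F> \<subseteq> iio r ` iio r f" "?K \<subseteq> \<Union> \<F>"
    using c op cov unfolding compactin_def by meson
  then obtain Z where Z: "Z \<subseteq> iio r f" "finite Z" "\<F> = iio r ` Z"
    using finite_subset_image by meson
  have zero: "(\<lambda>_. 0) \<in> iio r f" using below_zero[OF WO f f0] by (auto simp: iio_def)
  then have "?y (\<lambda>_. 0) \<in> \<Union> \<F>" using y(1) \<open>?K \<subseteq> \<Union> \<F>\<close> by blast
  then have "Z \<noteq> {}" using Z(3) by auto
  have "Z \<subseteq> Field (omega_exp r)" using Z(1) Field_omega_exp[OF WO] by (auto simp: iio_def)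
  obtain m where m: "m \<in> Z" "\<And>z. z \<in> Z \<Longrightarrow> z = m \<or> lt (omega_exp r) z m"
    by (rule ex_greatest[OF Well_order_omega_exp[OF WO] Z(2) \<open>Z \<noteq> {}\<close> \<open>Z \<subseteq> Field (omega_exp r)\<close>], rule that)
  have mF: "m \<in> iio r f" using m(1) Z(1) by blast
  have "?y m \<in> \<Union> \<F>" using y(1)[OF mF] \<open>?K \<subseteq> \<Union> \<F>\<close> by blast
  then obtain z where z: "z \<in> Z" "?y m \<in> iio r z" using Z(3) by blast
  have F: "m \<in> fin_supp r" "z \<in> fin_supp r" "?y m \<in> fin_supp r"
    using mF z Z(1) y(1)[OF mF] by (auto simp: iio_def)
  have "below r m z" using below_trans[OF WO F(3,2) y(2)[OF mF]] z(2) by (auto simp: iio_def)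
  moreover have "z = m \<or> below r z m" using m(2)[OF z(1)] by (auto simp: lt_omega_exp[OF WO])
  ultimately show False using below_asym[OF WO F(1,2)] below_irrefl[of r m] by blast
qed

lemma compactin_iic: "g \<in> fin_supp r \<Longrightarrow> compactin (exp_space r) (iic r g)"
  unfolding exp_space_def iic_under[OF WO] by (rule compactin_under[OF Well_order_omega_exp[OF WO]])

text \<open>Each point has a neighbourhood on which its own rank is the largest, so the points of
  rank less than d form an open set.\<close>

lemma closedin_rank_ge:
  assumes \<rho>: "rank_fun X r \<rho>" and d: "d \<in> Field r"
  shows "closedin X {x \<in> topspace X. (d, \<rho> x) \<in> r}"
proof -
  have eq: "topspace X - {x \<in> topspace X. (d, \<rho> x) \<in> r} = {x \<in> topspace X. lt r (\<rho> x) d}"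
  proof -
    have "(d, \<rho> x) \<notin> r \<longleftrightarrow> lt r (\<rho> x) d" if "x \<in> topspace X" for x
      using le_iff_lt[OF WO, of d "\<rho> x"] lt_linear[OF WO d rank_fun_Field[OF \<rho> that]] d
        lt_asym[OF WO, of d "\<rho> x"] lt_irrefl[of r d] by metis
    then show ?thesis by blast
  qed
  have "openin X {x \<in> topspace X. lt r (\<rho> x) d}"
  proof (subst openin_subopen, intro ballI)
    fix x assume x: "x \<in> {x \<in> topspace X. lt r (\<rho> x) d}"
    then obtain U where U: "openin X U" "x \<in> U" "\<And>y. y \<in> U \<Longrightarrow> y \<noteq> x \<Longrightarrow> lt r (\<rho> y) (\<rho> x)"
      using rank_fun_nhd[OF \<rho>, of x] by blast
    have "lt r (\<rho> y) d" if "y \<in> U" for y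
      using U(3)[OF that] x lt_trans[OF WO, of "\<rho> y" "\<rho> x" d] by (cases "y = x") auto
    then have "U \<subseteq> {x \<in> topspace X. lt r (\<rho> x) d}" using openin_subset[OF U(1)] by blast
    then show "\<exists>T. openin X T \<and> x \<in> T \<and> T \<subseteq> {x \<in> topspace X. lt r (\<rho> x) d}" using U by blast
  qed
  then show ?thesis unfolding closedin_def eq by blast
qed

section \<open>Segments whose leading exponent is the top of the host\<close>

context
  fixes t
  assumes top: "t \<in> Field r" "\<And>y. y \<in> Field r \<Longrightarrow> y = t \<or> lt r y t" and nonmin: "underS r t \<noteq> {}"
begin

text \<open>Keeps the default rank of 0 apart from t, so that 0 is not counted among the top points.
  This is where \<alpha> being nonzero enters.\<close>

lemma low_zero_less_top: "lt r (low r (\<lambda>_. 0)) t"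
proof -
  obtain d where d: "lt r d t" using nonmin by (auto simp: underS_lt)
  have "low r (\<lambda>_. 0) \<noteq> t" using d low_props(4)[OF zero_fin_supp] by blast
  then show ?thesis using top(2) low_props(1)[OF zero_fin_supp] by blast
qed

text \<open>If the last exponent is the greatest one available, it is also the leading one and there
  is only one term.\<close>

lemma low_eq_top_iff:
  assumes x: "x \<in> fin_supp r"
  shows "low r x = t \<longleftrightarrow> x = single t (x t) \<and> x t \<noteq> 0"
proof
  assume l: "low r x = t"
  then have x0: "x \<noteq> (\<lambda>_. 0)" using low_zero_less_top by auto
  have "x y = single t (x t) y" for y
  proof (cases "y = t")
    case False
    then have "x y = 0"
      using low_props(3)[OF x, of y] l top(2)[of y] fin_supp_Field[OF x, of y] by auto
    then show ?thesis using False by (simp add: single_def)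
  qed (simp add: single_def)
  then have "x = single t (x t)" by (rule ext)
  moreover have "x t \<noteq> 0" using low_props(2)[OF x x0] unfolding l .
  ultimately show "x = single t (x t) \<and> x t \<noteq> 0" ..
next
  assume h: "x = single t (x t) \<and> x t \<noteq> 0"
  have "x y = 0" if "lt r y t" for y
  proof -
    have "y \<noteq> t" using that by auto
    then have "single t (x t) y = 0" by (simp add: single_def)
    then show ?thesis using fun_cong[OF conjunct1[OF h], of y] by argo
  qed
  then show "low r x = t" using low_eqI[OF x conjunct2[OF h]] by blast
qed

text \<open>For d below t the points \<open>\<omega>\<^sup>d (n + 1)\<close> already form an
  infinite fibre, and rank t is attained only at the points \<open>\<omega>\<^sup>t i\<close> with i
  nonzero.\<close>

lemma big_ranks_segment:
  assumes f: "f \<in> fin_supp r" and sub: "\<And>g. g \<in> fin_supp r \<Longrightarrow> g t = 0 \<Longrightarrow> g \<in> iio r f"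
    and fin: "finite {i. i \<noteq> 0 \<and> single t i \<in> iio r f}"
  shows "big_ranks (subtopology (exp_space r) (iio r f)) r (low r) = underS r t"
    "card {x \<in> topspace (subtopology (exp_space r) (iio r f)).
       low r x \<notin> big_ranks (subtopology (exp_space r) (iio r f)) r (low r)}
     = card {i. i \<noteq> 0 \<and> single t i \<in> iio r f}"
proof -
  let ?X = "subtopology (exp_space r) (iio r f)"
  note T = topspace_segment[OF f]
  have iF: "x \<in> fin_supp r" if "x \<in> iio r f" for x using that by (simp add: iio_def)
  have fib: "{x \<in> iio r f. low r x = t} = single t ` {i. i \<noteq> 0 \<and> single t i \<in> iio r f}"
  proof (intro subset_antisym subsetI)
    fix x assume x: "x \<in> {x \<in> iio r f. low r x = t}"
    then have "x = single t (x t) \<and> x t \<noteq> 0" using low_eq_top_iff[OF iF] by blast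
    then show "x \<in> single t ` {i. i \<noteq> 0 \<and> single t i \<in> iio r f}"
      using x by (metis (mono_tags, lifting) image_eqI mem_Collect_eq)
  next
    fix x assume "x \<in> single t ` {i. i \<noteq> 0 \<and> single t i \<in> iio r f}"
    then obtain i where i: "i \<noteq> 0" "x \<in> iio r f" "x = single t i" by blast
    then have "x t = i" by (simp add: single_def)
    then show "x \<in> {x \<in> iio r f. low r x = t}" using i low_eq_top_iff[OF iF[OF i(2)]] by simp
  qed
  have inf: "infinite {x \<in> iio r f. low r x = d}" if d: "lt r d t" for d
  proof -
    have dF: "d \<in> Field r" using d by (simp add: lt_Field)
    \<comment> \<open>\<open>Suc\<close> avoids the coefficient 0, which would give the zero point
      with its default rank.\<close>
    have "range (\<lambda>n. single d (Suc n)) \<subseteq> {x \<in> iio r f. low r x = d}"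
    proof
      fix x assume "x \<in> range (\<lambda>n. single d (Suc n))"
      then obtain n where x: "x = single d (Suc n)" by blast
      have xF: "x \<in> fin_supp r" unfolding x by (rule single_fin_supp[OF dF])
      have "x t = 0" using d by (auto simp: x single_def)
      moreover have "x d \<noteq> 0" by (simp add: x single_def)
      moreover have "x y = 0" if "lt r y d" for y using that by (auto simp: x single_def)
      ultimately show "x \<in> {x \<in> iio r f. low r x = d}" using sub[OF xF] low_eqI[OF xF] by simp
    qed
    moreover have "infinite (range (\<lambda>n. single d (Suc n)))"
      by (rule range_inj_infinite) (auto simp: inj_on_def single_eq_iff)
    ultimately show ?thesis using infinite_super by blast
  qed
  show big: "big_ranks ?X r (low r) = underS r t"
  proof (intro subset_antisym subsetI)
    fix d assume d: "d \<in> big_ranks ?X r (low r)"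
    have "finite {x \<in> iio r f. low r x = t}" unfolding fib using fin by simp
    then have "d \<noteq> t" using d unfolding big_ranks_def T by blast
    then show "d \<in> underS r t" using d top(2) by (auto simp: big_ranks_def underS_lt)
  next
    fix d assume "d \<in> underS r t"
    then have "lt r d t" by (simp add: underS_lt)
    then show "d \<in> big_ranks ?X r (low r)"
      unfolding big_ranks_def T using inf lt_Field by auto
  qed
  have "low r x \<notin> underS r t \<longleftrightarrow> low r x = t" if "x \<in> iio r f" for x
    using top(2)[OF low_props(1)[OF iF[OF that]]] by (auto simp: underS_lt)
  then have "{x \<in> topspace ?X. low r x \<notin> big_ranks ?X r (low r)} = {x \<in> iio r f. low r x = t}"
    unfolding big T by blast
  then show "card {x \<in> topspace ?X. low r x \<notin> big_ranks ?X r (low r)}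
      = card {i. i \<noteq> 0 \<and> single t i \<in> iio r f}"
    unfolding fib by (simp add: card_image inj_on_def single_eq_iff)
qed

text \<open>The last exponent of the bound is t itself, so every rank below t is noncompact and the
  second invariant is \<alpha> again.\<close>

lemma rank_type_single:
  assumes k: "0 < k" and \<alpha>: "(Restr r (underS r t), \<alpha>) \<in> ordIso"
  shows "rank_type (subtopology (exp_space r) (iio r (single t k))) r (low r) \<alpha> \<alpha> (k - 1)"
proof -
  let ?f = "single t k"
  let ?X = "subtopology (exp_space r) (iio r ?f)"
  have f: "?f \<in> fin_supp r" by (rule single_fin_supp[OF top(1)])
  have no: "\<not> lt r t y" for y using top(2)[of y] lt_Field(2)[of r t y] lt_asym[OF WO, of t y] by auto
  have D: "g \<in> iio r ?f \<longleftrightarrow> g \<in> fin_supp r \<and> g t < k" for g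
    using no by (auto simp: iio_single[OF WO top(1)])
  \<comment> \<open>The end point \<open>\<omega>\<^sup>t k\<close> is missing and i = 0 is the zero
    point, hence k - 1 points remain.\<close>
  have I: "{i. i \<noteq> 0 \<and> single t i \<in> iio r ?f} = {1..<k}"
    unfolding D using single_fin_supp[OF top(1)] by (auto simp: single_def)
  have sub: "g \<in> iio r ?f" if "g \<in> fin_supp r" "g t = 0" for g
    using that k unfolding D by simp
  have fin: "finite {i. i \<noteq> 0 \<and> single t i \<in> iio r ?f}" unfolding I by simp
  have big: "big_ranks ?X r (low r) = underS r t"
    by (rule big_ranks_segment(1)[OF f sub fin])
  have card: "card {x \<in> topspace ?X. low r x \<notin> big_ranks ?X r (low r)} = card {i. i \<noteq> 0 \<and> single t i \<in> iio r ?f}"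
    by (rule big_ranks_segment(2)[OF f sub fin])
  have low: "low r ?f = t"
    by (rule low_eqI[OF f]) (use k in \<open>auto simp: single_def\<close>)
  have "noncompact_ranks ?X r (low r) = underS r t"
    unfolding noncompact_ranks_def big topspace_segment[OF f]
    using not_compactin_low[OF f] unfolding low by (auto simp: underS_lt)
  then show ?thesis
    unfolding rank_type_def using WO rank_fun_low[OF openin_iio[OF WO f]] card I big \<alpha> \<open>noncompact_ranks ?X r (low r) = underS r t\<close> by simp
qed

text \<open>Behind \<open>\<omega>\<^sup>t k\<close> only ranks below b occur, so the points of rank
  at least b lie in the compact initial segment ending at \<open>\<omega>\<^sup>t k\<close>, while
  each rank below b accumulates at the missing end point.\<close>

lemma rank_type_two_terms:
  assumes k: "0 < k" and bt: "lt r b t"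
    and \<alpha>: "(Restr r (underS r t), \<alpha>) \<in> ordIso" and \<beta>: "(Restr r (underS r b), \<beta>) \<in> ordIso"
  shows "rank_type (subtopology (exp_space r) (iio r (cnf_add r (single t k) (single b 1)))) r (low r) \<alpha> \<beta> k"
proof -
  let ?f = "cnf_add r (single t k) (single b 1)"
  let ?X = "subtopology (exp_space r) (iio r ?f)"
  have bF: "b \<in> Field r" using bt by (rule lt_Field)
  have P: "single t k \<in> fin_supp r" by (rule single_fin_supp[OF top(1)])
  have f: "?f \<in> fin_supp r" by (rule cnf_add_fin_supp[OF WO P single_fin_supp[OF bF]])
  have no: "\<not> lt r t y" for y using top(2)[of y] lt_Field(2)[of r t y] lt_asym[OF WO, of t y] by auto
  have D: "g \<in> iio r ?f \<longleftrightarrow> g \<in> fin_supp r \<and>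
      (g t < k \<or> g t = k \<and> (\<forall>y. lt r y t \<longrightarrow> \<not> lt r y b \<longrightarrow> g y = 0))" for g
    unfolding iio_two_terms[OF WO bt] using no by auto
  \<comment> \<open>Now \<open>\<omega>\<^sup>t k\<close> lies below the bound, so i = k counts as
    well.\<close>
  have I: "{i. i \<noteq> 0 \<and> single t i \<in> iio r ?f} = {1..k}"
    unfolding D using single_fin_supp[OF top(1)] lt_irrefl[of r t] by (auto simp: single_def)
  have sub: "g \<in> iio r ?f" if "g \<in> fin_supp r" "g t = 0" for g
    using that k unfolding D by simp
  have fin: "finite {i. i \<noteq> 0 \<and> single t i \<in> iio r ?f}" unfolding I by simp
  have big: "big_ranks ?X r (low r) = underS r t"
    by (rule big_ranks_segment(1)[OF f sub fin])
  have card: "card {x \<in> topspace ?X. low r x \<notin> big_ranks ?X r (low r)} = card {i. i \<noteq> 0 \<and> single t i \<in> iio r ?f}"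
    by (rule big_ranks_segment(2)[OF f sub fin])
  have fe: "?f = (\<lambda>y. if y = t then k else if y = b then 1 else 0)" by (rule cnf_add_single_single[OF WO bt])
  have btn: "b \<noteq> t" using bt by auto
  have fb: "?f b \<noteq> 0" unfolding fe by simp (use k in simp)
  have flow: "?f y = 0" if "lt r y b" for y
    using that lt_irrefl[of r b] lt_asym[OF WO bt] unfolding fe by auto
  have low: "low r ?f = b" by (rule low_eqI[OF f fb flow])
  \<comment> \<open>Identifies the left end of the interval in \<open>low_between\<close>: dropping
    the last term leaves \<open>\<omega>\<^sup>t k\<close>.\<close>
  have fP: "?f(b := ?f b - 1) = single t k" unfolding fe using btn by (auto simp: single_def fun_eq_iff)
  note rk = rank_fun_low[OF openin_iio[OF WO f]]
  have "compactin ?X {x \<in> iio r ?f. (d, low r x) \<in> r}" if d: "lt r d t" "\<not> lt r d b" for d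
  proof (rule closed_compactin)
    have dF: "d \<in> Field r" using d by (simp add: lt_Field)
    show "closedin ?X {x \<in> iio r ?f. (d, low r x) \<in> r}"
      using closedin_rank_ge[OF rk dF] unfolding topspace_segment[OF f] .
    have "iic r (single t k) \<subseteq> iio r ?f"
    proof
      fix x assume x: "x \<in> iic r (single t k)"
      then have xF: "x \<in> fin_supp r" by (simp add: iic_def)
      have "x = single t k \<or> x \<in> iio r (single t k)" using x by (auto simp: iic_def iio_def)
      then show "x \<in> iio r ?f"
        using xF unfolding D iio_single[OF WO top(1)] by (auto simp: single_def)
    qed
    then show "compactin ?X (iic r (single t k))"
      using compactin_iic[OF P] by (simp add: compactin_subtopology)
    show "{x \<in> iio r ?f. (d, low r x) \<in> r} \<subseteq> iic r (single t k)"
    proof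
      fix x assume x: "x \<in> {x \<in> iio r ?f. (d, low r x) \<in> r}"
      then have xF: "x \<in> fin_supp r" "below r x ?f" by (auto simp: iio_def)
      show "x \<in> iic r (single t k)"
      proof (rule ccontr)
        assume "x \<notin> iic r (single t k)"
        then have "below r (single t k) x" using below_linear[OF WO xF(1) P] xF(1) by (auto simp: iic_def)
        then have "lt r (low r x) b"
          using low_between[OF f fb flow xF(1) _ xF(2)] unfolding fP by blast
        moreover have "d = low r x \<or> lt r d (low r x)" using x by (auto simp: lt_def)
        ultimately show False using d(2) lt_trans[OF WO] by blast
      qed
    qed
  qed
  moreover have "\<not> compactin ?X {x \<in> iio r ?f. (d, low r x) \<in> r}" if "lt r d b" for d
    using not_compactin_low[OF f] that unfolding low by blast
  ultimately have "noncompact_ranks ?X r (low r) = underS r b"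
    unfolding noncompact_ranks_def big topspace_segment[OF f] underS_lt
    using lt_trans[OF WO _ bt] by blast
  then show ?thesis
    unfolding rank_type_def using WO rk card I big \<alpha> \<beta> \<open>noncompact_ranks ?X r (low r) = underS r b\<close> by simp
qed

end

end

subsection \<open>Non-redundancy\<close>

text \<open>The order is \<alpha> + 1, the host in which \<alpha> itself is available as an
  exponent, namely as the top element \<open>Inr ()\<close>.\<close>

lemma Well_order_osum_one:
  assumes \<alpha>: "Well_order \<alpha>"
  shows "Well_order (osum \<alpha> one_ord)"
proof -
  let ?r = "osum \<alpha> one_ord"
  note A = wo_Refl_antisym[OF \<alpha>]
  have one: "Refl one_ord" "antisym one_ord" "Field one_ord = {()}"
    by (auto simp: one_ord_def Field_def refl_on_def antisym_def)
  have F: "Field ?r = Inl ` Field \<alpha> \<union> {Inr ()}"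
    unfolding Field_osum[OF A(1) one(1)] one(3) by simp
  have iff: "(Inl a, Inl a') \<in> ?r \<longleftrightarrow> (a, a') \<in> \<alpha>" "(Inl a, Inr u) \<in> ?r \<longleftrightarrow> a \<in> Field \<alpha>"
    "(Inr u, Inl a) \<notin> ?r" "(Inr u, Inr v) \<in> ?r" for a a' u v
    by (auto simp: osum_iff one(3)) (auto simp: one_ord_def)
  have "trans ?r"
  proof (rule transI)
    fix x y z assume xyz: "(x, y) \<in> ?r" "(y, z) \<in> ?r"
    show "(x, z) \<in> ?r"
    proof (cases x)
      case x: (Inl a)
      show ?thesis
      proof (cases z)
        case z: (Inl c)
        obtain b where y: "y = Inl b" using xyz(2) z iff(3) by (cases y) auto
        show ?thesis using xyz wo_trans[OF \<alpha>, of a b c] unfolding x y z iff by blast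
      next
        case z: (Inr c)
        have "x \<in> Field ?r" using xyz(1) by (rule FieldI1)
        then show ?thesis unfolding x z iff F by auto
      qed
    next
      case x: (Inr u)
      obtain v where y: "y = Inr v" using xyz(1) x iff(3) by (cases y) auto
      obtain w where z: "z = Inr w" using xyz(2) y iff(3) by (cases z) auto
      show ?thesis unfolding x z by (rule iff(4))
    qed
  qed
  moreover have "Total ?r"
    unfolding total_on_def F using wo_linear[OF \<alpha>] by (auto simp: iff)
  moreover have "wf (?r - Id)"
  proof (rule wf_subset)
    \<comment> \<open>Lexicographic measure with tag 1 for the top element; its second coordinate is
      a placeholder that is never compared.\<close>
    let ?g = "\<lambda>z. case z of Inl a \<Rightarrow> (0::nat, a) | Inr _ \<Rightarrow> (1, undefined)"
    show "wf (inv_image (less_than <*lex*> (\<alpha> - Id)) ?g)"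
      by (intro wf_inv_image wf_lex_prod wf_less_than wo_rel.WF wo_rel.intro \<alpha>)
    show "?r - Id \<subseteq> inv_image (less_than <*lex*> (\<alpha> - Id)) ?g"
    proof (rule subrelI)
      fix x y assume "(x, y) \<in> ?r - Id"
      then show "(x, y) \<in> inv_image (less_than <*lex*> (\<alpha> - Id)) ?g"
        by (cases x; cases y) (auto simp: iff)
    qed
  qed
  moreover have "?r \<subseteq> Field ?r \<times> Field ?r" by (auto intro: FieldI1 FieldI2)
  ultimately show ?thesis
    using osum_order[OF A(1) one(1) A(2) one(2)]
    unfolding well_order_on_def linear_order_on_def partial_order_on_def preorder_on_def by blast
qed

lemma lt_osum_one:
  "lt (osum \<alpha> one_ord) (Inl a) (Inl b) \<longleftrightarrow> lt \<alpha> a b"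
  "lt (osum \<alpha> one_ord) (Inl a) (Inr u) \<longleftrightarrow> a \<in> Field \<alpha>"
  "\<not> lt (osum \<alpha> one_ord) (Inr u) x"
proof -
  have "Field one_ord = {()}" by (auto simp: one_ord_def Field_def)
  then show "lt (osum \<alpha> one_ord) (Inl a) (Inl b) \<longleftrightarrow> lt \<alpha> a b"
    "lt (osum \<alpha> one_ord) (Inl a) (Inr u) \<longleftrightarrow> a \<in> Field \<alpha>"
    "\<not> lt (osum \<alpha> one_ord) (Inr u) x"
    by (auto simp: lt_def osum_def)
qed

lemma underS_osum_one:
  "underS (osum \<alpha> one_ord) (Inl b) = Inl ` underS \<alpha> b"
  "underS (osum \<alpha> one_ord) (Inr ()) = Inl ` Field \<alpha>"
proof -
  have *: "x \<in> underS (osum \<alpha> one_ord) y \<longleftrightarrow> x \<in> Inl ` {a. lt (osum \<alpha> one_ord) (Inl a) y}" for x y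
    unfolding underS_lt using lt_osum_one(3) by (cases x) auto
  show "underS (osum \<alpha> one_ord) (Inl b) = Inl ` underS \<alpha> b"
    unfolding set_eq_iff * lt_osum_one by (simp add: underS_lt)
  show "underS (osum \<alpha> one_ord) (Inr ()) = Inl ` Field \<alpha>"
    unfolding set_eq_iff * lt_osum_one by simp
qed

lemma seg_iso_ordIso:
  assumes r: "Well_order r" and \<beta>: "Well_order \<beta>" and e: "seg_iso \<beta> r b e"
  shows "(Restr r (underS r b), \<beta>) \<in> ordIso"
proof -
  have "iso \<beta> (Restr r (underS r b)) e"
    unfolding iso_iff2 wo_Restr_underS[OF r]
  proof (intro conjI ballI)
    show bij: "bij_betw e (Field \<beta>) (underS r b)" using e by (simp add: seg_iso_def)
    fix x y assume "x \<in> Field \<beta>" "y \<in> Field \<beta>"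
    moreover from this have "e x \<in> underS r b" "e y \<in> underS r b"
      using bij by (auto simp: bij_betw_def)
    ultimately show "(x, y) \<in> \<beta> \<longleftrightarrow> (e x, e y) \<in> Restr r (underS r b)"
      using e by (simp add: seg_iso_def)
  qed
  then have "(\<beta>, Restr r (underS r b)) \<in> ordIso"
    unfolding ordIso_def using \<beta> Well_order_Restr[OF r] by blast
  then show ?thesis by (rule ordIso_symmetric)
qed

lemma seg_iso_osum_one:
  "seg_iso \<alpha> (osum \<alpha> one_ord) (Inr ()) Inl"
  unfolding seg_iso_def underS_osum_one by (auto simp: bij_betw_def osum_iff)

text \<open>A smaller ordinal is the segment of \<alpha> below some b, and adding a top element does
  not change that segment.\<close>

lemma seg_iso_osum_one_ordLess:
  assumes \<alpha>: "Well_order \<alpha>" and less: "(\<beta>, \<alpha>) \<in> ordLess"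
  obtains b e where "b \<in> Field \<alpha>" "seg_iso \<beta> (osum \<alpha> one_ord) (Inl b) e"
proof -
  have \<beta>: "Well_order \<beta>" using less by (auto simp: ordLess_def)
  obtain b F where b: "b \<in> Field \<alpha>" and F: "iso \<beta> (Restr \<alpha> (underS \<alpha> b)) F"
    using less ordLess_iff_ordIso_Restr[OF \<alpha> \<beta>] by (auto simp: ordIso_def)
  have bij: "bij_betw F (Field \<beta>) (underS \<alpha> b)"
    and ord: "\<forall>x\<in>Field \<beta>. \<forall>y\<in>Field \<beta>. (x, y) \<in> \<beta> \<longleftrightarrow> (F x, F y) \<in> Restr \<alpha> (underS \<alpha> b)"
    using F unfolding iso_iff2 wo_Restr_underS[OF \<alpha>] by blast+
  have "seg_iso \<beta> (osum \<alpha> one_ord) (Inl b) (Inl \<circ> F)"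
    unfolding seg_iso_def underS_osum_one
  proof (intro conjI ballI)
    show "bij_betw (Inl \<circ> F) (Field \<beta>) (Inl ` underS \<alpha> b)"
      by (rule bij_betw_trans[OF bij]) (simp add: bij_betw_def)
    fix x y assume "x \<in> Field \<beta>" "y \<in> Field \<beta>"
    moreover from this have "F x \<in> underS \<alpha> b" "F y \<in> underS \<alpha> b"
      using bij by (auto simp: bij_betw_def)
    ultimately show "(x, y) \<in> \<beta> \<longleftrightarrow> ((Inl \<circ> F) x, (Inl \<circ> F) y) \<in> osum \<alpha> one_ord"
      using ord by (simp add: osum_iff)
  qed
  then show thesis using that b by blast
qed

lemma osum_one_top:
  assumes \<alpha>: "Well_order \<alpha>" and ne: "Field \<alpha> \<noteq> {}"
  shows "Field (osum \<alpha> one_ord) \<noteq> {}" "Inr () \<in> Field (osum \<alpha> one_ord)"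
    "\<And>y. y \<in> Field (osum \<alpha> one_ord) \<Longrightarrow> y = Inr () \<or> lt (osum \<alpha> one_ord) y (Inr ())"
    "underS (osum \<alpha> one_ord) (Inr ()) \<noteq> {}"
proof -
  have one: "Refl one_ord" "Field one_ord = {()}"
    by (auto simp: one_ord_def Field_def refl_on_def)
  have F: "Field (osum \<alpha> one_ord) = Inl ` Field \<alpha> \<union> {Inr ()}"
    unfolding Field_osum[OF wo_Refl_antisym(1)[OF \<alpha>] one(1)] one(2) by simp
  show "Field (osum \<alpha> one_ord) \<noteq> {}" "Inr () \<in> Field (osum \<alpha> one_ord)" unfolding F by auto
  show "y = Inr () \<or> lt (osum \<alpha> one_ord) y (Inr ())" if "y \<in> Field (osum \<alpha> one_ord)" for y
    using that lt_osum_one(2)[of \<alpha>] unfolding F by auto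
  show "underS (osum \<alpha> one_ord) (Inr ()) \<noteq> {}" unfolding underS_osum_one using ne by simp
qed

section \<open>Invariants of the infinite families\<close>

lemma nf3_rank_type:
  assumes "ok23 \<alpha> k"
  obtains \<rho> where "rank_type (nf3 \<alpha> k) (osum \<alpha> one_ord) \<rho> \<alpha> \<alpha> (k - 1)"
proof -
  have \<alpha>: "Well_order \<alpha>" "Field \<alpha> \<noteq> {}" and k: "0 < k" using assms by (auto simp: ok23_def)
  note WO = Well_order_osum_one[OF \<alpha>(1)] and top = osum_one_top[OF \<alpha>]
  note iso = seg_iso_ordIso[OF WO \<alpha>(1) seg_iso_osum_one]
  show thesis
    using rank_type_homeomorphic[OF rank_type_single[OF WO top k iso]
        homeomorphic_space_sym[THEN iffD1, OF iio_single_nf3[OF WO \<alpha>(1) top(2) seg_iso_osum_one]]] that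
    by blast
qed

text \<open>Here \<beta> has its own type and may be empty, so that families (4) and (2) are treated
  together.\<close>

lemma two_terms_rank_type:
  fixes \<alpha> :: "'a rel" and \<beta> :: "'b rel"
  assumes \<alpha>: "Well_order \<alpha>" "Field \<alpha> \<noteq> {}" and k: "0 < k" and less: "(\<beta>, \<alpha>) \<in> ordLess"
  obtains \<rho> where "rank_type (ord_space (osum (oprod (omega_exp \<alpha>) (fin_ord k)) (omega_exp \<beta>)))
    (osum \<alpha> one_ord) \<rho> \<alpha> \<beta> k"
proof -
  note WO = Well_order_osum_one[OF \<alpha>(1)] and top = osum_one_top[OF \<alpha>]
  have \<beta>: "Well_order \<beta>" using less by (auto simp: ordLess_def)
  obtain b e where b: "b \<in> Field \<alpha>" and e: "seg_iso \<beta> (osum \<alpha> one_ord) (Inl b) e"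
    by (rule seg_iso_osum_one_ordLess[OF \<alpha>(1) less])
  have bt: "lt (osum \<alpha> one_ord) (Inl b) (Inr ())" using b by (simp add: lt_osum_one)
  note iso = seg_iso_ordIso[OF WO \<alpha>(1) seg_iso_osum_one] seg_iso_ordIso[OF WO \<beta> e]
  show thesis
    using rank_type_homeomorphic[OF rank_type_two_terms[OF WO top k bt iso]
        homeomorphic_space_sym[THEN iffD1, OF iio_two_terms_nf4[OF WO \<alpha>(1) \<beta> bt seg_iso_osum_one e]]] that
    by blast
qed

lemma nf4_rank_type:
  assumes "ok4 \<alpha> \<beta> k"
  obtains \<rho> where "rank_type (nf4 \<alpha> \<beta> k) (osum \<alpha> one_ord) \<rho> \<alpha> \<beta> k"
  using assms that unfolding ok4_def nf4_def by (metis two_terms_rank_type)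

text \<open>The two-term case with \<beta> = 0, represented by the empty relation. It is less than
  \<alpha>, being the segment under the least element of \<alpha>.\<close>

lemma nf2_rank_type:
  fixes \<alpha> :: "'a rel"
  assumes "ok23 \<alpha> k"
  obtains \<rho> where "rank_type (nf2 \<alpha> k) (osum \<alpha> one_ord) \<rho> \<alpha> ({} :: 'a rel) k"
proof -
  have \<alpha>: "Well_order \<alpha>" "Field \<alpha> \<noteq> {}" and k: "0 < k" using assms by (auto simp: ok23_def)
  have E: "Well_order ({} :: 'a rel)" "Field ({} :: 'a rel) = {}" by simp_all
  obtain m where m: "m \<in> Field \<alpha>" "\<And>y. y \<in> Field \<alpha> \<Longrightarrow> y = m \<or> lt \<alpha> m y"
    by (rule ex_least[OF \<alpha>(1) subset_refl \<alpha>(2)], rule that)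
  have "underS \<alpha> m = {}"
    using m(2) lt_asym[OF \<alpha>(1)] lt_Field(1) lt_irrefl unfolding underS_lt by (metis (no_types, lifting) Collect_empty_eq)
  then have "Restr \<alpha> (underS \<alpha> m) = {}" by simp
  then have less: "({} :: 'a rel, \<alpha>) \<in> ordLess"
    using underS_Restr_ordLess[OF \<alpha>, of m] by simp
  obtain \<rho> where "rank_type (ord_space (osum (oprod (omega_exp \<alpha>) (fin_ord k)) (omega_exp ({} :: 'a rel))))
    (osum \<alpha> one_ord) \<rho> \<alpha> ({} :: 'a rel) k"
    by (rule two_terms_rank_type[OF \<alpha> k less])
  from rank_type_homeomorphic[OF this homeomorphic_space_sym[THEN iffD1, OF nf2_osum[OF \<alpha>(1) E]]]
  show thesis using that by blast
qed

section \<open>Separating families and parameters\<close>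

lemma ordIso_empty: "({}, \<alpha>) \<in> ordIso \<Longrightarrow> Field \<alpha> = {}"
  using iso_Field unfolding ordIso_def by fastforce

lemma homeomorphic_finite_card:
  assumes "X homeomorphic_space Y"
  shows "finite (topspace X) \<longleftrightarrow> finite (topspace Y)" "card (topspace X) = card (topspace Y)"
proof -
  obtain h where h: "homeomorphic_map X Y h" using assms homeomorphic_space by blast
  have i: "inj_on h (topspace X)" and im: "h ` topspace X = topspace Y"
    using homeomorphic_imp_injective_map[OF h] homeomorphic_imp_surjective_map[OF h] by auto
  show "finite (topspace X) \<longleftrightarrow> finite (topspace Y)" using finite_image_iff[OF i] im by simp
  show "card (topspace X) = card (topspace Y)" using card_image[OF i] im by simp
qed

lemma topspace_nf1: "topspace (nf1 k) = {..<k}"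
  by (simp add: nf1_def Field_fin_ord)

lemma nf1_not_homeomorphic:
  assumes "rank_type X r \<rho> \<alpha> \<beta> n" "Field \<alpha> \<noteq> {}"
  shows "\<not> nf1 k homeomorphic_space X"
  using rank_type_infinite[OF assms] homeomorphic_finite_card(1)[of "nf1 k" X] by (auto simp: topspace_nf1)

lemma nf1_inj: "nf1 k homeomorphic_space nf1 k' \<Longrightarrow> k = k'"
  using homeomorphic_finite_card(2)[of "nf1 k" "nf1 k'"] by (simp add: topspace_nf1)

lemma nf2_inj:
  fixes \<alpha> :: "'a rel" and \<alpha>' :: "'b rel"
  assumes ok: "ok23 \<alpha> k" "ok23 \<alpha>' k'" and hom: "nf2 \<alpha> k homeomorphic_space nf2 \<alpha>' k'"
  shows "(\<alpha>, \<alpha>') \<in> ordIso \<and> k = k'"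
proof -
  obtain \<rho> where R: "rank_type (nf2 \<alpha> k) (osum \<alpha> one_ord) \<rho> \<alpha> ({} :: 'a rel) k" by (rule nf2_rank_type[OF ok(1)])
  obtain \<sigma> where S: "rank_type (nf2 \<alpha>' k') (osum \<alpha>' one_ord) \<sigma> \<alpha>' ({} :: 'b rel) k'" by (rule nf2_rank_type[OF ok(2)])
  show ?thesis using rank_type_homeomorphic_unique[OF R S hom] by simp
qed

text \<open>The invariant is k - 1; positivity of both multiplicities makes the truncated
  subtraction injective.\<close>

lemma nf3_inj:
  assumes ok: "ok23 \<alpha> k" "ok23 \<alpha>' k'" and hom: "nf3 \<alpha> k homeomorphic_space nf3 \<alpha>' k'"
  shows "(\<alpha>, \<alpha>') \<in> ordIso \<and> k = k'"
proof -
  obtain \<rho> where R: "rank_type (nf3 \<alpha> k) (osum \<alpha> one_ord) \<rho> \<alpha> \<alpha> (k - 1)" by (rule nf3_rank_type[OF ok(1)])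
  obtain \<sigma> where S: "rank_type (nf3 \<alpha>' k') (osum \<alpha>' one_ord) \<sigma> \<alpha>' \<alpha>' (k' - 1)" by (rule nf3_rank_type[OF ok(2)])
  show ?thesis using rank_type_homeomorphic_unique[OF R S hom] ok by (auto simp: ok23_def)
qed

lemma nf4_inj:
  assumes ok: "ok4 \<alpha> \<beta> k" "ok4 \<alpha>' \<beta>' k'" and hom: "nf4 \<alpha> \<beta> k homeomorphic_space nf4 \<alpha>' \<beta>' k'"
  shows "(\<alpha>, \<alpha>') \<in> ordIso \<and> (\<beta>, \<beta>') \<in> ordIso \<and> k = k'"
proof -
  obtain \<rho> where R: "rank_type (nf4 \<alpha> \<beta> k) (osum \<alpha> one_ord) \<rho> \<alpha> \<beta> k" by (rule nf4_rank_type[OF ok(1)])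
  obtain \<sigma> where S: "rank_type (nf4 \<alpha>' \<beta>' k') (osum \<alpha>' one_ord) \<sigma> \<alpha>' \<beta>' k'" by (rule nf4_rank_type[OF ok(2)])
  show ?thesis by (rule rank_type_homeomorphic_unique[OF R S hom])
qed

lemma nf1_nf2:
  fixes \<alpha> :: "'a rel"
  assumes ok: "ok23 \<alpha> k'"
  shows "\<not> nf1 k homeomorphic_space nf2 \<alpha> k'"
proof -
  obtain \<rho> where R: "rank_type (nf2 \<alpha> k') (osum \<alpha> one_ord) \<rho> \<alpha> ({} :: 'a rel) k'" by (rule nf2_rank_type[OF ok])
  show ?thesis by (rule nf1_not_homeomorphic[OF R]) (use ok in \<open>simp add: ok23_def\<close>)
qed

lemma nf1_nf3:
  assumes ok: "ok23 \<alpha> k'"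
  shows "\<not> nf1 k homeomorphic_space nf3 \<alpha> k'"
proof -
  obtain \<rho> where R: "rank_type (nf3 \<alpha> k') (osum \<alpha> one_ord) \<rho> \<alpha> \<alpha> (k' - 1)" by (rule nf3_rank_type[OF ok])
  show ?thesis by (rule nf1_not_homeomorphic[OF R]) (use ok in \<open>simp add: ok23_def\<close>)
qed

lemma nf1_nf4:
  assumes ok: "ok4 \<alpha> \<beta> k'"
  shows "\<not> nf1 k homeomorphic_space nf4 \<alpha> \<beta> k'"
proof -
  obtain \<rho> where R: "rank_type (nf4 \<alpha> \<beta> k') (osum \<alpha> one_ord) \<rho> \<alpha> \<beta> k'" by (rule nf4_rank_type[OF ok])
  show ?thesis by (rule nf1_not_homeomorphic[OF R]) (use ok in \<open>simp add: ok4_def\<close>)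
qed

text \<open>Family (2) has no noncompact ranks, whereas in family (3) they have the nonzero type
  \<alpha>'.\<close>

lemma nf2_nf3:
  fixes \<alpha> :: "'a rel" and \<alpha>' :: "'b rel"
  assumes ok: "ok23 \<alpha> k" "ok23 \<alpha>' k'"
  shows "\<not> nf2 \<alpha> k homeomorphic_space nf3 \<alpha>' k'"
proof
  assume hom: "nf2 \<alpha> k homeomorphic_space nf3 \<alpha>' k'"
  obtain \<rho> where R: "rank_type (nf2 \<alpha> k) (osum \<alpha> one_ord) \<rho> \<alpha> ({} :: 'a rel) k" by (rule nf2_rank_type[OF ok(1)])
  obtain \<sigma> where S: "rank_type (nf3 \<alpha>' k') (osum \<alpha>' one_ord) \<sigma> \<alpha>' \<alpha>' (k' - 1)" by (rule nf3_rank_type[OF ok(2)])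
  show False
    using rank_type_homeomorphic_unique[OF R S hom] ordIso_empty ok(2) unfolding ok23_def by blast
qed

text \<open>As before, now with the nonzero type \<beta>' of the noncompact ranks in family
  (4).\<close>

lemma nf2_nf4:
  fixes \<alpha> :: "'a rel" and \<alpha>' :: "'b rel"
  assumes ok: "ok23 \<alpha> k" "ok4 \<alpha>' \<beta>' k'"
  shows "\<not> nf2 \<alpha> k homeomorphic_space nf4 \<alpha>' \<beta>' k'"
proof
  assume hom: "nf2 \<alpha> k homeomorphic_space nf4 \<alpha>' \<beta>' k'"
  obtain \<rho> where R: "rank_type (nf2 \<alpha> k) (osum \<alpha> one_ord) \<rho> \<alpha> ({} :: 'a rel) k" by (rule nf2_rank_type[OF ok(1)])
  obtain \<sigma> where S: "rank_type (nf4 \<alpha>' \<beta>' k') (osum \<alpha>' one_ord) \<sigma> \<alpha>' \<beta>' k'" by (rule nf4_rank_type[OF ok(2)])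
  show False
    using rank_type_homeomorphic_unique[OF R S hom] ordIso_empty ok(2) unfolding ok4_def by blast
qed

text \<open>In family (3) both order invariants are \<alpha>. Equality with those of family (4)
  would identify \<beta>' with \<alpha>', although \<beta>' is less.\<close>

lemma nf3_nf4:
  assumes ok: "ok23 \<alpha> k" "ok4 \<alpha>' \<beta>' k'"
  shows "\<not> nf3 \<alpha> k homeomorphic_space nf4 \<alpha>' \<beta>' k'"
proof
  assume hom: "nf3 \<alpha> k homeomorphic_space nf4 \<alpha>' \<beta>' k'"
  obtain \<rho> where R: "rank_type (nf3 \<alpha> k) (osum \<alpha> one_ord) \<rho> \<alpha> \<alpha> (k - 1)" by (rule nf3_rank_type[OF ok(1)])
  obtain \<sigma> where S: "rank_type (nf4 \<alpha>' \<beta>' k') (osum \<alpha>' one_ord) \<sigma> \<alpha>' \<beta>' k'" by (rule nf4_rank_type[OF ok(2)])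
  have "(\<alpha>, \<alpha>') \<in> ordIso" "(\<alpha>, \<beta>') \<in> ordIso"
    using rank_type_homeomorphic_unique[OF R S hom] by auto
  then have "(\<beta>', \<alpha>') \<in> ordIso" by (rule ordIso_transitive[OF ordIso_symmetric, rotated])
  then show False using not_ordLess_ordIso ok(2) unfolding ok4_def by blast
qed

theorem theorem27:
  shows
  \<comment> \<open>Existence: every ordinal space is homeomorphic to one in the list
     (parameters \<alpha>, \<beta> may be taken on the same type as \<gamma>).\<close>
  "(\<forall>\<gamma> :: 'a rel. Well_order \<gamma> \<longrightarrow>
      (\<exists>k. ord_space \<gamma> homeomorphic_space nf1 k) \<or>
      (\<exists>(\<alpha> :: 'a rel) k. ok23 \<alpha> k \<and> ord_space \<gamma> homeomorphic_space nf2 \<alpha> k) \<or>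
      (\<exists>(\<alpha> :: 'a rel) k. ok23 \<alpha> k \<and> ord_space \<gamma> homeomorphic_space nf3 \<alpha> k) \<or>
      (\<exists>(\<alpha> :: 'a rel) \<beta> k. ok4 \<alpha> \<beta> k \<and> ord_space \<gamma> homeomorphic_space nf4 \<alpha> \<beta> k))
   \<and>
  \<comment> \<open>No redundancy within a family.\<close>
   (\<forall>k k'. nf1 k homeomorphic_space nf1 k' \<longrightarrow> k = k')
   \<and>
   (\<forall>(\<alpha> :: 'b rel) k (\<alpha>' :: 'c rel) k'. ok23 \<alpha> k \<and> ok23 \<alpha>' k' \<and>
       nf2 \<alpha> k homeomorphic_space nf2 \<alpha>' k' \<longrightarrow> (\<alpha>, \<alpha>') \<in> ordIso \<and> k = k')
   \<and>
   (\<forall>(\<alpha> :: 'b rel) k (\<alpha>' :: 'c rel) k'. ok23 \<alpha> k \<and> ok23 \<alpha>' k' \<and>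
       nf3 \<alpha> k homeomorphic_space nf3 \<alpha>' k' \<longrightarrow> (\<alpha>, \<alpha>') \<in> ordIso \<and> k = k')
   \<and>
   (\<forall>(\<alpha> :: 'b rel) \<beta> k (\<alpha>' :: 'c rel) \<beta>' k'. ok4 \<alpha> \<beta> k \<and> ok4 \<alpha>' \<beta>' k' \<and>
       nf4 \<alpha> \<beta> k homeomorphic_space nf4 \<alpha>' \<beta>' k' \<longrightarrow> (\<alpha>, \<alpha>') \<in> ordIso \<and> (\<beta>, \<beta>') \<in> ordIso \<and> k = k')
   \<and>
  \<comment> \<open>No redundancy across families.\<close>
   (\<forall>k (\<alpha> :: 'b rel) k'. ok23 \<alpha> k' \<longrightarrow> \<not> nf1 k homeomorphic_space nf2 \<alpha> k')
   \<and>
   (\<forall>k (\<alpha> :: 'b rel) k'. ok23 \<alpha> k' \<longrightarrow> \<not> nf1 k homeomorphic_space nf3 \<alpha> k')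
   \<and>
   (\<forall>k (\<alpha> :: 'b rel) \<beta> k'. ok4 \<alpha> \<beta> k' \<longrightarrow> \<not> nf1 k homeomorphic_space nf4 \<alpha> \<beta> k')
   \<and>
   (\<forall>(\<alpha> :: 'b rel) k (\<alpha>' :: 'c rel) k'. ok23 \<alpha> k \<and> ok23 \<alpha>' k' \<longrightarrow>
       \<not> nf2 \<alpha> k homeomorphic_space nf3 \<alpha>' k')
   \<and>
   (\<forall>(\<alpha> :: 'b rel) k (\<alpha>' :: 'c rel) \<beta>' k'. ok23 \<alpha> k \<and> ok4 \<alpha>' \<beta>' k' \<longrightarrow>
       \<not> nf2 \<alpha> k homeomorphic_space nf4 \<alpha>' \<beta>' k')
   \<and>
   (\<forall>(\<alpha> :: 'b rel) k (\<alpha>' :: 'c rel) \<beta>' k'. ok23 \<alpha> k \<and> ok4 \<alpha>' \<beta>' k' \<longrightarrow>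
       \<not> nf3 \<alpha> k homeomorphic_space nf4 \<alpha>' \<beta>' k')"
proof (intro conjI, goal_cases)
  case 1
  show ?case using ord_space_classification by blast
next
  case 2
  show ?case using nf1_inj by blast
next
  case 3
  show ?case using nf2_inj by blast
next
  case 4
  show ?case using nf3_inj by blast
next
  case 5
  show ?case using nf4_inj by blast
next
  case 6
  show ?case using nf1_nf2 by blast
next
  case 7
  show ?case using nf1_nf3 by blast
next
  case 8
  show ?case using nf1_nf4 by blast
next
  case 9
  show ?case using nf2_nf3 by blast
next
  case 10
  show ?case using nf2_nf4 by blast
next
  case 11
  show ?case using nf3_nf4 by blast
qed

end
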